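(* Let $d\ge 1$ and let $p,q$ satisfy either $1<p\le q\le 2$ or $2\le q\le p<\infty$. Let $m\in L^\infty(\mathbb R^+)$ and suppose that $\|m\|_{L^2_{\beta,sloc}}<\infty$ for some $\beta>(2d+1)/2$. Then the Hermite multiplier operator $m(H)$ is bounded on the modulation space $M^{q,p}(\mathbb R^d)$.
   Context: $H=-\Delta+|x|^2$ on $\mathbb R^d$. The normalized Hermite functions $\Phi_\alpha(x)=\prod_{j=1}^d h_{\alpha_j}(x_j)$, $\alpha\in\mathbb N^d$, with $h_k(x)=(\sqrt\pi 2^k k!)^{-1/2}(-1)^k e^{x^2/2}\frac{d^k}{dx^k}e^{-x^2}$, form an orthonormal basis of $L^2(\mathbb R^d)$ and $H\Phi_\alpha=(2|\alpha|+d)\Phi_\alpha$, $|\alpha|=\alpha_1+\dots+\alpha_d$. Writing $P_kf=\sum_{|\alpha|=k}\langle f,\Phi_\alpha\rangle\Phi_\alpha$, one defines $m(H)f=\sum_{k=0}^\infty m(2k+d)P_kf$. Fix $0\ne\psi\in C_0^\infty(\mathbb R^+)$ supported in $[1/2,1]$; the scale-invariant localized Sobolev norm is $\|m\|_{L^2_{\beta,sloc}}=\sup_{t>0}\|\psi\, m(t\,\cdot)\|_{L^2_\beta}$, where $L^2_\beta(\mathbb R)$ is the $L^2$-Sobolev (Bessel potential) space of order $\beta$. Modulation spaces: for a fixed window $0\neq g\in\mathcal S(\mathbb R^d)$, the short-time Fourier transform of $f\in\mathcal S'(\mathbb R^d)$ is $V_gf(x,y)=(2\pi)^{-d/2}\int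 f(t)\overline{g(t-x)}e^{-iy\cdot t}\,dt$, and for $1\le r,s<\infty$, $M^{r,s}(\mathbb R^d)$ is the space of $f\in\mathcal S'(\mathbb R^d)$ with $\|f\|_{M^{r,s}}=\big(\int_{\mathbb R^d}(\int_{\mathbb R^d}|V_gf(x,y)|^r dx)^{s/r}dy\big)^{1/s}<\infty$ (independent of $g$ up to equivalence). Bounded means $\|m(H)f\|_{M^{q,p}}\lesssim\|f\|_{M^{q,p}}$ for $f$ in a dense class (e.g. $\mathcal S$), hence a bounded extension.
   Formalization: m is assumed continuous on (0,∞): m(H) uses the point values m(2k+d), which an L^∞ class does not determine; the Sobolev condition gives each such m a unique continuous representative, and with arbitrary values at the points 2k+d the claim fails. *)

theory Defs
  imports "HOL-Analysis.Analysis"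
begin

text \<open>Normalized 1-d Hermite function via the Rodrigues formula:
  h_k(x) = (sqrt pi 2^k k!)^(-1/2) (-1)^k e^(x^2/2) (d/dx)^k e^(-x^2).\<close>
definition hermite_fun :: "nat \<Rightarrow> real \<Rightarrow> real" where
  "hermite_fun k x =
     (sqrt pi * 2 ^ k * fact k) powr (-1/2) * (-1) ^ k * exp (x\<^sup>2 / 2) *
     (deriv ^^ k) (\<lambda>t. exp (- (t\<^sup>2))) x"

definition hermite_Phi :: "('n::finite \<Rightarrow> nat) \<Rightarrow> real ^ 'n \<Rightarrow> real" where
  "hermite_Phi \<alpha> x = (\<Prod>j\<in>UNIV. hermite_fun (\<alpha> j) (x $ j))"

definition multi_abs :: "('n::finite \<Rightarrow> nat) \<Rightarrow> nat" where
  "multi_abs \<alpha> = (\<Sum>j\<in>UNIV. \<alpha> j)"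

definition hermite_coeff :: "(real ^ 'n::finite \<Rightarrow> complex) \<Rightarrow> ('n \<Rightarrow> nat) \<Rightarrow> complex" where
  "hermite_coeff f \<alpha> = (\<integral>x. f x * complex_of_real (hermite_Phi \<alpha> x) \<partial>lborel)"

definition hermite_proj :: "nat \<Rightarrow> (real ^ 'n::finite \<Rightarrow> complex) \<Rightarrow> real ^ 'n \<Rightarrow> complex" where
  "hermite_proj k f x =
     (\<Sum>\<alpha>\<in>{\<alpha>::'n \<Rightarrow> nat. multi_abs \<alpha> = k}. hermite_coeff f \<alpha> * complex_of_real (hermite_Phi \<alpha> x))"

text \<open>Hermite multiplier m(H) f = sum_k m(2k+d) P_k f (pointwise series; for Schwartz f
  this converges absolutely and uniformly and agrees with the L^2 limit).\<close>
definition hermite_mult :: "(real \<Rightarrow> complex) \<Rightarrow> (real ^ 'n::finite \<Rightarrow> complex) \<Rightarrow> real ^ 'n \<Rightarrow> complex" where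
  "hermite_mult m f x =
     (\<Sum>k. m (real (2 * k + CARD('n))) * hermite_proj k f x)"

definition partial_coord :: "'n::finite \<Rightarrow> (real ^ 'n \<Rightarrow> complex) \<Rightarrow> real ^ 'n \<Rightarrow> complex" where
  "partial_coord i f x = vector_derivative (\<lambda>t. f (x + t *\<^sub>R axis i 1)) (at 0)"

definition iter_partial :: "'n::finite list \<Rightarrow> (real ^ 'n \<Rightarrow> complex) \<Rightarrow> real ^ 'n \<Rightarrow> complex" where
  "iter_partial js f = foldr partial_coord js f"

definition schwartz :: "(real ^ 'n::finite \<Rightarrow> complex) set" where
  "schwartz = {f.
     (\<forall>js i x. (\<lambda>t. iter_partial js f (x + t *\<^sub>R axis i 1)) differentiable (at 0)) \<and>
     (\<forall>js. continuous_on UNIV (iter_partial js f)) \<and>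
     (\<forall>js (N::nat). \<exists>C. \<forall>x. (1 + norm x) ^ N * cmod (iter_partial js f x) \<le> C)}"

definition stft :: "(real ^ 'n::finite \<Rightarrow> complex) \<Rightarrow> (real ^ 'n \<Rightarrow> complex) \<Rightarrow> real ^ 'n \<Rightarrow> real ^ 'n \<Rightarrow> complex" where
  "stft g f x y = complex_of_real ((2 * pi) powr (- real CARD('n) / 2)) *
     (\<integral>t. f t * cnj (g (t - x)) * exp (- \<i> * complex_of_real (y \<bullet> t)) \<partial>lborel)"

definition enn_powr :: "ennreal \<Rightarrow> real \<Rightarrow> ennreal" where
  "enn_powr a e = (if a = \<infinity> then \<infinity> else ennreal (enn2real a powr e))"

definition mod_norm :: "(real ^ 'n::finite \<Rightarrow> complex) \<Rightarrow> real \<Rightarrow> real \<Rightarrow> (real ^ 'n \<Rightarrow> complex) \<Rightarrow> ennreal" where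
  "mod_norm g r s f =
     enn_powr (\<integral>\<^sup>+ y. enn_powr (\<integral>\<^sup>+ x. ennreal (cmod (stft g f x y) powr r) \<partial>lborel) (s / r) \<partial>lborel) (1 / s)"

definition fourier1 :: "(real \<Rightarrow> complex) \<Rightarrow> real \<Rightarrow> complex" where
  "fourier1 u \<xi> = complex_of_real ((2 * pi) powr (-1/2)) *
     (\<integral>x. u x * exp (- \<i> * complex_of_real (x * \<xi>)) \<partial>lborel)"

definition sobolev_norm :: "real \<Rightarrow> (real \<Rightarrow> complex) \<Rightarrow> ennreal" where
  "sobolev_norm \<beta> u =
     enn_powr (\<integral>\<^sup>+ \<xi>. ennreal ((1 + \<xi>\<^sup>2) powr \<beta> * (cmod (fourier1 u \<xi>))\<^sup>2) \<partial>lborel) (1/2)"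

definition sloc_norm :: "(real \<Rightarrow> real) \<Rightarrow> real \<Rightarrow> (real \<Rightarrow> complex) \<Rightarrow> ennreal" where
  "sloc_norm \<psi> \<beta> m = (SUP t\<in>{0<..}. sobolev_norm \<beta> (\<lambda>x. complex_of_real (\<psi> x) * m (t * x)))"

definition admissible_cutoff :: "(real \<Rightarrow> real) \<Rightarrow> bool" where
  "admissible_cutoff \<psi> \<longleftrightarrow>
     (\<forall>k x. (deriv ^^ k) \<psi> differentiable (at x)) \<and>
     (\<forall>x. \<psi> x \<noteq> 0 \<longrightarrow> x \<in> {1/2..1}) \<and>
     (\<exists>x. \<psi> x \<noteq> 0)"

definition Linfty_pos :: "(real \<Rightarrow> complex) \<Rightarrow> bool" where
  "Linfty_pos m \<longleftrightarrow> m \<in> borel_measurable (restrict_space lborel {0<..}) \<and>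
     (\<exists>C. AE x in lborel. x > 0 \<longrightarrow> cmod (m x) \<le> C)"

end

theory Submission
  imports Defs "HOL-Complex_Analysis.Complex_Analysis" "HOL-Probability.Probability"
begin

text \<open>Let $g_0$ be the normalized Gaussian and $\pi(z)g_0$, $z = (x,y)$, its phase-space shifts.
  All of the analysis is carried by the matrix of $m(H)$ with respect to these coherent states:
  for every $\gamma < \beta - 1/2$,
  $|\langle m(H)\pi(w)g_0, \pi(z)g_0\rangle| \le C (1 + |z-w|^2)^{-\gamma}$.
  For $m(\lambda) = e^{is\lambda}$ the operator rotates phase space by the angle $2s$, so the matrix entry is
  a Gaussian in the distance of $z$ to the rotated $w$. Near $\lambda \sim A = (|z|^2+|w|^2)/4$ the
  multiplier is a superposition of such exponentials whose coefficients are controlled by the local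
  Sobolev norm of $m$ at scale $A$; the other values of $\lambda$ have exponentially small weight, as the
  expansion of a coherent state in Hermite functions is Poisson distributed. Since
  $\beta > d + 1/2$ allows $\gamma > d$, the kernel $(1+|z|^2)^{-\gamma}$ is integrable on
  $\mathbb R^{2d}$, and Minkowski's integral inequality gives the bound in every mixed norm with
  exponents at least $1$. Moyal's identity passes between the window $g$ and the Gaussian.\<close>

section \<open>Fourier inversion and Parseval's identity\<close>

text \<open>Why the squared distance decays at the rate \<gamma>: at a scale t \<ge> A the frequency
  \<xi> of the localized multiplier acts as a rotation by an angle of order |\<xi>|/A, which moves
  points of radius about sqrt A by |\<xi>|/sqrt A. If |z-w|^2 = 4 D, carrying w near z takes |\<xi>|
  at least of order sqrt (A D), and since D \<le> 2 A this is at least of order D. So \<gamma>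
  powers of the frequency pay for \<gamma> powers of D. Passing from an L^2 bound of order \<beta>
  to a weighted L^1 bound of order \<gamma> for the Fourier transform costs 1/2, whence \<gamma> <
  \<beta> - 1/2. The operator m(H) is never expanded in coherent states. Its adjoint is applied to a
  single wave packet instead, which gives an absolutely convergent Hermite series with a localized
  transform, and Moyal's identity pairs this with the Schwartz function f. Only absolute values
  enter, so an inequality with a possibly infinite right side is enough.\<close>

abbreviation iexpn :: "real \<Rightarrow> complex" where
  "iexpn x \<equiv> exp (- \<i> * complex_of_real x)"

lemma
  fixes f :: "'a::euclidean_space \<Rightarrow> real \<Rightarrow> 'b::{real_normed_field,banach,second_countable_topology}"
  assumes f: "\<And>b. b \<in> Basis \<Longrightarrow> integrable lborel (f b)"
  shows integrable_lborel_prod: "integrable lborel (\<lambda>x::'a. \<Prod>b\<in>Basis. f b (x \<bullet> b))"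
    and integral_lborel_prod:
      "(\<integral>x. (\<Prod>b\<in>Basis. f b (x \<bullet> b)) \<partial>lborel) = (\<Prod>b\<in>Basis. \<integral>t. f b t \<partial>lborel)"
proof -
  interpret product_sigma_finite "\<lambda>_::'a. lborel :: real measure"
    by standard
  have [measurable]: "\<And>b. b \<in> Basis \<Longrightarrow> f b \<in> borel_measurable borel"
    using f by (auto dest: borel_measurable_integrable)
  show "integrable lborel (\<lambda>x::'a. \<Prod>b\<in>Basis. f b (x \<bullet> b))"
    using product_integrable_prod[OF finite_Basis f]
    by (subst lborel_eq) (simp add: integrable_distr_eq)
  show "(\<integral>x. (\<Prod>b\<in>Basis. f b (x \<bullet> b)) \<partial>lborel) = (\<Prod>b\<in>Basis. \<integral>t. f b t \<partial>lborel)"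
    using product_integral_prod[OF finite_Basis f]
    by (subst lborel_eq) (simp add: integral_distr)
qed

lemma
  fixes f :: "'a::euclidean_space \<Rightarrow> 'b::{banach, second_countable_topology}"
  assumes c: "c \<noteq> 0" and [measurable]: "f \<in> borel_measurable borel"
  shows lborel_integral_affine:
      "(\<integral>x. f x \<partial>lborel) = \<bar>c\<bar> ^ DIM('a) *\<^sub>R (\<integral>x. f (t + c *\<^sub>R x) \<partial>lborel)"
    and lborel_integrable_affine_iff:
      "integrable lborel (\<lambda>x. f (t + c *\<^sub>R x)) \<longleftrightarrow> integrable lborel f"
proof -
  show "(\<integral>x. f x \<partial>lborel) = \<bar>c\<bar> ^ DIM('a) *\<^sub>R (\<integral>x. f (t + c *\<^sub>R x) \<partial>lborel)"
    by (subst lborel_affine[OF c, of t]) (simp add: integral_density integral_distr)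
  show "integrable lborel (\<lambda>x. f (t + c *\<^sub>R x)) \<longleftrightarrow> integrable lborel f"
  proof -
    have "integrable lborel f \<longleftrightarrow> integrable lborel (\<lambda>x. (\<bar>c\<bar> ^ DIM('a)) *\<^sub>R f (t + c *\<^sub>R x))"
      by (subst lborel_affine[OF c, of t]) (simp add: integrable_density integrable_distr_eq)
    also have "\<dots> \<longleftrightarrow> integrable lborel (\<lambda>x. f (t + c *\<^sub>R x))"
    proof
      assume "integrable lborel (\<lambda>x. (\<bar>c\<bar> ^ DIM('a)) *\<^sub>R f (t + c *\<^sub>R x))"
      from integrable_scaleR_right[OF this, of "inverse (\<bar>c\<bar> ^ DIM('a))"] c
      show "integrable lborel (\<lambda>x. f (t + c *\<^sub>R x))" by simp
    qed simp
    finally show ?thesis ..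
  qed
qed

lemma gauss_prod:
  "exp (- (norm x)\<^sup>2 / 2) = (\<Prod>b\<in>Basis. exp (- (x \<bullet> b)\<^sup>2 / 2))" for x :: "'a::euclidean_space"
  by (simp add: power2_norm_eq_inner euclidean_inner[of x x] sum_divide_distrib sum_negf
        flip: exp_sum power2_eq_square)

lemma cis_prod:
  "iexp (y \<bullet> x) = (\<Prod>b\<in>Basis. iexp ((y \<bullet> b) * (x \<bullet> b)))"
  for x y :: "'a::euclidean_space"
  by (simp add: euclidean_inner[of y x] sum_distrib_left flip: exp_sum)

lemma
  fixes s :: real
  shows gauss1_integrable: "integrable lborel (\<lambda>x::real. iexp (s * x) * complex_of_real (exp (- x\<^sup>2 / 2)))"
    and gauss1_fourier: "(\<integral>x. iexp (s * x) * complex_of_real (exp (- x\<^sup>2 / 2)) \<partial>lborel)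
      = complex_of_real (sqrt (2 * pi) * exp (- s\<^sup>2 / 2))"
proof -
  have i0: "integrable lborel (\<lambda>x::real. exp (- x\<^sup>2 / 2))"
    using integrable_mult_right[OF integrable_normal_density[of 1 0], of "sqrt (2 * pi)"]
    by (simp add: normal_density_def[abs_def])
  show "integrable lborel (\<lambda>x::real. iexp (s * x) * complex_of_real (exp (- x\<^sup>2 / 2)))"
    by (rule Bochner_Integration.integrable_bound[OF i0]) (auto simp: norm_mult)
  have "complex_of_real (exp (- s\<^sup>2 / 2)) = char std_normal_distribution s"
    by (simp add: char_std_normal_distribution)
  also have "\<dots> = (\<integral>x. std_normal_density x *\<^sub>R iexp (s * x) \<partial>lborel)"
    unfolding char_def by (subst integral_density) auto
  also have "\<dots> = (\<integral>x. complex_of_real (1 / sqrt (2 * pi)) * (iexp (s * x) * complex_of_real (exp (- x\<^sup>2 / 2))) \<partial>lborel)"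
    by (intro Bochner_Integration.integral_cong)
       (auto simp: std_normal_density_def scaleR_conv_of_real)
  also have "\<dots> = complex_of_real (1 / sqrt (2 * pi)) * (\<integral>x. (iexp (s * x) * complex_of_real (exp (- x\<^sup>2 / 2))) \<partial>lborel)"
    by (rule integral_mult_right_zero)
  finally show "(\<integral>x. iexp (s * x) * complex_of_real (exp (- x\<^sup>2 / 2)) \<partial>lborel)
      = complex_of_real (sqrt (2 * pi) * exp (- s\<^sup>2 / 2))"
    by (simp add: field_simps)
qed

lemma
  fixes y :: "'a::euclidean_space"
  shows gauss_integrable: "integrable lborel (\<lambda>x::'a. iexp (y \<bullet> x) * complex_of_real (exp (- (norm x)\<^sup>2 / 2)))"
    and gauss_fourier: "(\<integral>x. iexp (y \<bullet> x) * complex_of_real (exp (- (norm x)\<^sup>2 / 2)) \<partial>lborel)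
      = complex_of_real (sqrt (2 * pi) ^ DIM('a) * exp (- (norm y)\<^sup>2 / 2))"
proof -
  have eq: "iexp (y \<bullet> x) * complex_of_real (exp (- (norm x)\<^sup>2 / 2)) =
     (\<Prod>b\<in>Basis. iexp ((y \<bullet> b) * (x \<bullet> b)) * complex_of_real (exp (- (x \<bullet> b)\<^sup>2 / 2)))" for x
    unfolding gauss_prod cis_prod of_real_prod prod.distrib ..
  show "integrable lborel (\<lambda>x::'a. iexp (y \<bullet> x) * complex_of_real (exp (- (norm x)\<^sup>2 / 2)))"
    unfolding eq by (rule integrable_lborel_prod[OF gauss1_integrable])
  show "(\<integral>x. iexp (y \<bullet> x) * complex_of_real (exp (- (norm x)\<^sup>2 / 2)) \<partial>lborel)
      = complex_of_real (sqrt (2 * pi) ^ DIM('a) * exp (- (norm y)\<^sup>2 / 2))"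
    unfolding eq integral_lborel_prod[OF gauss1_integrable] gauss1_fourier
    unfolding gauss_prod by (simp add: prod.distrib flip: of_real_prod)
qed

lemma gauss_real_integrable: "integrable lborel (\<lambda>x::'a::euclidean_space. exp (- (norm x)\<^sup>2 / 2))"
  using integrable_Re[OF gauss_integrable[of "0::'a"]] by simp

text \<open>Kept without a normalizing factor, so that \<open>fourier1\<close> and
  \<open>stft\<close> are both constant multiples of it; the powers of 2 pi are restored in the
  inversion formula.\<close>

definition fint :: "('a::euclidean_space \<Rightarrow> complex) \<Rightarrow> 'a \<Rightarrow> complex" where
  "fint \<phi> y = (\<integral>t. \<phi> t * iexpn (y \<bullet> t) \<partial>lborel)"

lemma fint_measurable [measurable]:
  assumes [measurable]: "\<phi> \<in> borel_measurable borel"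
  shows "fint \<phi> \<in> borel_measurable borel"
  unfolding fint_def[abs_def] by measurable

text \<open>Gaussian summation. With the factor \<open>?G (e k *\<^sub>R y)\<close> inserted, the
  inverse integral is, by Fubini and the self-duality of the Gaussian, a constant times the average
  \<open>J k\<close> of \<phi> around x at scale \<open>e k\<close>. Continuity and boundedness of
  \<phi> give the limit of \<open>J\<close>; integrability of \<open>fint \<phi>\<close> gives the
  limit of the other side.\<close>

theorem fourier_inversion:
  fixes \<phi> :: "'a::euclidean_space \<Rightarrow> complex"
  assumes cont: "continuous_on UNIV \<phi>" and bdd: "\<And>x. cmod (\<phi> x) \<le> B"
    and int: "integrable lborel \<phi>" and fint: "integrable lborel (fint \<phi>)"
  shows "\<phi> x = complex_of_real (1 / (2 * pi) ^ DIM('a)) * (\<integral>y. fint \<phi> y * iexp (y \<bullet> x) \<partial>lborel)"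
proof -
  have [measurable]: "\<phi> \<in> borel_measurable borel"
    using cont by (rule borel_measurable_continuous_onI)
  have cc: "sqrt (2 * pi) ^ DIM('a) * sqrt (2 * pi) ^ DIM('a) = (2 * pi) ^ DIM('a)"
    by (subst power_mult_distrib[symmetric]) simp
  define e where "e k = 1 / real (Suc k)" for k
  have e0: "e k > 0" for k by (simp add: e_def)
  have elim: "e \<longlonglongrightarrow> 0" unfolding e_def using LIMSEQ_inverse_real_of_nat by (simp add: inverse_eq_divide)
  let ?G = "\<lambda>v::'a. complex_of_real (exp (- (norm v)\<^sup>2 / 2))"
  let ?c = "complex_of_real (sqrt (2 * pi) ^ DIM('a))"
  define J where "J k = (\<integral>v. \<phi> (x + e k *\<^sub>R v) * ?G v \<partial>lborel)" for k
  have "J \<longlonglongrightarrow> (\<integral>v. \<phi> x * ?G v \<partial>lborel)"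
    unfolding J_def
  proof (rule integral_dominated_convergence[where w = "\<lambda>v. B * exp (- (norm v)\<^sup>2 / 2)"])
    show "integrable lborel (\<lambda>v::'a. B * exp (- (norm v)\<^sup>2 / 2))"
      using gauss_real_integrable[where 'a='a] by simp
    show "AE v in lborel. (\<lambda>k. \<phi> (x + e k *\<^sub>R v) * ?G v) \<longlonglongrightarrow> \<phi> x * ?G v"
    proof (intro AE_I2 tendsto_mult tendsto_const)
      fix v
      have "isCont \<phi> x" using cont by (simp add: continuous_on_eq_continuous_at)
      moreover have "(\<lambda>k. x + e k *\<^sub>R v) \<longlonglongrightarrow> x"
        by (rule tendsto_eq_intros elim | simp)+
      ultimately show "(\<lambda>k. \<phi> (x + e k *\<^sub>R v)) \<longlonglongrightarrow> \<phi> x"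
        by (rule isCont_tendsto_compose)
    qed
    show "\<And>k. AE v in lborel. cmod (\<phi> (x + e k *\<^sub>R v) * ?G v) \<le> B * exp (- (norm v)\<^sup>2 / 2)"
      using bdd by (auto simp: norm_mult intro!: mult_right_mono)
  qed measurable
  moreover have "(\<integral>v. ?G v \<partial>lborel) = ?c"
    using gauss_fourier[of "0::'a"] by simp
  ultimately have lim1: "J \<longlonglongrightarrow> \<phi> x * ?c" by (simp only: integral_mult_right_zero)
  \<comment> \<open>\<open>?G v\<close> is replaced by its own transform, which is the origin of the
    factor \<open>?c\<close>. After Fubini, the rescaling of u and the substitution t = x + e v
    inside \<open>fint\<close> produce the same Jacobian.\<close>
  have Jeq: "?c * J k = (\<integral>y. fint \<phi> y * iexp (y \<bullet> x) * ?G (e k *\<^sub>R y) \<partial>lborel)" for k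
  proof -
    let ?e = "e k"
    let ?h = "\<lambda>v u. \<phi> (x + ?e *\<^sub>R v) * (iexp ((- v) \<bullet> u) * ?G u)"
    have ichi: "integrable lborel (\<lambda>v. \<phi> (x + ?e *\<^sub>R v))"
      using int e0[of k] by (subst lborel_integrable_affine_iff) auto
    have "?c * J k = (\<integral>v. \<phi> (x + ?e *\<^sub>R v) * (\<integral>u. iexp ((- v) \<bullet> u) * ?G u \<partial>lborel) \<partial>lborel)"
      unfolding J_def gauss_fourier by (subst integral_mult_right_zero[symmetric]) (simp add: mult_ac)
    also have "\<dots> = (\<integral>v. (\<integral>u. ?h v u \<partial>lborel) \<partial>lborel)"
      by (subst integral_mult_right_zero) simp
    also have "\<dots> = (\<integral>u. (\<integral>v. ?h v u \<partial>lborel) \<partial>lborel)"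
    proof (rule lborel_pair.Fubini_integral[symmetric])
      have "integrable (lborel \<Otimes>\<^sub>M lborel) (\<lambda>(v, u). \<phi> (x + ?e *\<^sub>R v) * ?G u)"
      proof (rule lborel_pair.Fubini_integrable)
        show "integrable lborel (\<lambda>v. LINT u|lborel. norm (case (v, u) of (v, u) \<Rightarrow> \<phi> (x + e k *\<^sub>R v) * ?G u))"
          using ichi by (simp add: norm_mult)
        show "AE v in lborel. integrable lborel (\<lambda>u. case (v, u) of (v, u) \<Rightarrow> \<phi> (x + e k *\<^sub>R v) * ?G u)"
          using gauss_integrable[of "0::'a"] by simp
      qed measurable
      then show "integrable (lborel \<Otimes>\<^sub>M lborel) (\<lambda>(v, u). ?h v u)"
        by (rule Bochner_Integration.integrable_bound) (auto simp: norm_mult)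
    qed
    also have "\<dots> = (\<integral>u. (?e ^ DIM('a)) *\<^sub>R (\<integral>v. ?h v (0 + ?e *\<^sub>R u) \<partial>lborel) \<partial>lborel)"
      using e0[of k] by (subst lborel_integral_affine[where c = ?e and t = 0]) auto
    also have "\<dots> = (\<integral>y. fint \<phi> y * iexp (y \<bullet> x) * ?G (e k *\<^sub>R y) \<partial>lborel)"
    proof (rule Bochner_Integration.integral_cong[OF refl])
      fix y
      have "fint \<phi> y * iexp (y \<bullet> x) * ?G (?e *\<^sub>R y)
          = (\<integral>t. \<phi> t * iexpn (y \<bullet> t) * (iexp (y \<bullet> x) * ?G (?e *\<^sub>R y)) \<partial>lborel)"
        unfolding fint_def by (subst integral_mult_left_zero) simp
      also have "\<dots> = (?e ^ DIM('a)) *\<^sub>R (\<integral>v. \<phi> (x + ?e *\<^sub>R v) * iexpn (y \<bullet> (x + ?e *\<^sub>R v)) * (iexp (y \<bullet> x) * ?G (?e *\<^sub>R y)) \<partial>lborel)"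
        using e0[of k] by (subst lborel_integral_affine[where c = ?e and t = x]) auto
      also have "(\<integral>v. \<phi> (x + ?e *\<^sub>R v) * iexpn (y \<bullet> (x + ?e *\<^sub>R v)) * (iexp (y \<bullet> x) * ?G (?e *\<^sub>R y)) \<partial>lborel)
          = (\<integral>v. ?h v (0 + ?e *\<^sub>R y) \<partial>lborel)"
      proof (rule Bochner_Integration.integral_cong[OF refl])
        fix v
        have "iexpn (y \<bullet> (x + ?e *\<^sub>R v)) * iexp (y \<bullet> x) = iexp ((- v) \<bullet> (0 + ?e *\<^sub>R y))"
          by (simp add: inner_add_right algebra_simps inner_commute flip: exp_add)
        then show "\<phi> (x + ?e *\<^sub>R v) * iexpn (y \<bullet> (x + ?e *\<^sub>R v)) * (iexp (y \<bullet> x) * ?G (?e *\<^sub>R y)) = ?h v (0 + ?e *\<^sub>R y)"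
          by (metis (no_types, lifting) add_0 mult.assoc)
      qed
      finally show "(?e ^ DIM('a)) *\<^sub>R (\<integral>v. ?h v (0 + ?e *\<^sub>R y) \<partial>lborel) = fint \<phi> y * iexp (y \<bullet> x) * ?G (e k *\<^sub>R y)"
        by simp
    qed
    finally show ?thesis .
  qed
  have "(\<lambda>k. \<integral>y. fint \<phi> y * iexp (y \<bullet> x) * ?G (e k *\<^sub>R y) \<partial>lborel)
        \<longlonglongrightarrow> (\<integral>y. fint \<phi> y * iexp (y \<bullet> x) * 1 \<partial>lborel)"
  proof (rule integral_dominated_convergence[where w = "\<lambda>y. cmod (fint \<phi> y)"])
    show "AE y in lborel. (\<lambda>k. fint \<phi> y * iexp (y \<bullet> x) * ?G (e k *\<^sub>R y)) \<longlonglongrightarrow> fint \<phi> y * iexp (y \<bullet> x) * 1"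
    proof (intro AE_I2 tendsto_mult tendsto_const)
      fix y :: 'a
      show "(\<lambda>k. ?G (e k *\<^sub>R y)) \<longlonglongrightarrow> 1"
        by (rule tendsto_eq_intros elim | simp)+
    qed
    show "AE y in lborel. cmod (fint \<phi> y * iexp (y \<bullet> x) * ?G (e k *\<^sub>R y)) \<le> cmod (fint \<phi> y)" for k
    proof (rule AE_I2)
      fix y :: 'a
      have "cmod (?G (e k *\<^sub>R y)) \<le> 1" by simp
      from mult_left_mono[OF this, of "cmod (fint \<phi> y)"]
      show "cmod (fint \<phi> y * iexp (y \<bullet> x) * ?G (e k *\<^sub>R y)) \<le> cmod (fint \<phi> y)"
        by (simp add: norm_mult)
    qed
  qed (use fint in simp_all)
  then have "(\<lambda>k. ?c * J k) \<longlonglongrightarrow> (\<integral>y. fint \<phi> y * iexp (y \<bullet> x) \<partial>lborel)"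
    unfolding Jeq by simp
  moreover have "(\<lambda>k. ?c * J k) \<longlonglongrightarrow> ?c * (\<phi> x * ?c)"
    by (intro tendsto_mult tendsto_const lim1)
  ultimately have "(\<integral>y. fint \<phi> y * iexp (y \<bullet> x) \<partial>lborel) = ?c * (\<phi> x * ?c)"
    using LIMSEQ_unique by blast
  also have "\<dots> = complex_of_real ((2 * pi) ^ DIM('a)) * \<phi> x"
    unfolding cc[symmetric] of_real_mult by (simp only: mult_ac)
  finally show ?thesis by simp
qed

section \<open>Product weights of polynomial decay, and Parseval's identity\<close>

lemma borel_measurable_cnj [measurable (raw)]:
  "f \<in> borel_measurable M \<Longrightarrow> (\<lambda>x. cnj (f x)) \<in> borel_measurable M"
  by (rule borel_measurable_continuous_on[OF continuous_on_cnj[OF continuous_on_id]])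

text \<open>A product over coordinates rather than a power of 1 + |x|^2, so that integrability
  reduces to one variable and holds for every exponent above 1/2. The exponent 1 serves as decay of
  Schwartz and Hermite functions; an exponent in (1/2, 1] serves as the kernel in phase
  space.\<close>

definition wt :: "real \<Rightarrow> 'a::euclidean_space \<Rightarrow> real" where
  "wt a x = (\<Prod>b\<in>Basis. (1 + (x \<bullet> b)\<^sup>2) powr (- a))"

lemma integrable_wt1:
  assumes a: "a > 1 / 2"
  shows "integrable lborel (\<lambda>x::real. (1 + x\<^sup>2) powr (- a))"
proof -
  have "(\<lambda>x::real. x powr (- 2 * a)) integrable_on {1..}"
    using has_integral_powr_to_inf[of "- 2 * a" 1] a by (auto simp: has_integral_integrable)
  then have "(\<lambda>x::real. x powr (- 2 * a)) absolutely_integrable_on {1..}"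
    by (intro nonnegative_absolutely_integrable_1) auto
  then have i1: "integrable lborel (\<lambda>x::real. indicator {1..} x *\<^sub>R x powr (- 2 * a))"
    unfolding set_integrable_def by (subst (asm) integrable_completion) auto
  have i2: "integrable lborel (\<lambda>x::real. indicator {1..} (- x) *\<^sub>R (- x) powr (- 2 * a))"
    using iffD2[OF lborel_integrable_real_affine_iff[of "-1" "\<lambda>x. indicator {1..} x *\<^sub>R x powr (- 2 * a)" 0] i1]
    by (simp only: mult_minus1 add_0)
  have i3: "integrable lborel (indicator {-1..1} :: real \<Rightarrow> real)"
    by (rule integrable_real_indicator) auto
  define F where "F x = indicat_real {-1..1} x + (indicat_real {1..} x *\<^sub>R x powr (- 2 * a) + indicat_real {1..} (- x) *\<^sub>R (- x) powr (- 2 * a))" for x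
  have F: "integrable lborel F"
    unfolding F_def by (intro Bochner_Integration.integrable_add i1 i2 i3)
  have bd: "norm ((1 + x\<^sup>2) powr (- a)) \<le> norm (F x)" for x :: real
  proof -
      have small: "(1 + x\<^sup>2) powr (- a) \<le> 1"
        using a by (simp add: powr_minus inverse_le_1_iff ge_one_powr_ge_zero)
      have large: "(1 + x\<^sup>2) powr (- a) \<le> \<bar>x\<bar> powr (- 2 * a)" if "x \<noteq> 0"
      proof -
        have "(1 + x\<^sup>2) powr (- a) \<le> (x\<^sup>2) powr (- a)"
          using a that by (intro powr_mono2') auto
        also have "(x\<^sup>2) powr (- a) = (\<bar>x\<bar> powr 2) powr (- a)" using that by simp
        also have "(\<bar>x\<bar> powr 2) powr (- a) = \<bar>x\<bar> powr (- 2 * a)"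
          unfolding powr_powr by simp
        finally show ?thesis .
      qed
      define A B C where "A = indicat_real {-1..1} x" and "B = indicat_real {1..} x *\<^sub>R x powr (- 2 * a)"
        and "C = indicat_real {1..} (- x) *\<^sub>R (- x) powr (- 2 * a)"
      have nn: "A \<ge> 0" "B \<ge> 0" "C \<ge> 0" by (simp_all add: A_def B_def C_def)
      have "(1 + x\<^sup>2) powr (- a) \<le> A + (B + C)"
      proof (cases "\<bar>x\<bar> \<le> 1")
        case True
        then have "A = 1" by (auto simp: A_def indicator_def abs_le_iff)
        then show ?thesis using small nn by linarith
      next
        case False
        show ?thesis
        proof (cases "x > 0")
          case True
          then have "B = \<bar>x\<bar> powr (- 2 * a)" using False by (simp add: B_def)
          then show ?thesis using large True nn by linarith
        next
          case neg: False
          then have "C = \<bar>x\<bar> powr (- 2 * a)" using False by (simp add: C_def)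
          then show ?thesis using large False nn by linarith
        qed
      qed
      then show "norm ((1 + x\<^sup>2) powr (- a)) \<le> norm (F x)"
        using nn unfolding F_def A_def[symmetric] B_def[symmetric] C_def[symmetric] by simp
  qed
  have "(\<lambda>x::real. (1 + x\<^sup>2) powr (- a)) \<in> borel_measurable lborel" by measurable
  then show ?thesis
    using Bochner_Integration.integrable_bound[OF F] bd by blast
qed

lemma wt_integrable: "a > 1 / 2 \<Longrightarrow> integrable lborel (wt a :: 'a::euclidean_space \<Rightarrow> real)"
  unfolding wt_def[abs_def] by (rule integrable_lborel_prod) (rule integrable_wt1)

lemma wt_pos: "wt a x > 0"
  unfolding wt_def by (intro prod_pos ballI) (simp add: add_nonneg_eq_0_iff)

lemma wt_le1: "a \<ge> 0 \<Longrightarrow> wt a x \<le> 1"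
  unfolding wt_def by (intro prod_le_1) (auto simp: powr_minus inverse_le_1_iff ge_one_powr_ge_zero)

lemma wt_minus [simp]: "wt a (- x) = wt a x"
  by (simp add: wt_def)

lemma wt_measurable [measurable]: "wt a \<in> borel_measurable borel"
  unfolding wt_def[abs_def] by measurable

lemma wt_mono: "0 \<le> a \<Longrightarrow> a \<le> b \<Longrightarrow> wt b x \<le> wt a x"
  unfolding wt_def by (intro prod_mono conjI powr_mono) auto

text \<open>Peetre's inequality in each coordinate, from 1 + (u + v)^2 \<le> 3 (1 + u^2)(1 + v^2).
  It makes decay bounds uniform along segments of unit length.\<close>

lemma wt_shift: "wt 1 x \<le> 3 ^ DIM('a) * (1 + (norm y)\<^sup>2) ^ DIM('a) * wt 1 (x + y)" for x y :: "'a::euclidean_space"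
proof -
  have "wt 1 x \<le> (\<Prod>b\<in>Basis. (3 * (1 + (norm y)\<^sup>2)) * (1 + ((x + y) \<bullet> b)\<^sup>2) powr (- 1))"
    unfolding wt_def
  proof (intro prod_mono conjI)
    fix b :: 'a assume b: "b \<in> Basis"
    have "\<bar>y \<bullet> b\<bar> \<le> norm y" by (rule Basis_le_norm[OF b])
    then have y: "(y \<bullet> b)\<^sup>2 \<le> (norm y)\<^sup>2" by (metis abs_norm_cancel abs_le_square_iff)
    define u v where "u = x \<bullet> b" and "v = y \<bullet> b"
    have "(u + v)\<^sup>2 \<le> 2 * u\<^sup>2 + 2 * v\<^sup>2"
      using sum_squares_bound[of u v] by (simp add: power2_sum)
    then have "1 + (u + v)\<^sup>2 \<le> 3 * (1 + v\<^sup>2) * (1 + u\<^sup>2)"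
      using mult_nonneg_nonneg[of "v\<^sup>2" "u\<^sup>2"] zero_le_power2[of u] zero_le_power2[of v]
      unfolding distrib_left distrib_right by linarith
    also have "\<dots> \<le> 3 * (1 + (norm y)\<^sup>2) * (1 + u\<^sup>2)"
      using y by (intro mult_right_mono) (auto simp: v_def)
    finally have "1 + (u + v)\<^sup>2 \<le> 3 * (1 + (norm y)\<^sup>2) * (1 + u\<^sup>2)" .
    moreover have "1 + u\<^sup>2 > 0" "1 + (u + v)\<^sup>2 > 0" by (simp_all add: add_pos_nonneg)
    ultimately show "(1 + (x \<bullet> b)\<^sup>2) powr (- 1) \<le> 3 * (1 + (norm y)\<^sup>2) * (1 + ((x + y) \<bullet> b)\<^sup>2) powr (- 1)"
      by (simp add: powr_minus inner_add_left u_def[symmetric] v_def[symmetric] field_simps)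
  qed simp
  also have "\<dots> = 3 ^ DIM('a) * (1 + (norm y)\<^sup>2) ^ DIM('a) * wt 1 (x + y)"
    by (simp only: prod.distrib wt_def power_mult_distrib prod_constant)
  finally show ?thesis .
qed

text \<open>Inversion is applied to h alone and Fubini does the rest; f enters only through its
  integrability. The same asymmetry between f and h reappears in Moyal's identity.\<close>

theorem parseval_cnj:
  fixes f h :: "'a::euclidean_space \<Rightarrow> complex"
  assumes f: "integrable lborel f"
    and cont: "continuous_on UNIV h" and bdd: "\<And>x. cmod (h x) \<le> B"
    and int: "integrable lborel h" and fint: "integrable lborel (fint h)"
  shows "(\<integral>t. f t * cnj (h t) \<partial>lborel) = complex_of_real (1 / (2 * pi) ^ DIM('a)) * (\<integral>y. fint f y * cnj (fint h y) \<partial>lborel)"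
proof -
  have [measurable]: "f \<in> borel_measurable borel" "h \<in> borel_measurable borel"
    using f int by (auto dest: borel_measurable_integrable)
  let ?k = "\<lambda>t y. f t * (cnj (fint h y) * iexpn (y \<bullet> t))"
  have pt: "f t * cnj (h t) = complex_of_real (1 / (2 * pi) ^ DIM('a)) * (\<integral>y. ?k t y \<partial>lborel)" for t
  proof -
    have "cnj (h t) = complex_of_real (1 / (2 * pi) ^ DIM('a)) * cnj (\<integral>y. fint h y * iexp (y \<bullet> t) \<partial>lborel)"
      by (subst fourier_inversion[OF cont bdd int fint, of t]) simp
    also have "cnj (\<integral>y. fint h y * iexp (y \<bullet> t) \<partial>lborel) = (\<integral>y. cnj (fint h y) * iexpn (y \<bullet> t) \<partial>lborel)"
      by (subst Bochner_Integration.integral_cnj[symmetric]) (simp add: exp_cnj)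
    finally show ?thesis
      by (subst integral_mult_right_zero) (simp add: mult_ac)
  qed
  have "(\<integral>t. f t * cnj (h t) \<partial>lborel) = complex_of_real (1 / (2 * pi) ^ DIM('a)) * (\<integral>t. (\<integral>y. ?k t y \<partial>lborel) \<partial>lborel)"
    unfolding pt by (rule integral_mult_right_zero)
  also have "(\<integral>t. (\<integral>y. ?k t y \<partial>lborel) \<partial>lborel) = (\<integral>y. (\<integral>t. ?k t y \<partial>lborel) \<partial>lborel)"
  proof (rule lborel_pair.Fubini_integral[symmetric])
    have "integrable (lborel \<Otimes>\<^sub>M lborel) (\<lambda>(t, y). f t * fint h y)"
    proof (rule lborel_pair.Fubini_integrable)
      show "integrable lborel (\<lambda>t. LINT y|lborel. norm (case (t, y) of (t, y) \<Rightarrow> f t * fint h y))"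
        using f by (simp add: norm_mult)
    qed (use fint in auto)
    then show "integrable (lborel \<Otimes>\<^sub>M lborel) (\<lambda>(t, y). ?k t y)"
      by (rule Bochner_Integration.integrable_bound) (auto simp: norm_mult)
  qed
  also have "\<dots> = (\<integral>y. fint f y * cnj (fint h y) \<partial>lborel)"
    unfolding fint_def by (subst integral_mult_left_zero[symmetric]) (simp add: mult_ac)
  finally show ?thesis .
qed

lemma integrable_mult_bounded:
  fixes f k :: "'a \<Rightarrow> complex"
  assumes f: "integrable M f" and [measurable]: "k \<in> borel_measurable M" and k: "\<And>t. cmod (k t) \<le> B"
  shows "integrable M (\<lambda>t. f t * k t)"
proof (rule Bochner_Integration.integrable_bound)
  have [measurable]: "f \<in> borel_measurable M" using f by (rule borel_measurable_integrable)
  show "integrable M (\<lambda>t. B * cmod (f t))" using f by simp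
  show "AE t in M. norm (f t * k t) \<le> norm (B * cmod (f t))"
    using k order_trans[OF norm_ge_zero k] by (auto simp: norm_mult abs_mult mult.commute[of B] intro!: mult_left_mono)
  show "(\<lambda>t. f t * k t) \<in> borel_measurable M" by measurable
qed

lemma stft_fint:
  "stft g f x y = complex_of_real ((2 * pi) powr (- real CARD('n) / 2)) * fint (\<lambda>t. f t * cnj (g (t - x))) y"
  for f g :: "real ^ 'n::finite \<Rightarrow> complex"
  by (simp add: stft_def fint_def)

section \<open>Moyal's identity\<close>

text \<open>For fixed x, Parseval in y is applied to the products of f and of h with the shifted
  window; integrating over x then turns |g(t - x)|^2 into the squared L^2 norm of g. The right side
  is a nonnegative integral, hence meaningful even when it is infinite, and it retains only the
  sizes of the two transforms.\<close>

theorem moyal_inequality: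
  fixes f h g :: "real ^ 'n::finite \<Rightarrow> complex"
  assumes f: "integrable lborel f"
    and h: "continuous_on UNIV h" "\<And>x. cmod (h x) \<le> B" "integrable lborel h"
    and g: "continuous_on UNIV g" "\<And>x. cmod (g x) \<le> B'" "integrable lborel g"
    and stft: "\<And>x. integrable lborel (stft g h x)"
  shows "ennreal (cmod (\<integral>t. f t * cnj (h t) \<partial>lborel) * (\<integral>t. (cmod (g t))\<^sup>2 \<partial>lborel))
    \<le> (\<integral>\<^sup>+x. \<integral>\<^sup>+y. ennreal (cmod (stft g f x y) * cmod (stft g h x y)) \<partial>lborel \<partial>lborel)"
proof -
  let ?c = "complex_of_real ((2 * pi) powr (- real CARD('n) / 2))"
  have B: "B \<ge> 0" "B' \<ge> 0" using h(2) g(2) norm_ge_zero order_trans by blast+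
  have [measurable]: "f \<in> borel_measurable borel" "h \<in> borel_measurable borel" "g \<in> borel_measurable borel"
    using f h g by (auto dest: borel_measurable_integrable)
  have cc: "?c * cnj ?c = complex_of_real (1 / (2 * pi) ^ CARD('n))"
    by (simp flip: of_real_mult powr_add add: powr_minus powr_realpow divide_simps)
  have "integrable lborel (\<lambda>t. g t * cnj (g t))"
    by (rule integrable_mult_bounded[OF g(3), of _ B']) (use g in auto)
  then have g2: "integrable lborel (\<lambda>t. (cmod (g t))\<^sup>2)"
    using integrable_norm by (force simp: norm_mult power2_eq_square)
  have fh: "integrable lborel (\<lambda>t. f t * cnj (h t))"
    by (rule integrable_mult_bounded[OF f, of _ B]) (use h in auto)
  have gshift: "(\<integral>x. (cmod (g (t - x)))\<^sup>2 \<partial>lborel) = (\<integral>t. (cmod (g t))\<^sup>2 \<partial>lborel)"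
    and igshift: "integrable lborel (\<lambda>x. (cmod (g (t - x)))\<^sup>2)" for t
    using lborel_integral_affine[of "-1" "\<lambda>t. (cmod (g t))\<^sup>2" t] g2
      lborel_integrable_affine_iff[of "-1" "\<lambda>t. (cmod (g t))\<^sup>2" t] by simp_all
  have igs: "integrable lborel (\<lambda>t. g (t - x))" for x
    using lborel_integrable_affine_iff[of "1" g "-x"] g by (simp add: add.commute)
  let ?k = "\<lambda>t x. (f t * cnj (h t)) * complex_of_real ((cmod (g (t - x)))\<^sup>2)"
  have kint: "integrable (lborel \<Otimes>\<^sub>M lborel) (\<lambda>(t, x). ?k t x)"
  proof (rule lborel_pair.Fubini_integrable)
    show "integrable lborel (\<lambda>t. LINT x|lborel. norm (case (t, x) of (t, x) \<Rightarrow> ?k t x))"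
      using integrable_norm[OF fh] by (simp add: norm_mult gshift norm_power)
    show "AE t in lborel. integrable lborel (\<lambda>x. case (t, x) of (t, x) \<Rightarrow> ?k t x)"
      using igshift by (auto intro!: integrable_mult_right integrable_of_real simp flip: of_real_power)
  qed measurable
  have inner: "(\<integral>t. ?k t x \<partial>lborel) = (\<integral>y. stft g f x y * cnj (stft g h x y) \<partial>lborel)" for x
  proof -
    let ?f = "\<lambda>t. f t * cnj (g (t - x))" and ?h = "\<lambda>t. h t * cnj (g (t - x))"
    have "(\<integral>t. ?k t x \<partial>lborel) = (\<integral>t. ?f t * cnj (?h t) \<partial>lborel)"
      by (rule Bochner_Integration.integral_cong) (simp_all add: complex_norm_square mult_ac flip: of_real_power)
    also have "\<dots> = complex_of_real (1 / (2 * pi) ^ DIM(real^'n)) * (\<integral>y. fint ?f y * cnj (fint ?h y) \<partial>lborel)"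
    proof (rule parseval_cnj)
      show "integrable lborel ?f" "integrable lborel ?h"
        by (rule integrable_mult_bounded[OF f, of _ B'] integrable_mult_bounded[OF h(3), of _ B'], use g in auto)+
      show "continuous_on UNIV ?h"
        by (intro continuous_intros h continuous_on_compose2[OF g(1)]) auto
      show "cmod (?h t) \<le> B * B'" for t
        using h(2)[of t] g(2)[of "t - x"] B by (auto simp: norm_mult intro!: mult_mono)
      have "integrable lborel (\<lambda>y. stft g h x y / ?c)" using stft[of x] by simp
      then show "integrable lborel (fint ?h)"
        by (simp add: stft_fint)
    qed
    also have "\<dots> = (\<integral>y. stft g f x y * cnj (stft g h x y) \<partial>lborel)"
      unfolding stft_fint using cc
      by (subst integral_mult_right_zero[symmetric]) (simp add: mult_ac)
    finally show ?thesis .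
  qed
  have gk: "(\<integral>x. ?k t x \<partial>lborel) = f t * cnj (h t) * complex_of_real (\<integral>t. (cmod (g t))\<^sup>2 \<partial>lborel)" for t
    by (simp only: integral_mult_right_zero integral_complex_of_real gshift)
  have "(\<integral>t. f t * cnj (h t) \<partial>lborel) * complex_of_real (\<integral>t. (cmod (g t))\<^sup>2 \<partial>lborel) = (\<integral>t. (\<integral>x. ?k t x \<partial>lborel) \<partial>lborel)"
    using gk by (simp only: integral_mult_left_zero)
  also have "\<dots> = (\<integral>x. (\<integral>t. ?k t x \<partial>lborel) \<partial>lborel)"
    by (rule lborel_pair.Fubini_integral[OF kint, symmetric])
  finally have eq: "(\<integral>t. f t * cnj (h t) \<partial>lborel) * complex_of_real (\<integral>t. (cmod (g t))\<^sup>2 \<partial>lborel)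
     = (\<integral>x. (\<integral>t. ?k t x \<partial>lborel) \<partial>lborel)" .
  have intx: "integrable lborel (\<lambda>x. \<integral>t. ?k t x \<partial>lborel)"
    using lborel_pair.integrable_snd[OF kint] .
  have "ennreal (cmod (\<integral>t. f t * cnj (h t) \<partial>lborel) * (\<integral>t. (cmod (g t))\<^sup>2 \<partial>lborel))
     = ennreal (cmod (\<integral>x. (\<integral>t. ?k t x \<partial>lborel) \<partial>lborel))"
    unfolding eq[symmetric] by (simp add: norm_mult)
  also have "\<dots> \<le> (\<integral>\<^sup>+x. ennreal (cmod (\<integral>t. ?k t x \<partial>lborel)) \<partial>lborel)"
    by (rule integral_norm_bound_ennreal[OF intx])
  also have "\<dots> \<le> (\<integral>\<^sup>+x. \<integral>\<^sup>+y. ennreal (cmod (stft g f x y) * cmod (stft g h x y)) \<partial>lborel \<partial>lborel)"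
  proof (rule nn_integral_mono)
    fix x
    show "ennreal (cmod (\<integral>t. ?k t x \<partial>lborel)) \<le> (\<integral>\<^sup>+y. ennreal (cmod (stft g f x y) * cmod (stft g h x y)) \<partial>lborel)"
    proof (cases "integrable lborel (\<lambda>y. stft g f x y * cnj (stft g h x y))")
      case True
      show ?thesis unfolding inner
        using integral_norm_bound_ennreal[OF True] by (simp add: norm_mult)
    next
      \<comment> \<open>The Bochner integral is 0 by convention here, so the bound is
        trivial.\<close>
      case False
      then show ?thesis unfolding inner by (simp add: not_integrable_integral_eq)
    qed
  qed
  finally show ?thesis .
qed

section \<open>Schwartz functions\<close>

lemma prod_Basis_vec: "(\<Prod>b\<in>(Basis :: (real ^ 'n::finite) set). F b) = (\<Prod>j\<in>UNIV. F (axis j 1))"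
proof -
  have eq: "(Basis :: (real ^ 'n) set) = range (\<lambda>j. axis j 1)"
    by (auto simp: Basis_vec_def)
  have inj: "inj (\<lambda>j::'n. axis j (1::real))"
    by (auto simp: inj_def axis_eq_axis)
  show ?thesis unfolding eq prod.reindex[OF inj] o_def ..
qed

lemma wt_vec: "wt a x = (\<Prod>j\<in>UNIV. (1 + (x $ j)\<^sup>2) powr (- a))" for x :: "real ^ 'n::finite"
  by (simp add: wt_def prod_Basis_vec inner_axis)

text \<open>The difference quotients have integral $0$ by translation invariance and are dominated.\<close>

lemma integral_derivative_zero:
  fixes u u' :: "'a::euclidean_space \<Rightarrow> complex"
  assumes b: "norm b = 1"
    and der: "\<And>x s. ((\<lambda>t. u (x + t *\<^sub>R b)) has_vector_derivative u' (x + s *\<^sub>R b)) (at s)"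
    and [measurable]: "u \<in> borel_measurable borel" "u' \<in> borel_measurable borel"
    and bu: "\<And>x. cmod (u x) \<le> C * wt 1 x" and bu': "\<And>x. cmod (u' x) \<le> C * wt 1 x"
  shows "(\<integral>x. u' x \<partial>lborel) = 0"
proof -
  have wt: "integrable lborel (\<lambda>x::'a. K * wt 1 x)" for K
    using wt_integrable[of 1, where 'a='a] by simp
  have C: "C \<ge> 0"
    using order_trans[OF norm_ge_zero bu[of 0]] wt_pos[of 1 "0::'a"] by (simp add: zero_le_mult_iff)
  define e where "e k = 1 / real (Suc k)" for k
  have e0: "e k > 0" "e k \<le> 1" for k by (auto simp: e_def)
  have elim: "e \<longlonglongrightarrow> 0" unfolding e_def using LIMSEQ_inverse_real_of_nat by (simp add: inverse_eq_divide)
  define q where "q k x = (u (x + e k *\<^sub>R b) - u x) /\<^sub>R e k" for k x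
  have iu: "integrable lborel u"
    by (rule Bochner_Integration.integrable_bound[OF wt[of C]]) (use bu C in \<open>auto simp: abs_mult less_imp_le[OF wt_pos]\<close>)
  have iq: "(\<integral>x. q k x \<partial>lborel) = 0" for k
  proof -
    have "integrable lborel (\<lambda>x. u (e k *\<^sub>R b + 1 *\<^sub>R x))"
      using iu by (subst lborel_integrable_affine_iff) auto
    moreover have "(\<integral>x. u (e k *\<^sub>R b + 1 *\<^sub>R x) \<partial>lborel) = (\<integral>x. u x \<partial>lborel)"
      using lborel_integral_affine[of 1 u "e k *\<^sub>R b"] by simp
    ultimately show ?thesis
      unfolding q_def using iu by (simp add: add.commute)
  qed
  \<comment> \<open>The factor of \<open>wt_shift\<close> for shifts of length at most 1. With it
    the mean value inequality bounds all difference quotients by one multiple of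
    \<open>wt 1 x\<close>.\<close>
  define K where "K = C * (3 ^ DIM('a) * 2 ^ DIM('a))"
  have bq: "cmod (q k x) \<le> K * wt 1 x" for k x
  proof -
    have shift: "cmod (u' (x + t *\<^sub>R b)) \<le> K * wt 1 x" if t: "t \<in> {0..1}" for t
    proof -
      have "(norm (- t *\<^sub>R b))\<^sup>2 \<le> 1" using t b by (simp add: power_le_one_iff abs_square_le_1)
      then have "(1 + (norm (- t *\<^sub>R b))\<^sup>2) ^ DIM('a) \<le> 2 ^ DIM('a)"
        by (intro power_mono) auto
      then have "wt 1 (x + t *\<^sub>R b) \<le> 3 ^ DIM('a) * 2 ^ DIM('a) * wt 1 (x + t *\<^sub>R b + - t *\<^sub>R b)"
        using wt_pos[of 1 "x + t *\<^sub>R b + - t *\<^sub>R b"]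
        by (intro order_trans[OF wt_shift[of "x + t *\<^sub>R b" "- t *\<^sub>R b"]] mult_right_mono mult_left_mono) auto
      then show ?thesis
        using C by (intro order_trans[OF bu']) (simp add: K_def mult.assoc mult_left_mono)
    qed
    have "cmod (u (x + e k *\<^sub>R b) - u (x + 0 *\<^sub>R b)) \<le> (K * wt 1 x) * norm (e k - 0)"
    proof (rule differentiable_bound[where S = "{0..1}" and f' = "\<lambda>t h. h *\<^sub>R u' (x + t *\<^sub>R b)" and f = "\<lambda>t. u (x + t *\<^sub>R b)"])
      show "\<And>t. t \<in> {0..1} \<Longrightarrow> ((\<lambda>t. u (x + t *\<^sub>R b)) has_derivative (\<lambda>h. h *\<^sub>R u' (x + t *\<^sub>R b))) (at t within {0..1})"
        using der by (auto simp: has_vector_derivative_def intro: has_derivative_at_withinI)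
      show "onorm (\<lambda>h. h *\<^sub>R u' (x + t *\<^sub>R b)) \<le> K * wt 1 x" if "t \<in> {0..1}" for t
        by (rule onorm_le) (use shift[OF that] in \<open>simp add: mult.commute mult_left_mono\<close>)
    qed (use e0[of k] in auto)
    then show ?thesis using e0[of k] by (simp add: q_def divide_simps mult.commute norm_divide divideR_right)
  qed
  have "(\<lambda>k. \<integral>x. q k x \<partial>lborel) \<longlonglongrightarrow> (\<integral>x. u' x \<partial>lborel)"
  proof (rule integral_dominated_convergence[where w = "\<lambda>x. K * wt 1 x"])
    show "AE x in lborel. (\<lambda>k. q k x) \<longlonglongrightarrow> u' x"
    proof (rule AE_I2)
      fix x
      have "(\<lambda>h. norm (u (x + h *\<^sub>R b) - u x - h *\<^sub>R u' x) / norm h) \<midarrow>0\<rightarrow> 0"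
        using der[of x 0] by (simp add: has_vector_derivative_def has_derivative_at)
      moreover have "filterlim e (at 0) sequentially"
        using e0 elim by (auto simp: filterlim_at less_imp_neq[symmetric])
      ultimately have "(\<lambda>k. norm (u (x + e k *\<^sub>R b) - u x - e k *\<^sub>R u' x) / norm (e k)) \<longlonglongrightarrow> 0"
        by (rule filterlim_compose)
      moreover have "norm (u (x + e k *\<^sub>R b) - u x - e k *\<^sub>R u' x) / norm (e k) = norm (q k x - u' x)" for k
      proof -
        have "q k x - u' x = (u (x + e k *\<^sub>R b) - u x - e k *\<^sub>R u' x) /\<^sub>R e k"
          using e0[of k] by (simp add: q_def scaleR_diff_right)
        then show ?thesis using e0[of k] by (simp add: divide_inverse mult.commute)
      qed
      ultimately have "(\<lambda>k. norm (q k x - u' x)) \<longlonglongrightarrow> 0" by simp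
      then show "(\<lambda>k. q k x) \<longlonglongrightarrow> u' x"
        by (simp add: tendsto_norm_zero_iff LIM_zero_iff)
    qed
  qed (use wt bq in \<open>auto simp: q_def[abs_def]\<close>)
  then show ?thesis by (simp add: iq LIMSEQ_const_iff)
qed

section \<open>Closure properties of the Schwartz class and integration by parts\<close>

lemma continuous_on_schwartz: "f \<in> schwartz \<Longrightarrow> continuous_on UNIV f"
  unfolding schwartz_def by (auto dest: spec[of _ "[]"] simp: iter_partial_def)

lemma schwartz_measurable: "f \<in> schwartz \<Longrightarrow> f \<in> borel_measurable borel"
  by (intro borel_measurable_continuous_onI continuous_on_schwartz)

lemma schwartz_decay: "f \<in> schwartz \<Longrightarrow> \<exists>C. \<forall>x. (1 + norm x) ^ N * cmod (f x) \<le> C"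
proof -
  assume "f \<in> schwartz"
  then have "\<exists>C. \<forall>x. (1 + norm x) ^ N * cmod (iter_partial [] f x) \<le> C"
    unfolding schwartz_def by blast
  then show ?thesis by (simp add: iter_partial_def)
qed

lemma schwartz_partial_coord: "f \<in> schwartz \<Longrightarrow> partial_coord i f \<in> schwartz"
proof -
  assume f: "f \<in> schwartz"
  have "iter_partial js (partial_coord i f) = iter_partial (js @ [i]) f" for js
    by (simp add: iter_partial_def)
  then show ?thesis using f unfolding schwartz_def by simp
qed

lemma has_vector_derivative_line:
  fixes f :: "'a::real_vector \<Rightarrow> 'b::real_normed_vector"
  assumes "((\<lambda>t. f ((x + s *\<^sub>R e) + t *\<^sub>R e)) has_vector_derivative D) (at 0)"
  shows "((\<lambda>t. f (x + t *\<^sub>R e)) has_vector_derivative D) (at s)"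
proof -
  have d: "((\<lambda>t. t - s) has_vector_derivative 1) (at s)"
    by (auto intro!: derivative_eq_intros)
  have "((\<lambda>t. f ((x + s *\<^sub>R e) + t *\<^sub>R e)) has_vector_derivative D) (at ((\<lambda>t. t - s) s))"
    using assms by simp
  from vector_diff_chain_at[OF d this] show ?thesis by (simp add: o_def scaleR_diff_left)
qed

lemma schwartz_has_vector_derivative:
  assumes f: "f \<in> schwartz"
  shows "((\<lambda>t. f (x + t *\<^sub>R axis i 1)) has_vector_derivative partial_coord i f (x + s *\<^sub>R axis i 1)) (at s)"
proof (rule has_vector_derivative_line)
  let ?e = "axis i 1 :: real ^ 'a"
  have "(\<lambda>t. iter_partial [] f ((x + s *\<^sub>R ?e) + t *\<^sub>R ?e)) differentiable (at 0)"
    using f unfolding schwartz_def by blast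
  then show "((\<lambda>t. f ((x + s *\<^sub>R ?e) + t *\<^sub>R ?e)) has_vector_derivative partial_coord i f (x + s *\<^sub>R ?e)) (at 0)"
    by (simp add: iter_partial_def vector_derivative_works partial_coord_def)
qed

lemma partial_coord_eqI:
  "((\<lambda>t. f (x + t *\<^sub>R axis i 1)) has_vector_derivative D) (at 0) \<Longrightarrow> partial_coord i f x = D"
  unfolding partial_coord_def by (rule vector_derivative_at)

text \<open>Membership in \<open>schwartz\<close> quantifies over all iterated partial derivatives.
  A class that is stable under one partial derivative, and whose members satisfy the conditions of
  order zero, therefore consists of Schwartz functions; this replaces explicit Leibniz
  formulas.\<close>

lemma schwartz_coinduct:
  assumes "f \<in> X"
    and step: "\<And>f i. f \<in> X \<Longrightarrow> continuous_on UNIV f \<and> partial_coord i f \<in> X \<and>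
      (\<forall>x. ((\<lambda>t. f (x + t *\<^sub>R axis i 1)) differentiable (at 0))) \<and> (\<forall>N. \<exists>C. \<forall>x. (1 + norm x) ^ N * cmod (f x) \<le> C)"
  shows "f \<in> schwartz"
proof -
  have X: "iter_partial js f \<in> X" for js
  proof (induction js)
    case Nil then show ?case using assms(1) by (simp add: iter_partial_def)
  next
    case (Cons i js)
    then have "partial_coord i (iter_partial js f) \<in> X" using step by blast
    then show ?case by (simp add: iter_partial_def)
  qed
  show ?thesis unfolding schwartz_def using step[OF X] by blast
qed

lemma schwartz_lincomb:
  assumes f: "f \<in> schwartz" and h: "h \<in> schwartz"
  shows "(\<lambda>x. f x + c * h x) \<in> schwartz"
proof (rule schwartz_coinduct[where X = "{(\<lambda>x. f x + c * h x) | f h. f \<in> schwartz \<and> h \<in> schwartz}"])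
  show "(\<lambda>x. f x + c * h x) \<in> {(\<lambda>x. f x + c * h x) | f h. f \<in> schwartz \<and> h \<in> schwartz}"
    using f h by blast
next
  fix k :: "real ^ 'a \<Rightarrow> complex" and i
  assume "k \<in> {(\<lambda>x. f x + c * h x) | f h. f \<in> schwartz \<and> h \<in> schwartz}"
  then obtain f h where k: "k = (\<lambda>x. f x + c * h x)" and fh: "f \<in> schwartz" "h \<in> schwartz" by blast
  have der: "((\<lambda>t. k (x + t *\<^sub>R axis i 1)) has_vector_derivative (partial_coord i f x + c * partial_coord i h x)) (at 0)" for x
    unfolding k using schwartz_has_vector_derivative[OF fh(1), of x i 0] schwartz_has_vector_derivative[OF fh(2), of x i 0]
    by (auto intro!: has_vector_derivative_add has_vector_derivative_mult_right)
  have "partial_coord i k = (\<lambda>x. partial_coord i f x + c * partial_coord i h x)"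
    using partial_coord_eqI[OF der] by blast
  moreover have "\<exists>C. \<forall>x. (1 + norm x) ^ N * cmod (k x) \<le> C" for N
  proof -
    obtain C C' where C: "\<And>x. (1 + norm x) ^ N * cmod (f x) \<le> C" "\<And>x. (1 + norm x) ^ N * cmod (h x) \<le> C'"
      using schwartz_decay[OF fh(1)] schwartz_decay[OF fh(2)] by blast
    have "(1 + norm x) ^ N * cmod (k x) \<le> C + cmod c * C'" for x
    proof -
      have "(1 + norm x) ^ N * cmod (k x) \<le> (1 + norm x) ^ N * (cmod (f x) + cmod c * cmod (h x))"
        unfolding k by (intro mult_left_mono order_trans[OF norm_triangle_ineq]) (simp_all add: norm_mult)
      also have "\<dots> = (1 + norm x) ^ N * cmod (f x) + cmod c * ((1 + norm x) ^ N * cmod (h x))"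
        by (simp add: algebra_simps)
      also have "\<dots> \<le> C + cmod c * C'"
        by (intro add_mono mult_left_mono C) auto
      finally show ?thesis .
    qed
    then show ?thesis by blast
  qed
  ultimately show "continuous_on UNIV k \<and> partial_coord i k \<in> {(\<lambda>x. f x + c * h x) | f h. f \<in> schwartz \<and> h \<in> schwartz} \<and>
      (\<forall>x. ((\<lambda>t. k (x + t *\<^sub>R axis i 1)) differentiable (at 0))) \<and> (\<forall>N. \<exists>C. \<forall>x. (1 + norm x) ^ N * cmod (k x) \<le> C)"
    using fh schwartz_partial_coord[OF fh(1), of i] schwartz_partial_coord[OF fh(2), of i] der
      continuous_on_schwartz[OF fh(1)] continuous_on_schwartz[OF fh(2)]
    by (intro conjI allI) (auto simp: k intro!: continuous_intros dest: differentiableI_vector)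
qed

text \<open>Products of x_j with Schwartz functions are not stable under differentiation, since the
  product rule leaves the extra term f when i = j. The invariant class is therefore that of sums of
  such a product and a Schwartz function.\<close>

lemma schwartz_mult_coord:
  fixes f :: "real ^ 'n::finite \<Rightarrow> complex"
  assumes f: "f \<in> schwartz"
  shows "(\<lambda>x. complex_of_real (x $ j) * f x) \<in> schwartz"
proof -
  let ?X = "{(\<lambda>x. complex_of_real (x $ j) * f x + h x) | f h :: real ^ 'n \<Rightarrow> complex. f \<in> schwartz \<and> h \<in> schwartz}"
  have 0: "(\<lambda>x::real^'n. 0) \<in> schwartz"
    using schwartz_lincomb[OF f f, of "-1"] by simp
  have "(\<lambda>x. complex_of_real (x $ j) * f x + 0) \<in> schwartz"
  proof (rule schwartz_coinduct[where X = ?X])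
    show "(\<lambda>x. complex_of_real (x $ j) * f x + 0) \<in> ?X"
      using f 0 by (intro CollectI exI[of _ f] exI[of _ "\<lambda>_. 0"]) simp
  next
    fix k :: "real ^ 'n \<Rightarrow> complex" and i
    assume "k \<in> ?X"
    then obtain f h where k: "k = (\<lambda>x. complex_of_real (x $ j) * f x + h x)" and fh: "f \<in> schwartz" "h \<in> schwartz" by blast
    let ?d = "if i = j then 1 else 0 :: complex"
    have der: "((\<lambda>t. k (x + t *\<^sub>R axis i 1)) has_vector_derivative (complex_of_real (x $ j) * partial_coord i f x + (partial_coord i h x + ?d * f x))) (at 0)" for x
    proof -
      have "((\<lambda>t. complex_of_real ((x + t *\<^sub>R axis i 1) $ j)) has_vector_derivative ?d) (at 0)"
        by (auto simp: axis_def intro!: derivative_eq_intros has_vector_derivative_of_real)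
      from has_vector_derivative_add[OF has_vector_derivative_mult[OF this] schwartz_has_vector_derivative[OF fh(2), of x i 0, simplified],
          OF schwartz_has_vector_derivative[OF fh(1), of x i 0, simplified]]
      show ?thesis unfolding k by (simp add: algebra_simps)
    qed
    have eq: "partial_coord i k = (\<lambda>x. complex_of_real (x $ j) * partial_coord i f x + (partial_coord i h x + ?d * f x))"
      using partial_coord_eqI[OF der] by blast
    have mem: "partial_coord i k \<in> ?X"
      unfolding eq using schwartz_partial_coord[OF fh(1), of i] schwartz_lincomb[OF schwartz_partial_coord[OF fh(2), of i] fh(1), of ?d]
      by (intro CollectI exI[of _ "partial_coord i f"] exI[of _ "\<lambda>x. partial_coord i h x + ?d * f x"]) simp
    have dec: "\<exists>C. \<forall>x. (1 + norm x) ^ N * cmod (k x) \<le> C" for N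
    proof -
      obtain C C' where C: "\<And>x. (1 + norm x) ^ Suc N * cmod (f x) \<le> C" "\<And>x. (1 + norm x) ^ N * cmod (h x) \<le> C'"
        using schwartz_decay[OF fh(1)] schwartz_decay[OF fh(2)] by blast
      have "(1 + norm x) ^ N * cmod (k x) \<le> C + C'" for x
      proof -
        have "\<bar>x $ j\<bar> \<le> 1 + norm x" using component_le_norm_cart[of x j] by simp
        then have "cmod (complex_of_real (x $ j) * f x) \<le> (1 + norm x) * cmod (f x)"
          by (auto simp: norm_mult intro!: mult_right_mono)
        then have "(1 + norm x) ^ N * cmod (k x) \<le> (1 + norm x) ^ N * ((1 + norm x) * cmod (f x) + cmod (h x))"
          unfolding k by (intro mult_left_mono order_trans[OF norm_triangle_ineq] add_mono) simp_all
        also have "\<dots> = (1 + norm x) ^ Suc N * cmod (f x) + (1 + norm x) ^ N * cmod (h x)"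
          by (simp add: algebra_simps)
        also have "\<dots> \<le> C + C'"
          by (intro add_mono C)
        finally show ?thesis .
      qed
      then show ?thesis by blast
    qed
    have "continuous_on UNIV k"
      unfolding k by (intro continuous_intros continuous_on_schwartz fh)
    then show "continuous_on UNIV k \<and> partial_coord i k \<in> ?X \<and>
        (\<forall>x. ((\<lambda>t. k (x + t *\<^sub>R axis i 1)) differentiable (at 0))) \<and> (\<forall>N. \<exists>C. \<forall>x. (1 + norm x) ^ N * cmod (k x) \<le> C)"
      using mem dec der by (auto dest: differentiableI_vector)
  qed
  then show ?thesis by simp
qed

lemma schwartz_wt_bound:
  fixes f :: "real ^ 'n::finite \<Rightarrow> complex"
  assumes f: "f \<in> schwartz"
  obtains C where "C \<ge> 0" "\<And>x. cmod (f x) \<le> C * wt 1 x"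
proof -
  obtain C where C: "\<And>x. (1 + norm x) ^ (2 * CARD('n)) * cmod (f x) \<le> C"
    using schwartz_decay[OF f] by blast
  have "cmod (f x) \<le> C * wt 1 x" for x
  proof -
    have "inverse (wt 1 x) = (\<Prod>j\<in>UNIV. 1 + (x $ j)\<^sup>2)"
      by (simp add: wt_vec powr_minus prod_inversef[symmetric] abs_of_nonneg add_nonneg_nonneg)
    also have "\<dots> \<le> (\<Prod>j\<in>(UNIV :: 'n set). (1 + norm x)\<^sup>2)"
    proof (intro prod_mono conjI)
      fix j
      have "\<bar>x $ j\<bar> \<le> norm x" by (rule component_le_norm_cart)
      then have "(x $ j)\<^sup>2 \<le> (norm x)\<^sup>2" by (metis abs_norm_cancel abs_le_square_iff)
      also have "1 + (norm x)\<^sup>2 \<le> (1 + norm x)\<^sup>2" by (simp add: power2_sum)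
      finally show "1 + (x $ j)\<^sup>2 \<le> (1 + norm x)\<^sup>2" by simp
    qed simp
    also have "\<dots> = (1 + norm x) ^ (2 * CARD('n))"
      by (simp add: power_mult)
    finally have "inverse (wt 1 x) * cmod (f x) \<le> C"
      by (intro order_trans[OF mult_right_mono C]) auto
    then show ?thesis using wt_pos[of 1 x] by (simp add: field_simps)
  qed
  moreover have "C \<ge> 0" using order_trans[OF _ C[of 0]] by simp
  ultimately show thesis using that by blast
qed

lemma schwartz_integrable:
  fixes f :: "real ^ 'n::finite \<Rightarrow> complex"
  assumes f: "f \<in> schwartz"
  shows "integrable lborel f"
proof -
  obtain C where C: "C \<ge> 0" "\<And>x. cmod (f x) \<le> C * wt 1 x" using schwartz_wt_bound[OF f] by blast
  have "integrable lborel (\<lambda>x::real^'n. C * wt 1 x)" using wt_integrable[of 1, where 'a="real^'n"] by simp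
  then show ?thesis
    by (rule Bochner_Integration.integrable_bound)
       (use C schwartz_measurable[OF f] in \<open>auto simp: abs_mult less_imp_le[OF wt_pos]\<close>)
qed

lemma schwartz_bounded:
  fixes f :: "real ^ 'n::finite \<Rightarrow> complex"
  assumes f: "f \<in> schwartz"
  obtains B where "\<And>x. cmod (f x) \<le> B"
proof -
  obtain C where C: "C \<ge> 0" "\<And>x. cmod (f x) \<le> C * wt 1 x" using schwartz_wt_bound[OF f] by blast
  have "cmod (f x) \<le> C" for x
    using C(2)[of x] mult_left_le[OF wt_le1[of 1 x] C(1)] by simp
  then show thesis using that by blast
qed

text \<open>The test function is only asked to be bounded together with its derivative along one
  axis. This covers Gaussian wave packets and Hermite functions alike, so that neither has to be
  shown to be Schwartz.\<close>

lemma schwartz_ibp: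
  fixes f :: "real ^ 'n::finite \<Rightarrow> complex"
  assumes f: "f \<in> schwartz"
    and der: "\<And>x. ((\<lambda>t. \<Phi> (x + t *\<^sub>R axis j 1)) has_vector_derivative \<Phi>' x) (at 0)"
    and [measurable]: "\<Phi> \<in> borel_measurable borel" "\<Phi>' \<in> borel_measurable borel"
    and B: "\<And>x. cmod (\<Phi> x) \<le> B" "\<And>x. cmod (\<Phi>' x) \<le> B"
  shows "(\<integral>x. partial_coord j f x * \<Phi> x \<partial>lborel) = - (\<integral>x. f x * \<Phi>' x \<partial>lborel)"
proof -
  have f': "partial_coord j f \<in> schwartz" by (rule schwartz_partial_coord[OF f])
  have [measurable]: "f \<in> borel_measurable borel" "partial_coord j f \<in> borel_measurable borel"
    by (auto intro: schwartz_measurable f f')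
  have B0: "B \<ge> 0" using order_trans[OF norm_ge_zero B(1)[of 0]] .
  obtain C where C: "C \<ge> 0" "\<And>x. cmod (f x) \<le> C * wt 1 x" using schwartz_wt_bound[OF f] by blast
  obtain C' where C': "C' \<ge> 0" "\<And>x. cmod (partial_coord j f x) \<le> C' * wt 1 x" using schwartz_wt_bound[OF f'] by blast
  have bd: "cmod (h x * k x) \<le> (K * wt 1 x) * B" if "cmod (h x) \<le> K * wt 1 x" "cmod (k x) \<le> B" for h k :: "real^'n \<Rightarrow> complex" and x K
    using that B0 order_trans[OF norm_ge_zero that(1)] by (auto simp: norm_mult intro!: mult_mono)
  have bd1: "cmod (f x * \<Phi> x) \<le> (C + C') * B * wt 1 x" for x
    using bd[of f x C \<Phi>, OF C(2) B(1)] mult_nonneg_nonneg[OF mult_nonneg_nonneg[OF C'(1) B0] less_imp_le[OF wt_pos[of 1 x]]]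
    by (simp add: algebra_simps)
  have bd2: "cmod (partial_coord j f x * \<Phi> x) \<le> C' * B * wt 1 x" for x
    using bd[of "partial_coord j f" x C' \<Phi>, OF C'(2) B(1)] by (simp add: mult_ac)
  have bd3: "cmod (f x * \<Phi>' x) \<le> C * B * wt 1 x" for x
    using bd[of f x C \<Phi>', OF C(2) B(2)] by (simp add: mult_ac)
  have wt: "integrable lborel (\<lambda>x::real^'n. K * wt 1 x)" for K
    using wt_integrable[of 1, where 'a="real^'n"] by simp
  have i1: "integrable lborel (\<lambda>x. partial_coord j f x * \<Phi> x)"
    by (rule Bochner_Integration.integrable_bound[OF wt[of "C' * B"]])
       (use C' B0 bd2 in \<open>auto simp: abs_mult less_imp_le[OF wt_pos]\<close>)
  have i2: "integrable lborel (\<lambda>x. f x * \<Phi>' x)"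
    by (rule Bochner_Integration.integrable_bound[OF wt[of "C * B"]])
       (use C B0 bd3 in \<open>auto simp: abs_mult less_imp_le[OF wt_pos]\<close>)
  have "(\<integral>x. partial_coord j f x * \<Phi> x + f x * \<Phi>' x \<partial>lborel) = 0"
  proof (rule integral_derivative_zero[where b = "axis j 1" and u = "\<lambda>x. f x * \<Phi> x" and C = "(C + C') * B"])
    show "((\<lambda>t. f (x + t *\<^sub>R axis j 1) * \<Phi> (x + t *\<^sub>R axis j 1)) has_vector_derivative
        (partial_coord j f (x + s *\<^sub>R axis j 1) * \<Phi> (x + s *\<^sub>R axis j 1) + f (x + s *\<^sub>R axis j 1) * \<Phi>' (x + s *\<^sub>R axis j 1))) (at s)" for x s
      using has_vector_derivative_mult[OF schwartz_has_vector_derivative[OF f, of x j s] has_vector_derivative_line[OF der]]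
      by (simp add: add.commute)
    show "cmod (partial_coord j f x * \<Phi> x + f x * \<Phi>' x) \<le> (C + C') * B * wt 1 x" for x
      using norm_triangle_le[OF add_mono[OF bd2[of x] bd3[of x]]] by (simp add: algebra_simps)
  qed (use bd1 in auto)
  then show ?thesis using i1 i2 by (simp add: add_eq_0_iff2)
qed

section \<open>Decay of the Gaussian short-time Fourier transform\<close>

text \<open>The ground state \<Phi>_0 of H, of unit L^2 norm. The constant is written as a power so
  that it splits over the coordinates.\<close>

definition gauss_window :: "real ^ 'n::finite \<Rightarrow> complex" where
  "gauss_window t = complex_of_real ((pi powr (-1/4)) ^ CARD('n) * exp (- (norm t)\<^sup>2 / 2))"

definition creation :: "'n::finite \<Rightarrow> (real ^ 'n \<Rightarrow> complex) \<Rightarrow> real ^ 'n \<Rightarrow> complex" where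
  "creation j f = (\<lambda>x. complex_of_real (x $ j) * f x - partial_coord j f x)"

lemma schwartz_creation: "f \<in> schwartz \<Longrightarrow> creation j f \<in> schwartz"
  using schwartz_lincomb[OF schwartz_mult_coord[of f j] schwartz_partial_coord[of f j], where c = "-1"]
  by (simp add: creation_def)

lemma gauss_window_measurable [measurable]: "gauss_window \<in> borel_measurable borel"
  unfolding gauss_window_def[abs_def] by measurable

lemma gauss_window_continuous: "continuous_on UNIV gauss_window"
  unfolding gauss_window_def[abs_def] by (intro continuous_intros) auto

lemma gauss_window_const_le1: "(pi powr (-1/4)) ^ k \<le> 1"
proof -
  have "pi powr (-1/4) \<le> 1" using pi_gt3 powr_mono[of "-1/4" 0 pi] by simp
  then show ?thesis by (intro power_le_one) auto
qed

lemma gauss_window_bound: "cmod (gauss_window t) \<le> 1"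
proof -
  have "(pi powr (-1/4)) ^ CARD('a) \<le> 1" by (rule gauss_window_const_le1)
  moreover have "exp (- (norm t)\<^sup>2 / 2) \<le> 1" by simp
  ultimately show ?thesis
    unfolding gauss_window_def norm_of_real by (simp add: abs_mult mult_le_one)
qed

lemma gauss_window_integrable: "integrable lborel (gauss_window :: real ^ 'n::finite \<Rightarrow> complex)"
  unfolding gauss_window_def[abs_def] of_real_mult
  by (intro integrable_mult_right integrable_of_real gauss_real_integrable)

lemma cnj_gauss_window [simp]: "cnj (gauss_window t) = gauss_window t"
  by (simp add: gauss_window_def)

lemma abs_le_exp_half_sq: "\<bar>s\<bar> \<le> exp (s\<^sup>2 / 2)" for s :: real
proof -
  have "2 * \<bar>s\<bar> \<le> 1 + s\<^sup>2" using zero_le_power2[of "\<bar>s\<bar> - 1"] by (simp add: power2_diff)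
  then show ?thesis using exp_ge_add_one_self[of "s\<^sup>2 / 2"] by linarith
qed

text \<open>Equivalently, the wave packet is an eigenfunction of t_j + d/dt_j with eigenvalue x_j -
  i y_j. This eigenvalue equation is what turns the creation operator into a multiplication.\<close>

lemma gauss_window_wave_derivative:
  fixes x y :: "real ^ 'n::finite"
  defines "\<Phi> \<equiv> \<lambda>t. gauss_window (t - x) * iexpn (y \<bullet> t)"
  shows "((\<lambda>s. \<Phi> (t + s *\<^sub>R axis j 1)) has_vector_derivative
          - (complex_of_real (t $ j - x $ j) + \<i> * complex_of_real (y $ j)) * \<Phi> t) (at 0)"
proof -
  let ?K = "complex_of_real ((pi powr (-1/4)) ^ CARD('n))"
  \<comment> \<open>The restriction of the wave packet to a line extends to an entire function of
    the line parameter, so it can be differentiated by the rules for complex functions.\<close>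
  define F where "F w = ?K * exp (- (complex_of_real ((norm (t - x))\<^sup>2) + 2 * w * complex_of_real (t $ j - x $ j) + w\<^sup>2) / 2
     - \<i> * (complex_of_real (y \<bullet> t) + w * complex_of_real (y $ j)))" for w :: complex
  have eq: "\<Phi> (t + s *\<^sub>R axis j 1) = F (complex_of_real s)" for s
  proof -
    have "(norm (t + s *\<^sub>R axis j 1 - x))\<^sup>2 = (norm (t - x))\<^sup>2 + 2 * s * (t $ j - x $ j) + s\<^sup>2"
      unfolding power2_norm_eq_inner
      by (simp add: inner_add_left inner_add_right inner_diff_left inner_diff_right inner_axis inner_axis' axis_def power2_eq_square algebra_simps)
         (simp add: inner_axis inner_axis' flip: axis_def)
    moreover have "y \<bullet> (t + s *\<^sub>R axis j 1) = y \<bullet> t + s * y $ j"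
      by (simp add: inner_add_right inner_axis)
    ultimately have "\<Phi> (t + s *\<^sub>R axis j 1) = ?K * (exp (complex_of_real (- ((norm (t - x))\<^sup>2 + 2 * s * (t $ j - x $ j) + s\<^sup>2) / 2)) * iexpn (y \<bullet> t + s * y $ j))"
      unfolding \<Phi>_def gauss_window_def by (simp add: exp_of_real[symmetric] mult.assoc)
    also have "\<dots> = F (complex_of_real s)"
      unfolding F_def mult_exp_exp by (simp add: algebra_simps diff_divide_distrib add_divide_distrib)
    finally show ?thesis .
  qed
  have "(F has_field_derivative - (complex_of_real (t $ j - x $ j) + \<i> * complex_of_real (y $ j)) * F 0) (at 0)"
    unfolding F_def by (auto intro!: derivative_eq_intros simp: field_simps)
  then have "((\<lambda>s. F (complex_of_real s)) has_vector_derivative - (complex_of_real (t $ j - x $ j) + \<i> * complex_of_real (y $ j)) * F 0) (at 0)"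
    by (intro has_vector_derivative_real_field) simp
  moreover have "F 0 = \<Phi> t" using eq[of 0] by simp
  ultimately show ?thesis unfolding eq by simp
qed

text \<open>The creation operator acts as multiplication by $\bar z_j$, so iterating it trades
  polynomial decay of the transform for an $L^1$ bound.\<close>

lemma stft_gauss_creation:
  fixes f :: "real ^ 'n::finite \<Rightarrow> complex"
  assumes f: "f \<in> schwartz"
  shows "stft gauss_window (creation j f) x y = (complex_of_real (x $ j) - \<i> * complex_of_real (y $ j)) * stft gauss_window f x y"
proof -
  define \<Phi> where "\<Phi> t = gauss_window (t - x) * iexpn (y \<bullet> t)" for t
  define \<Phi>' where "\<Phi>' t = - (complex_of_real (t $ j - x $ j) + \<i> * complex_of_real (y $ j)) * \<Phi> t" for t
  have [measurable]: "\<Phi> \<in> borel_measurable borel" "\<Phi>' \<in> borel_measurable borel"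
    unfolding \<Phi>_def[abs_def] \<Phi>'_def[abs_def] by measurable
  have b1: "cmod (\<Phi> t) \<le> 1" for t
    using gauss_window_bound[of "t - x"] by (simp add: \<Phi>_def norm_mult)
  have b2: "cmod (\<Phi>' t) \<le> 1 + \<bar>y $ j\<bar>" for t
  proof -
    have "\<bar>t $ j - x $ j\<bar> * cmod (\<Phi> t) \<le> 1"
    proof -
      have k: "(pi powr (-1/4)) ^ CARD('n) \<le> 1"
        by (rule gauss_window_const_le1)
      have "\<bar>t $ j - x $ j\<bar> \<le> norm (t - x)"
        using component_le_norm_cart[of "t - x" j] by simp
      also have "\<dots> \<le> exp ((norm (t - x))\<^sup>2 / 2)"
        using abs_le_exp_half_sq[of "norm (t - x)"] by simp
      finally have "\<bar>t $ j - x $ j\<bar> * exp (- (norm (t - x))\<^sup>2 / 2) \<le> 1"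
        by (simp add: exp_minus field_simps)
      then have "(pi powr (-1/4)) ^ CARD('n) * (\<bar>t $ j - x $ j\<bar> * exp (- (norm (t - x))\<^sup>2 / 2)) \<le> 1"
        using mult_mono[OF k, of _ 1] by simp
      then show ?thesis by (simp add: \<Phi>_def gauss_window_def norm_mult norm_power mult_ac)
    qed
    moreover have "\<bar>y $ j\<bar> * cmod (\<Phi> t) \<le> \<bar>y $ j\<bar>" using b1[of t] by (simp add: mult_left_le)
    moreover have "cmod (\<Phi>' t) \<le> (\<bar>t $ j - x $ j\<bar> + \<bar>y $ j\<bar>) * cmod (\<Phi> t)"
      unfolding \<Phi>'_def norm_mult norm_minus_cancel
      by (intro mult_right_mono order_trans[OF norm_triangle_ineq]) (simp_all add: norm_mult del: of_real_diff)
    ultimately show ?thesis by (simp add: algebra_simps)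
  qed
  have ibp: "(\<integral>t. partial_coord j f t * \<Phi> t \<partial>lborel) = - (\<integral>t. f t * \<Phi>' t \<partial>lborel)"
  proof (rule schwartz_ibp[OF f, where B = "1 + \<bar>y $ j\<bar>"])
    show "((\<lambda>s. \<Phi> (t + s *\<^sub>R axis j 1)) has_vector_derivative \<Phi>' t) (at 0)" for t
      using gauss_window_wave_derivative[where x = x and y = y and t = t and j = j] unfolding \<Phi>_def \<Phi>'_def .
    show "cmod (\<Phi> t) \<le> 1 + \<bar>y $ j\<bar>" for t using b1[of t] by simp
  qed (use b2 in auto)
  have int: "integrable lborel (\<lambda>t. h t * k t)" if "h \<in> schwartz" "k \<in> borel_measurable borel"
    and "\<And>t. cmod (k t) \<le> B" for h k :: "real ^ 'n \<Rightarrow> complex" and B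
    using integrable_mult_bounded[OF schwartz_integrable[OF that(1)], of k B] that by simp
  have i1: "integrable lborel (\<lambda>t. partial_coord j f t * \<Phi> t)"
    by (rule int[OF schwartz_partial_coord[OF f] _ b1]) simp
  have i2: "integrable lborel (\<lambda>t. (complex_of_real (t $ j) * f t) * \<Phi> t)"
    by (rule int[OF schwartz_mult_coord[OF f] _ b1]) simp
  have i3: "integrable lborel (\<lambda>t. f t * \<Phi>' t)"
    by (rule int[OF f _ b2]) simp
  have "(\<integral>t. creation j f t * \<Phi> t \<partial>lborel) = (\<integral>t. (complex_of_real (t $ j) * f t) * \<Phi> t - partial_coord j f t * \<Phi> t \<partial>lborel)"
    by (simp add: creation_def left_diff_distrib)
  also have "\<dots> = (\<integral>t. (complex_of_real (t $ j) * f t) * \<Phi> t + f t * \<Phi>' t \<partial>lborel)"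
    using i1 i2 i3 ibp by simp
  also have "\<dots> = (\<integral>t. (complex_of_real (x $ j) - \<i> * complex_of_real (y $ j)) * (f t * \<Phi> t) \<partial>lborel)"
    by (rule Bochner_Integration.integral_cong) (auto simp: \<Phi>'_def algebra_simps)
  finally have "(\<integral>t. creation j f t * \<Phi> t \<partial>lborel) = (complex_of_real (x $ j) - \<i> * complex_of_real (y $ j)) * (\<integral>t. f t * \<Phi> t \<partial>lborel)"
    by simp
  then show ?thesis
    by (simp add: stft_def \<Phi>_def mult.assoc)
qed

lemma stft_gauss_bound:
  fixes f :: "real ^ 'n::finite \<Rightarrow> complex"
  assumes f: "integrable lborel f"
  shows "cmod (stft gauss_window f x y) \<le> (2 * pi) powr (- real CARD('n) / 2) * (\<integral>t. cmod (f t) \<partial>lborel)"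
proof -
  have [measurable]: "f \<in> borel_measurable borel" using f by (auto dest: borel_measurable_integrable)
  have "cmod (\<integral>t. f t * cnj (gauss_window (t - x)) * iexpn (y \<bullet> t) \<partial>lborel) \<le> (\<integral>t. cmod (f t) \<partial>lborel)"
  proof (rule Bochner_Integration.integral_norm_bound_integral)
    show bd: "cmod (f t * cnj (gauss_window (t - x)) * iexpn (y \<bullet> t)) \<le> cmod (f t)" for t
      using gauss_window_bound[of "t - x"] by (simp add: norm_mult mult_left_le)
    show "integrable lborel (\<lambda>t. f t * cnj (gauss_window (t - x)) * iexpn (y \<bullet> t))"
      by (rule Bochner_Integration.integrable_bound[OF f]) (use bd in auto)
  qed (use f in auto)
  then show ?thesis by (simp add: stft_def norm_mult mult_left_mono)
qed

text \<open>Four creation operators per coordinate multiply the transform by the fourth power of the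
  conjugate of z_j, and |z_j|^4 is what dominates the product (1 + x_j^2)(1 + y_j^2) of the two
  weights.\<close>

theorem stft_gauss_decay:
  fixes f :: "real ^ 'n::finite \<Rightarrow> complex"
  assumes f: "f \<in> schwartz"
  obtains C where "C \<ge> 0" "\<And>x y. cmod (stft gauss_window f x y) \<le> C * wt 1 x * wt 1 y"
proof -
  define \<zeta> where "\<zeta> x y j = complex_of_real (x $ j) - \<i> * complex_of_real (y $ j)" for x y :: "real ^ 'n" and j
  \<comment> \<open>The function is generalized because the hypothesis is used twice, for f and for
    \<open>?f4\<close>: their transforms supply the terms 1 and |z_j|^4 of the new factor.\<close>
  have main: "\<exists>C. \<forall>x y. (\<Prod>j\<in>J. 1 + cmod (\<zeta> x y j) ^ 4) * cmod (stft gauss_window f x y) \<le> C"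
    if "finite J" "f \<in> schwartz" for J and f :: "real ^ 'n \<Rightarrow> complex"
    using that
  proof (induction J arbitrary: f)
    case empty
    then show ?case using stft_gauss_bound[OF schwartz_integrable] by auto
  next
    case (insert j J)
    let ?f4 = "creation j (creation j (creation j (creation j f)))"
    have s: "creation j f \<in> schwartz" "creation j (creation j f) \<in> schwartz"
      "creation j (creation j (creation j f)) \<in> schwartz" "?f4 \<in> schwartz"
      using insert.prems by (auto intro: schwartz_creation)
    obtain C C' where C: "\<And>x y. (\<Prod>j\<in>J. 1 + cmod (\<zeta> x y j) ^ 4) * cmod (stft gauss_window f x y) \<le> C"
      "\<And>x y. (\<Prod>j\<in>J. 1 + cmod (\<zeta> x y j) ^ 4) * cmod (stft gauss_window ?f4 x y) \<le> C'"
      using insert.IH[OF insert.prems] insert.IH[OF s(4)] by blast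
    have "cmod (stft gauss_window ?f4 x y) = cmod (\<zeta> x y j) ^ 4 * cmod (stft gauss_window f x y)" for x y
      by (simp add: stft_gauss_creation s insert.prems \<zeta>_def[symmetric] norm_mult power_numeral_reduce)
    then have "(\<Prod>j\<in>insert j J. 1 + cmod (\<zeta> x y j) ^ 4) * cmod (stft gauss_window f x y) \<le> C + C'" for x y
      using add_mono[OF C(1)[of x y] C(2)[of x y]] insert.hyps by (simp add: algebra_simps)
    then show ?case by blast
  qed
  from main[OF finite_class.finite_UNIV f] obtain C where
    C: "\<And>x y. (\<Prod>j\<in>UNIV. 1 + cmod (\<zeta> x y j) ^ 4) * cmod (stft gauss_window f x y) \<le> C" by blast
  have C0: "C \<ge> 0" by (rule order_trans[OF _ C[of 0 0]]) (auto intro!: mult_nonneg_nonneg prod_nonneg)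
  have "cmod (stft gauss_window f x y) \<le> (2 ^ CARD('n) * C) * wt 1 x * wt 1 y" for x y
  proof -
    have "inverse (wt 1 x * wt 1 y) = (\<Prod>j\<in>UNIV. (1 + (x $ j)\<^sup>2) * (1 + (y $ j)\<^sup>2))"
      by (simp add: wt_vec powr_minus prod_inversef[symmetric] abs_of_nonneg add_nonneg_nonneg prod.distrib)
    also have "\<dots> \<le> (\<Prod>j\<in>(UNIV :: 'n set). 2 * (1 + cmod (\<zeta> x y j) ^ 4))"
    proof (intro prod_mono conjI)
      fix j
      define u v where "u = (x $ j)\<^sup>2" and "v = (y $ j)\<^sup>2"
      have uv: "u \<ge> 0" "v \<ge> 0" by (auto simp: u_def v_def)
      have "cmod (\<zeta> x y j) ^ 4 = ((cmod (\<zeta> x y j))\<^sup>2)\<^sup>2" by simp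
      also have "(cmod (\<zeta> x y j))\<^sup>2 = u + v" by (simp add: cmod_power2 \<zeta>_def u_def v_def)
      finally have z: "cmod (\<zeta> x y j) ^ 4 = (u + v)\<^sup>2" .
      have "(1 + u) * (1 + v) \<le> 2 * (1 + (u + v)\<^sup>2)"
      proof -
        have "2 * (u + v) \<le> 1 + (u + v)\<^sup>2"
          using zero_le_power2[of "u + v - 1"] by (simp add: power2_eq_square algebra_simps)
        moreover have "u * v \<le> (u + v)\<^sup>2"
          using mult_nonneg_nonneg[OF uv] by (simp add: power2_sum)
        moreover have "(1 + u) * (1 + v) = 1 + (u + v) + u * v" by (simp add: algebra_simps)
        moreover have "0 \<le> (u + v)\<^sup>2" by simp
        moreover have "1 + (u + v) + P \<le> 2 * (1 + S)" if "2 * (u + v) \<le> 1 + S" "P \<le> S" "0 \<le> S" for P S :: real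
          using that by simp
        ultimately show ?thesis by metis
      qed
      then show "(1 + (x $ j)\<^sup>2) * (1 + (y $ j)\<^sup>2) \<le> 2 * (1 + cmod (\<zeta> x y j) ^ 4)"
        by (simp only: z u_def v_def)
    qed auto
    also have "\<dots> = 2 ^ CARD('n) * (\<Prod>j\<in>(UNIV :: 'n set). 1 + cmod (\<zeta> x y j) ^ 4)"
      by (simp only: prod.distrib prod_constant)
    finally have "inverse (wt 1 x * wt 1 y) * cmod (stft gauss_window f x y) \<le> 2 ^ CARD('n) * ((\<Prod>j\<in>(UNIV :: 'n set). 1 + cmod (\<zeta> x y j) ^ 4) * cmod (stft gauss_window f x y))"
      unfolding mult.assoc[symmetric] by (rule mult_right_mono) simp
    also have "\<dots> \<le> 2 ^ CARD('n) * C" by (intro mult_left_mono C) simp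
    finally show ?thesis using wt_pos[of 1 x] wt_pos[of 1 y] by (simp add: field_simps)
  qed
  then show thesis using that[of "2 ^ CARD('n) * C"] C0 by simp
qed

section \<open>Hermite functions\<close>

definition dgauss :: "nat \<Rightarrow> real \<Rightarrow> real" where
  "dgauss k = (deriv ^^ k) (\<lambda>t. exp (- (t\<^sup>2)))"

definition cgauss :: "complex \<Rightarrow> complex" where
  "cgauss z = exp (- z\<^sup>2)"

lemma cgauss_holomorphic: "cgauss holomorphic_on A"
  unfolding cgauss_def[abs_def] by (intro holomorphic_intros)

text \<open>The iterated real derivatives are restrictions of derivatives of an entire function.
  This yields at once that they exist and that Cauchy's inequality applies to them. In the induction
  the imaginary part of the derivative vanishes, being the derivative of the zero function.\<close>

lemma dgauss_complex:
  shows "(deriv ^^ k) cgauss (complex_of_real x) = complex_of_real (dgauss k x)"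
proof (induction k arbitrary: x)
  case 0
  then show ?case by (simp add: dgauss_def cgauss_def flip: exp_of_real)
next
  case (Suc k)
  let ?F = "(deriv ^^ k) cgauss"
  define D where "D = deriv ?F (complex_of_real x)"
  have "?F holomorphic_on UNIV" by (intro holomorphic_higher_deriv cgauss_holomorphic) auto
  then have "(?F has_field_derivative D) (at (complex_of_real x))"
    unfolding D_def by (intro holomorphic_derivI[of _ UNIV]) auto
  then have v: "((\<lambda>s. ?F (complex_of_real s)) has_vector_derivative D) (at x)"
    by (rule has_vector_derivative_real_field)
  then have "((\<lambda>s. complex_of_real (dgauss k s)) has_vector_derivative D) (at x)"
    by (simp add: Suc.IH)
  then have re: "(dgauss k has_field_derivative Re D) (at x)" and im: "((\<lambda>s. 0) has_field_derivative Im D) (at x)"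
    by (auto simp: has_vector_derivative_complex_iff has_real_derivative_iff_has_vector_derivative)
  have "Im D = 0" using im DERIV_const DERIV_unique by metis
  moreover have "dgauss (Suc k) x = Re D"
    using DERIV_imp_deriv[OF re] by (simp add: dgauss_def)
  ultimately have "complex_of_real (dgauss (Suc k) x) = D" by (simp add: complex_eq_iff)
  then show ?case by (simp add: D_def)
qed

lemma dgauss_has_derivative: "(dgauss k has_field_derivative dgauss (Suc k) x) (at x)"
proof -
  let ?F = "(deriv ^^ k) cgauss"
  have "?F holomorphic_on UNIV" by (intro holomorphic_higher_deriv cgauss_holomorphic) auto
  then have "(?F has_field_derivative deriv ?F (complex_of_real x)) (at (complex_of_real x))"
    by (intro holomorphic_derivI[of _ UNIV]) auto
  moreover have "deriv ?F (complex_of_real x) = complex_of_real (dgauss (Suc k) x)"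
    using dgauss_complex[of "Suc k" x] by simp
  ultimately have "((\<lambda>s. complex_of_real (dgauss k s)) has_vector_derivative complex_of_real (dgauss (Suc k) x)) (at x)"
    using has_vector_derivative_real_field[of ?F _ x] by (simp add: dgauss_complex)
  then show ?thesis
    by (auto simp: has_vector_derivative_complex_iff has_real_derivative_iff_has_vector_derivative)
qed

lemma dgauss_0: "dgauss 0 x = exp (- (x\<^sup>2))"
  by (simp add: dgauss_def)

lemma dgauss_1: "dgauss (Suc 0) x = - 2 * x * dgauss 0 x"
proof -
  have "((\<lambda>x. exp (- (x\<^sup>2))) has_field_derivative - 2 * x * exp (- (x\<^sup>2))) (at x)"
    by (auto intro!: derivative_eq_intros)
  moreover have "dgauss 0 = (\<lambda>x. exp (- (x\<^sup>2)))" by (simp add: dgauss_def)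
  ultimately show ?thesis using dgauss_has_derivative[of 0 x] DERIV_unique by metis
qed

text \<open>The three-term recursion of the Hermite polynomials; differentiating it for k gives it
  for k + 1. It is the source of the eigenvalue 2k + 1.\<close>

lemma dgauss_rec: "dgauss (Suc (Suc k)) x = - 2 * x * dgauss (Suc k) x - 2 * real (Suc k) * dgauss k x"
proof (induction k arbitrary: x)
  case 0
  have eq: "dgauss (Suc 0) = (\<lambda>x. - 2 * x * dgauss 0 x)" by (rule ext) (rule dgauss_1)
  have "((\<lambda>x. - 2 * x * dgauss 0 x) has_field_derivative - 2 * dgauss 0 x + dgauss (Suc 0) x * (- 2 * x)) (at x)"
    by (rule derivative_eq_intros dgauss_has_derivative refl | simp)+
  then show ?case using dgauss_has_derivative[of "Suc 0" x] unfolding eq by (auto dest: DERIV_unique)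
next
  case (Suc k)
  have eq: "dgauss (Suc (Suc k)) = (\<lambda>x. - 2 * x * dgauss (Suc k) x - 2 * real (Suc k) * dgauss k x)"
    by (rule ext) (rule Suc.IH)
  have "((\<lambda>x. - 2 * x * dgauss (Suc k) x - 2 * real (Suc k) * dgauss k x) has_field_derivative
     - 2 * dgauss (Suc k) x + dgauss (Suc (Suc k)) x * (- 2 * x) - 2 * real (Suc k) * dgauss (Suc k) x) (at x)"
    by (rule derivative_eq_intros dgauss_has_derivative refl | simp)+
  then have "dgauss (Suc (Suc (Suc k))) x = - 2 * dgauss (Suc k) x + dgauss (Suc (Suc k)) x * (- 2 * x) - 2 * real (Suc k) * dgauss (Suc k) x"
    using dgauss_has_derivative[of "Suc (Suc k)" x] DERIV_unique unfolding eq by blast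
  then show ?case by (simp add: algebra_simps)
qed

definition hnorm :: "nat \<Rightarrow> real" where "hnorm k = sqrt (2 ^ k * fact k)"

lemma hnorm_pos: "hnorm k > 0" by (simp add: hnorm_def)

lemma hnorm_Suc: "hnorm (Suc k) = sqrt (2 * real k + 2) * hnorm k"
  unfolding hnorm_def by (simp add: real_sqrt_mult[symmetric] algebra_simps)

lemma hnorm_sq: "hnorm k * hnorm k = 2 ^ k * fact k" "(hnorm k)\<^sup>2 = 2 ^ k * fact k" by (simp_all add: hnorm_def)

lemma hermite_fun_eq:
  "hermite_fun k x = pi powr (-1/4) / hnorm k * (-1) ^ k * exp (x\<^sup>2 / 2) * dgauss k x"
proof -
  have "(sqrt pi * 2 ^ k * fact k) powr (-1/2) = sqrt pi powr (-1/2) * (2 ^ k * fact k) powr (-1/2)"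
    by (simp add: powr_mult mult.assoc)
  also have "sqrt pi powr (-1/2) = pi powr (-1/4)"
    by (simp add: powr_half_sqrt[symmetric] powr_powr)
  also have "(2 ^ k * fact k) powr (-1/2) = 1 / hnorm k"
    by (simp add: hnorm_def powr_minus_divide powr_half_sqrt)
  finally show ?thesis by (simp add: hermite_fun_def dgauss_def)
qed

lemma hermite_fun_0: "hermite_fun 0 x = pi powr (-1/4) * exp (- x\<^sup>2 / 2)"
  by (simp add: hermite_fun_eq hnorm_def dgauss_0 flip: exp_add)

text \<open>The derivative of h_k, written by means of the raising relation (x - d/dx) h_k = sqrt
  (2k + 2) h_{k+1}, which can be read off from Rodrigues' formula.\<close>

definition hermite_fun' :: "nat \<Rightarrow> real \<Rightarrow> real" where
  "hermite_fun' k x = x * hermite_fun k x - sqrt (2 * real k + 2) * hermite_fun (Suc k) x"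

lemma hermite_fun_deriv: "(hermite_fun k has_field_derivative hermite_fun' k x) (at x)"
proof -
  let ?c = "pi powr (-1/4) / hnorm k * (-1) ^ k"
  have eq: "hermite_fun k = (\<lambda>x. ?c * exp (x\<^sup>2 / 2) * dgauss k x)"
    by (rule ext) (rule hermite_fun_eq)
  have "((\<lambda>x. ?c * exp (x\<^sup>2 / 2) * dgauss k x) has_field_derivative ?c * (x * exp (x\<^sup>2 / 2)) * dgauss k x + dgauss (Suc k) x * (?c * exp (x\<^sup>2 / 2))) (at x)"
    by (rule derivative_eq_intros dgauss_has_derivative refl | simp)+
  also have "?c * (x * exp (x\<^sup>2 / 2)) * dgauss k x + dgauss (Suc k) x * (?c * exp (x\<^sup>2 / 2)) = hermite_fun' k x"
    using hnorm_pos[of k] by (simp add: hermite_fun'_def hermite_fun_eq hnorm_Suc field_simps)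
  finally show ?thesis by (simp only: eq)
qed

text \<open>The eigenvalue equation of the one-dimensional Hermite operator. Applying the raising
  relation twice introduces h_{k+2}, which the three-term recursion eliminates.\<close>

lemma hermite_fun_deriv2: "(hermite_fun' k has_field_derivative (x\<^sup>2 - (2 * real k + 1)) * hermite_fun k x) (at x)"
proof -
  have eq: "hermite_fun' k = (\<lambda>x. x * hermite_fun k x - sqrt (2 * real k + 2) * hermite_fun (Suc k) x)"
    by (rule ext) (rule hermite_fun'_def)
  have "((\<lambda>x. x * hermite_fun k x - sqrt (2 * real k + 2) * hermite_fun (Suc k) x) has_field_derivative
      (hermite_fun k x + hermite_fun' k x * x) - sqrt (2 * real k + 2) * hermite_fun' (Suc k) x) (at x)"
    by (rule derivative_eq_intros hermite_fun_deriv refl | simp)+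
  also have "(hermite_fun k x + hermite_fun' k x * x) - sqrt (2 * real k + 2) * hermite_fun' (Suc k) x = (x\<^sup>2 - (2 * real k + 1)) * hermite_fun k x"
  proof -
    define a where "a = sqrt (2 * real k + 2)"
    define b where "b = sqrt (2 * real k + 4)"
    have ab: "a > 0" "b > 0" "a * a = 2 * real k + 2" by (auto simp: a_def b_def)
    have n: "hnorm (Suc k) = a * hnorm k" "hnorm (Suc (Suc k)) = b * (a * hnorm k)"
      by (simp_all add: hnorm_Suc a_def b_def algebra_simps)
    define c where "c = pi powr (-1/4) * (-1) ^ k * exp (x\<^sup>2 / 2) / hnorm k"
    have h0: "hermite_fun k x = c * dgauss k x" by (simp add: hermite_fun_eq c_def)
    have h1: "a * hermite_fun (Suc k) x = - c * dgauss (Suc k) x"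
      using ab hnorm_pos[of k] by (simp add: hermite_fun_eq c_def n)
    have h2: "a * (b * hermite_fun (Suc (Suc k)) x) = c * dgauss (Suc (Suc k)) x"
      using ab hnorm_pos[of k] by (simp add: hermite_fun_eq c_def n)
    have "(hermite_fun k x + hermite_fun' k x * x) - a * hermite_fun' (Suc k) x
       = hermite_fun k x + (x * hermite_fun k x - a * hermite_fun (Suc k) x) * x - (x * (a * hermite_fun (Suc k) x) - a * (b * hermite_fun (Suc (Suc k)) x))"
      by (simp add: hermite_fun'_def a_def b_def algebra_simps)
    also have "\<dots> = (x\<^sup>2 - (2 * real k + 1)) * hermite_fun k x"
      unfolding h0 h1 h2 dgauss_rec by (simp add: power2_eq_square algebra_simps)
    finally show ?thesis by (simp add: a_def)
  qed
  finally show ?thesis unfolding eq .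
qed

text \<open>A crude upper half of Stirling's formula. The induction step is (1 - 1/n)^n \<le> 1/e
  with n = k + 2.\<close>

lemma fact_exp_bound: "fact k * exp (real k) \<le> (real k + 1) ^ (k + 1)"
proof (induction k)
  case (Suc k)
  let ?n = "real k + 2"
  have "1 - 1 / ?n \<le> exp (- (1 / ?n))" using exp_ge_add_one_self[of "- (1 / ?n)"] by simp
  then have "((real k + 1) / ?n) ^ (k + 2) \<le> exp (- (1 / ?n)) ^ (k + 2)"
    by (intro power_mono) (auto simp: field_simps)
  also have "\<dots> = exp (real (k + 2) * - (1 / ?n))" by (simp only: exp_of_nat_mult)
  also have "real (k + 2) * - (1 / ?n) = - 1" by (simp add: field_simps)
  finally have *: "((real k + 1) / ?n) ^ (k + 2) \<le> exp (- 1)" .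
  have le: "exp 1 * (real k + 1) ^ (k + 2) \<le> ?n ^ (k + 2)"
  proof -
    have gen: "exp 1 * P \<le> Q" if "P / Q \<le> exp (- 1)" "Q > 0" for P Q :: real
      using that by (simp add: exp_minus field_simps)
    show ?thesis using *[unfolded power_divide] by (intro gen) auto
  qed
  have "fact (Suc k) * exp (real (Suc k)) = (real k + 1) * exp 1 * (fact k * exp (real k))"
    by (simp add: exp_add algebra_simps)
  also have "\<dots> \<le> (real k + 1) * exp 1 * (real k + 1) ^ (k + 1)"
    by (intro mult_left_mono Suc.IH) auto
  also have "\<dots> = exp 1 * (real k + 1) ^ (k + 2)" by (simp add: algebra_simps)
  also note le
  finally show ?case by (simp add: algebra_simps)
qed simp

text \<open>Cauchy's inequality for $e^{-z^2}$ on the circle of radius $r$ about $x$; the choice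
  $r^2 = (k+1)/2$ nearly minimizes $e^{r^2} r^{-k}$.\<close>

lemma hermite_fun_bound: "(1 + x\<^sup>2) * \<bar>hermite_fun k x\<bar> \<le> 16 * (real k + 1)\<^sup>2"
proof -
  define r where "r = sqrt ((real k + 1) / 2)"
  have r: "r > 0" "r\<^sup>2 = (real k + 1) / 2" by (auto simp: r_def)
  define B where "B = exp (r\<^sup>2) * (5 + 8 * r\<^sup>2) / ((1 + x\<^sup>2) * exp (x\<^sup>2 / 2))"
  have x1: "1 + x\<^sup>2 > 0" by (simp add: add_pos_nonneg)
  have "norm ((deriv ^^ k) cgauss (complex_of_real x)) \<le> fact k * B / r ^ k"
  proof (rule Cauchy_inequality)
    show "cgauss holomorphic_on ball (complex_of_real x) r" by (rule cgauss_holomorphic)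
    show "continuous_on (cball (complex_of_real x) r) cgauss"
      using cgauss_holomorphic holomorphic_on_imp_continuous_on by blast
    show "0 < r" by fact
    fix z assume "norm (complex_of_real x - z) = r"
    define a b where "a = Re z - x" and "b = Im z"
    have z: "z = Complex (x + a) b" by (simp add: a_def b_def)
    have "(norm (complex_of_real x - z))\<^sup>2 = a\<^sup>2 + b\<^sup>2"
      by (simp add: cmod_power2 z)
    then have ab: "a\<^sup>2 + b\<^sup>2 = r\<^sup>2" using \<open>norm (complex_of_real x - z) = r\<close> by simp
    define q where "q = (x + 2 * a)\<^sup>2"
    have "norm (cgauss z) = exp (b\<^sup>2 - (x + a)\<^sup>2)"
      by (simp add: cgauss_def z power2_eq_square algebra_simps)
    \<comment> \<open>Completing the square under a^2 + b^2 = r^2 isolates exp (-x^2/2), which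
      compensates the factor exp (x^2/2) of the Hermite function.\<close>
    also have "b\<^sup>2 - (x + a)\<^sup>2 = r\<^sup>2 + - (q / 2) + - (x\<^sup>2 / 2)"
      unfolding ab[symmetric] q_def by (simp add: power2_eq_square algebra_simps)
    also have "exp \<dots> = exp (r\<^sup>2) * exp (- (q / 2)) / exp (x\<^sup>2 / 2)"
      unfolding exp_add exp_minus[of "x\<^sup>2 / 2"] by (simp only: divide_inverse)
    finally have e: "norm (cgauss z) = exp (r\<^sup>2) * exp (- (q / 2)) / exp (x\<^sup>2 / 2)" .
    \<comment> \<open>The leftover Gaussian in q absorbs the growth of 1 + x^2, because x^2 \<le> 2
      q + 8 a^2 and a^2 \<le> r^2. This is the source of the quadratic decay.\<close>
    have "(1 + x\<^sup>2) * exp (- (q / 2)) \<le> 5 + 8 * r\<^sup>2"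
    proof -
      have "x\<^sup>2 \<le> 2 * q + 8 * a\<^sup>2"
        using zero_le_power2[of "x + 4 * a"] unfolding q_def by (simp add: power2_eq_square algebra_simps)
      then have xq: "1 + x\<^sup>2 \<le> 2 * q + (1 + 8 * r\<^sup>2)" using ab zero_le_power2[of b] by linarith
      have q0: "q \<ge> 0" by (simp add: q_def)
      have "q / 2 \<le> exp (q / 2)" using exp_ge_add_one_self[of "q / 2"] by linarith
      then have "2 * q * exp (- (q / 2)) \<le> 4" by (simp add: exp_minus field_simps)
      moreover have "(1 + 8 * r\<^sup>2) * exp (- (q / 2)) \<le> 1 + 8 * r\<^sup>2"
        using q0 by (intro mult_left_le) auto
      moreover have "(1 + x\<^sup>2) * exp (- (q / 2)) \<le> (2 * q + (1 + 8 * r\<^sup>2)) * exp (- (q / 2))"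
        using xq by (intro mult_right_mono) auto
      ultimately show ?thesis by (simp add: distrib_right)
    qed
    then have "exp (- (q / 2)) \<le> (5 + 8 * r\<^sup>2) / (1 + x\<^sup>2)"
      using x1 by (simp add: pos_le_divide_eq mult.commute)
    then have "exp (r\<^sup>2) * exp (- (q / 2)) / exp (x\<^sup>2 / 2) \<le> exp (r\<^sup>2) * ((5 + 8 * r\<^sup>2) / (1 + x\<^sup>2)) / exp (x\<^sup>2 / 2)"
      by (intro divide_right_mono mult_left_mono) auto
    then show "norm (cgauss z) \<le> B" unfolding e B_def by simp
  qed
  then have "\<bar>dgauss k x\<bar> \<le> fact k * B / r ^ k" by (simp add: dgauss_complex)
  then have "(1 + x\<^sup>2) * exp (x\<^sup>2 / 2) * \<bar>dgauss k x\<bar> \<le> (1 + x\<^sup>2) * exp (x\<^sup>2 / 2) * (fact k * B / r ^ k)"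
    using x1 by (intro mult_left_mono) auto
  also have "\<dots> = fact k * exp (r\<^sup>2) * (5 + 8 * r\<^sup>2) / r ^ k"
    using x1 unfolding B_def by simp
  finally have d: "(1 + x\<^sup>2) * exp (x\<^sup>2 / 2) * \<bar>dgauss k x\<bar> \<le> fact k * exp (r\<^sup>2) * (5 + 8 * r\<^sup>2) / r ^ k" .
  have pi1: "pi powr (-1/4) \<le> 1" using gauss_window_const_le1[of 1] by simp
  have "(1 + x\<^sup>2) * \<bar>hermite_fun k x\<bar> = pi powr (-1/4) / hnorm k * ((1 + x\<^sup>2) * exp (x\<^sup>2 / 2) * \<bar>dgauss k x\<bar>)"
    using hnorm_pos[of k] by (simp add: hermite_fun_eq abs_mult power_abs mult_ac)
  also have "\<dots> \<le> 1 / hnorm k * (fact k * exp (r\<^sup>2) * (5 + 8 * r\<^sup>2) / r ^ k)"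
    using hnorm_pos[of k] pi1 d x1 by (intro mult_mono divide_right_mono) auto
  finally have le: "(1 + x\<^sup>2) * \<bar>hermite_fun k x\<bar> \<le> fact k * exp (r\<^sup>2) / (hnorm k * r ^ k) * (5 + 8 * r\<^sup>2)" by simp
  have sq: "(fact k * exp (r\<^sup>2) / (hnorm k * r ^ k))\<^sup>2 \<le> 3 * (real k + 1)"
  proof -
    have "(fact k * exp (r\<^sup>2) / (hnorm k * r ^ k))\<^sup>2 = (fact k)\<^sup>2 * exp (2 * r\<^sup>2) / (2 ^ k * fact k * (r\<^sup>2) ^ k)"
      by (simp add: power_divide power_mult_distrib hnorm_sq exp_double power_mult[symmetric] mult.commute)
    also have "exp (2 * r\<^sup>2) = exp (real k) * exp 1" by (simp add: r(2) mult_exp_exp)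
    also have "(fact k)\<^sup>2 * (exp (real k) * exp 1) / (2 ^ k * fact k * (r\<^sup>2) ^ k) = (fact k * exp (real k)) * exp 1 / (real k + 1) ^ k"
      unfolding r(2) by (simp add: power_divide power2_eq_square)
    also have "\<dots> \<le> (real k + 1) ^ (k + 1) * exp 1 / (real k + 1) ^ k"
      by (intro divide_right_mono mult_right_mono fact_exp_bound) auto
    also have "\<dots> = exp 1 * (real k + 1)" by simp
    also have "\<dots> \<le> 3 * (real k + 1)" using exp_le by (intro mult_right_mono) auto
    finally show ?thesis .
  qed
  \<comment> \<open>The number 16/9 satisfies (16/9)^2 \<ge> 3, as the previous bound requires, and
    its product with 9, the factor bounding 5 + 8 r^2, is the constant 16 of the claim.\<close>
  have "(fact k * exp (r\<^sup>2) / (hnorm k * r ^ k))\<^sup>2 \<le> (16 / 9 * (real k + 1))\<^sup>2"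
  proof (rule order_trans[OF sq])
    have "3 * (real k + 1) \<le> (16/9)\<^sup>2 * (real k + 1) * 1" by (simp add: power2_eq_square)
    also have "\<dots> \<le> (16/9)\<^sup>2 * (real k + 1) * (real k + 1)" by (intro mult_left_mono) auto
    finally show "3 * (real k + 1) \<le> (16 / 9 * (real k + 1))\<^sup>2" by (simp add: power2_eq_square algebra_simps)
  qed
  then have "fact k * exp (r\<^sup>2) / (hnorm k * r ^ k) \<le> 16 / 9 * (real k + 1)"
    by (rule power2_le_imp_le) simp
  moreover have "5 + 8 * r\<^sup>2 \<le> 9 * (real k + 1)" unfolding r(2) by simp
  ultimately have "fact k * exp (r\<^sup>2) / (hnorm k * r ^ k) * (5 + 8 * r\<^sup>2) \<le> (16 / 9 * (real k + 1)) * (9 * (real k + 1))"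
    by (intro mult_mono) auto
  also have "\<dots> = 16 * (real k + 1)\<^sup>2" by (simp add: power2_eq_square algebra_simps)
  finally show ?thesis using le by linarith
qed

lemma wt_real: "wt 1 (x :: real) = inverse (1 + x\<^sup>2)"
  by (simp add: wt_def powr_minus)

lemma hermite_fun_wt: "\<bar>hermite_fun k x\<bar> \<le> 16 * (real k + 1)\<^sup>2 * wt 1 x"
proof -
  have "1 + x\<^sup>2 > 0" by (simp add: add_pos_nonneg)
  then show ?thesis using hermite_fun_bound[of x k] by (simp add: wt_real field_simps)
qed

lemma hermite_fun_continuous: "continuous_on UNIV (hermite_fun k)"
  using hermite_fun_deriv by (meson DERIV_isCont continuous_at_imp_continuous_on)

lemma hermite_fun_measurable [measurable]: "hermite_fun k \<in> borel_measurable borel"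
  by (rule borel_measurable_continuous_onI[OF hermite_fun_continuous])

lemma hermite_fun'_measurable [measurable]: "hermite_fun' k \<in> borel_measurable borel"
  unfolding hermite_fun'_def[abs_def] by measurable

section \<open>Hermite functions paired with wave packets in one variable\<close>

lemma wt_real_integrable: "integrable lborel (\<lambda>x::real. K * wt 1 x)"
  using wt_integrable[of 1, where 'a=real] by simp

text \<open>The Bargmann transform of $h_k$, as lemma \<open>gabor_hermite\<close> below shows:
  $\int h_k(t) h_0(t-x) e^{-iyt}\,dt = \bar z^k (2^k k!)^{-1/2} e^{-|z|^2/4 - ixy/2}$ with $z = x + iy$.\<close>

definition gabor1 :: "nat \<Rightarrow> real \<Rightarrow> real \<Rightarrow> complex" where
  "gabor1 k x y = (complex_of_real x - \<i> * complex_of_real y) ^ k / complex_of_real (hnorm k) *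
     exp (- complex_of_real (x\<^sup>2 + y\<^sup>2) / 4 - \<i> * complex_of_real (x * y) / 2)"

definition wave1 :: "real \<Rightarrow> real \<Rightarrow> real \<Rightarrow> complex" where
  "wave1 x y t = complex_of_real (hermite_fun 0 (t - x)) * iexpn (y * t)"

lemma wave1_measurable [measurable]: "wave1 x y \<in> borel_measurable borel"
  unfolding wave1_def[abs_def] by measurable

lemma wave1_bound: "cmod (wave1 x y t) \<le> 1"
proof -
  have "\<bar>hermite_fun 0 s\<bar> \<le> 1" for s
  proof -
    have "pi powr (-1/4) * exp (- s\<^sup>2 / 2) \<le> 1"
      using gauss_window_const_le1[of 1] by (intro mult_le_one) auto
    then show ?thesis by (simp add: hermite_fun_0 abs_mult)
  qed
  then show ?thesis by (simp add: wave1_def norm_mult)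
qed

lemma wave1_deriv:
  "(wave1 x y has_vector_derivative - (complex_of_real (t - x) + \<i> * complex_of_real y) * wave1 x y t) (at t)"
proof -
  let ?K = "complex_of_real (pi powr (-1/4))"
  define F where "F w = ?K * exp (- (w - complex_of_real x)\<^sup>2 / 2 - \<i> * (complex_of_real y * w))" for w
  have eq: "wave1 x y s = F (complex_of_real s)" for s
    unfolding wave1_def F_def hermite_fun_0 of_real_mult mult.assoc exp_of_real[symmetric] mult_exp_exp by simp
  have "(F has_field_derivative - (complex_of_real (t - x) + \<i> * complex_of_real y) * F (complex_of_real t)) (at (complex_of_real t))"
    unfolding F_def by (auto intro!: derivative_eq_intros simp: field_simps)
  from has_vector_derivative_real_field[OF this] show ?thesis
    by (simp add: eq[abs_def])
qed

lemma integrable_hermite_wave1: "integrable lborel (\<lambda>t. complex_of_real (hermite_fun k t) * wave1 x y t)"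
proof (rule Bochner_Integration.integrable_bound[OF wt_real_integrable[of "16 * (real k + 1)\<^sup>2"]])
  have "\<bar>hermite_fun k t\<bar> * cmod (wave1 x y t) \<le> 16 * (real k + 1)\<^sup>2 * wt 1 t" for t
    using mult_mono[OF hermite_fun_wt[of k t] wave1_bound[of x y t]] wt_pos[of 1 t] by simp
  then show "AE t in lborel. norm (complex_of_real (hermite_fun k t) * wave1 x y t) \<le> norm (16 * (real k + 1)\<^sup>2 * wt 1 t)"
    by (auto simp: norm_mult less_imp_le[OF wt_pos])
qed measurable

lemma gabor_hermite_0:
  "(\<integral>t. complex_of_real (hermite_fun 0 t) * wave1 x y t \<partial>lborel) = gabor1 0 x y"
proof -
  define f where "f t = complex_of_real (hermite_fun 0 t) * wave1 x y t" for t
  have [measurable]: "f \<in> borel_measurable borel" unfolding f_def[abs_def] by measurable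
  define K where "K = complex_of_real (exp (- x\<^sup>2 / 4) / sqrt pi) * exp (- \<i> * complex_of_real (x * y) / 2)"
  have pi2: "pi powr (-1/4) * pi powr (-1/4) = 1 / sqrt pi"
    by (simp add: powr_add[symmetric] powr_minus_divide powr_half_sqrt)
  \<comment> \<open>The product of the Gaussians centred at 0 and x is a Gaussian centred at the
    midpoint x/2; the scale 1/sqrt 2 makes it standard.\<close>
  have "f (x / 2 + (1 / sqrt 2) * v) = K * (iexp ((- y / sqrt 2) * v) * complex_of_real (exp (- v\<^sup>2 / 2)))" for v
  proof -
    define w where "w = v / sqrt 2"
    have v2: "v\<^sup>2 = 2 * w\<^sup>2" by (simp add: w_def power_divide)
    have "f (x / 2 + w) = complex_of_real ((pi powr (-1/4) * pi powr (-1/4)) * (exp (- (x / 2 + w)\<^sup>2 / 2) * exp (- (w - x / 2)\<^sup>2 / 2))) * iexpn (y * (x / 2 + w))"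
      by (simp add: f_def wave1_def hermite_fun_0 field_simps)
    also have "exp (- (x / 2 + w)\<^sup>2 / 2) * exp (- (w - x / 2)\<^sup>2 / 2) = exp (- x\<^sup>2 / 4) * exp (- v\<^sup>2 / 2)"
      unfolding v2 mult_exp_exp by (simp add: power2_eq_square field_simps)
    also have "iexpn (y * (x / 2 + w)) = exp (- \<i> * complex_of_real (x * y) / 2) * iexp ((- y / sqrt 2) * v)"
      unfolding mult_exp_exp by (simp add: w_def algebra_simps)
    finally show ?thesis unfolding pi2 by (simp add: K_def w_def mult_ac)
  qed
  then have "(\<integral>v. f (x / 2 + (1 / sqrt 2) * v) \<partial>lborel) = K * (sqrt (2 * pi) * exp (- (- y / sqrt 2)\<^sup>2 / 2))"
    by (simp only: integral_mult_right_zero gauss1_fourier)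
  then have "(\<integral>t. f t \<partial>lborel) = complex_of_real (1 / sqrt 2) * (K * (sqrt (2 * pi) * exp (- (- y / sqrt 2)\<^sup>2 / 2)))"
    using lborel_integral_affine[of "1 / sqrt 2" f "x / 2"] by (simp add: scaleR_conv_of_real)
  also have "\<dots> = gabor1 0 x y"
  proof -
    have "(- y / sqrt 2)\<^sup>2 / 2 = y\<^sup>2 / 4" by (simp add: power_divide)
    then have "complex_of_real (1 / sqrt 2) * (K * (sqrt (2 * pi) * exp (- (- y / sqrt 2)\<^sup>2 / 2)))
      = complex_of_real ((1 / sqrt 2) * (1 / sqrt pi) * sqrt (2 * pi)) * (complex_of_real (exp (- x\<^sup>2 / 4) * exp (- y\<^sup>2 / 4)) * exp (- \<i> * complex_of_real (x * y) / 2))"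
      by (simp add: K_def mult_ac)
    also have "(1 / sqrt 2) * (1 / sqrt pi) * sqrt (2 * pi) = 1" by (simp add: real_sqrt_mult)
    also have "complex_of_real (exp (- x\<^sup>2 / 4) * exp (- y\<^sup>2 / 4)) * exp (- \<i> * complex_of_real (x * y) / 2) = exp (- complex_of_real (x\<^sup>2 + y\<^sup>2) / 4 - \<i> * complex_of_real (x * y) / 2)"
      unfolding mult_exp_exp exp_of_real[symmetric] by (simp add: add_divide_distrib diff_divide_distrib)
    finally show ?thesis by (simp add: gabor1_def hnorm_def)
  qed
  finally show ?thesis by (simp only: f_def)
qed

text \<open>By the raising relation and the derivative of the wave packet, the derivative of h_k
  times the packet is a combination of the integrands for k and k + 1. Its integral vanishes, which
  gives the one-step recursion with factor (x - i y)/sqrt (2k + 2).\<close>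

lemma gabor_hermite:
  "(\<integral>t. complex_of_real (hermite_fun k t) * wave1 x y t \<partial>lborel) = gabor1 k x y"
proof (induction k)
  case 0 show ?case by (rule gabor_hermite_0)
next
  case (Suc k)
  let ?\<zeta> = "complex_of_real x - \<i> * complex_of_real y"
  let ?s = "complex_of_real (sqrt (2 * real k + 2))"
  define u where "u t = complex_of_real (hermite_fun k t) * wave1 x y t" for t
  define u' where "u' t = ?\<zeta> * (complex_of_real (hermite_fun k t) * wave1 x y t) - ?s * (complex_of_real (hermite_fun (Suc k) t) * wave1 x y t)" for t
  define C where "C = (1 + cmod ?\<zeta>) * (16 * (real k + 1)\<^sup>2) + sqrt (2 * real k + 2) * (16 * (real (Suc k) + 1)\<^sup>2)"
  have b: "cmod (complex_of_real (hermite_fun k t) * wave1 x y t) \<le> 16 * (real k + 1)\<^sup>2 * wt 1 t" for k t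
    using mult_mono[OF hermite_fun_wt[of k t] wave1_bound[of x y t]] wt_pos[of 1 t] by (simp add: norm_mult)
  have "(\<integral>t. u' t \<partial>lborel) = 0"
  proof (rule integral_derivative_zero[where b = 1 and u = u and C = C])
    show "((\<lambda>s. u (t + s *\<^sub>R 1)) has_vector_derivative u' (t + s *\<^sub>R 1)) (at s)" for t s
    proof (rule has_vector_derivative_line)
      define r where "r = t + s"
      have "((\<lambda>t. complex_of_real (hermite_fun k t)) has_vector_derivative complex_of_real (hermite_fun' k r)) (at r)"
        using hermite_fun_deriv[of k r]
        by (auto simp: has_real_derivative_iff_has_vector_derivative intro!: has_vector_derivative_of_real)
      from has_vector_derivative_mult[OF this wave1_deriv]
      have d: "(u has_vector_derivative complex_of_real (hermite_fun k r) * (- (complex_of_real (r - x) + \<i> * complex_of_real y) * wave1 x y r) + complex_of_real (hermite_fun' k r) * wave1 x y r) (at r)"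
        unfolding u_def[abs_def] .
      have eq: "complex_of_real (hermite_fun k r) * (- (complex_of_real (r - x) + \<i> * complex_of_real y) * wave1 x y r) + complex_of_real (hermite_fun' k r) * wave1 x y r = u' r"
        unfolding u'_def hermite_fun'_def by (simp add: algebra_simps)
      have "(u has_vector_derivative u' r) (at (r + 0))" using d unfolding eq by simp
      then have "(u has_vector_derivative u' r) (at ((\<lambda>v. r + v) 0))" by simp
      moreover have "((\<lambda>v. r + v) has_vector_derivative 1) (at 0)"
        by (auto intro!: derivative_eq_intros)
      ultimately have "((\<lambda>v. u (r + v)) has_vector_derivative u' r) (at 0)"
        using vector_diff_chain_at[of "\<lambda>v. r + v" 1 0 u "u' r"] by (simp add: o_def)
      then show "((\<lambda>v. u (t + s *\<^sub>R 1 + v *\<^sub>R 1)) has_vector_derivative u' (t + s *\<^sub>R 1)) (at 0)"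
        by (simp add: r_def)
    qed
    have nn: "16 * (real k + 1)\<^sup>2 * wt 1 t \<ge> 0" for k and t :: real using wt_pos[of 1 t] by simp
    show "cmod (u t) \<le> C * wt 1 t" for t
    proof -
      have "1 * (16 * (real k + 1)\<^sup>2 * wt 1 t) \<le> C * wt 1 t"
        unfolding C_def distrib_right[of _ _ "wt 1 t"] using nn[of k t] nn[of "Suc k" t]
        by (simp add: distrib_right add_increasing2 mult.assoc)
      then show ?thesis using b[of k t] by (simp add: u_def)
    qed
    show "cmod (u' t) \<le> C * wt 1 t" for t
    proof -
      have "cmod (u' t) \<le> cmod ?\<zeta> * (16 * (real k + 1)\<^sup>2 * wt 1 t) + sqrt (2 * real k + 2) * (16 * (real (Suc k) + 1)\<^sup>2 * wt 1 t)"
        unfolding u'_def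
        by (rule order_trans[OF norm_triangle_ineq4]) (unfold norm_mult[of ?\<zeta>] norm_mult[of ?s], intro add_mono mult_mono b, auto)
      also have "\<dots> \<le> C * wt 1 t"
        unfolding C_def using nn[of k t] by (simp add: algebra_simps)
      finally show ?thesis .
    qed
    show "u \<in> borel_measurable borel" "u' \<in> borel_measurable borel"
      unfolding u_def[abs_def] u'_def[abs_def] by measurable
  qed simp
  moreover have "(\<integral>t. u' t \<partial>lborel) = ?\<zeta> * gabor1 k x y - ?s * (\<integral>t. complex_of_real (hermite_fun (Suc k) t) * wave1 x y t \<partial>lborel)"
    unfolding u'_def using integrable_hermite_wave1[of k x y] integrable_hermite_wave1[of "Suc k" x y] Suc.IH by simp
  ultimately have "?s * (\<integral>t. complex_of_real (hermite_fun (Suc k) t) * wave1 x y t \<partial>lborel) = ?\<zeta> * gabor1 k x y" by simp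
  also have "\<dots> = ?s * gabor1 (Suc k) x y"
    using hnorm_pos[of k] by (simp add: gabor1_def hnorm_Suc del: of_real_add)
  finally show ?case by (simp del: of_real_add)
qed

text \<open>Ratio test: the quotient of the polynomial factors is at most 4, and R / sqrt (2k + 2)
  \<le> 1/8 as soon as k \<ge> 32 R^2, so the ratio is at most 1/2.\<close>

lemma summable_hnorm: "summable (\<lambda>k. (real k + 1)\<^sup>2 * (R ^ k / hnorm k))" if R: "R \<ge> 0"
proof (rule summable_ratio_test[of "1/2" "nat \<lceil>32 * R\<^sup>2\<rceil>"])
  fix k assume k: "k \<ge> nat \<lceil>32 * R\<^sup>2\<rceil>"
  then have "64 * R\<^sup>2 \<le> 2 * real k + 2" by linarith
  then have s: "8 * R \<le> sqrt (2 * real k + 2)" by (intro real_le_rsqrt) (simp add: power2_eq_square)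
  have s0: "sqrt (2 * real k + 2) > 0" by simp
  have q: "(real (Suc k) + 1)\<^sup>2 \<le> 4 * (real k + 1)\<^sup>2"
    by (simp add: power2_eq_square algebra_simps)
  have "(real (Suc k) + 1)\<^sup>2 * (R ^ Suc k / hnorm (Suc k)) = ((real (Suc k) + 1)\<^sup>2 * (R / sqrt (2 * real k + 2))) * (R ^ k / hnorm k)"
    by (simp add: hnorm_Suc)
  also have "\<dots> \<le> ((4 * (real k + 1)\<^sup>2) * (1 / 8)) * (R ^ k / hnorm k)"
  proof (intro mult_right_mono mult_mono q)
    show "R / sqrt (2 * real k + 2) \<le> 1 / 8" using s s0 by (simp add: field_simps)
  qed (use R hnorm_pos[of k] in auto)
  finally show "norm ((real (Suc k) + 1)\<^sup>2 * (R ^ Suc k / hnorm (Suc k))) \<le> 1/2 * norm ((real k + 1)\<^sup>2 * (R ^ k / hnorm k))"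
    using R hnorm_pos[of k] hnorm_pos[of "Suc k"] by (simp add: abs_mult)
qed simp

lemma cmod_gabor1: "cmod (gabor1 k x y) = cmod (complex_of_real x - \<i> * complex_of_real y) ^ k / hnorm k * exp (- (x\<^sup>2 + y\<^sup>2) / 4)"
  using hnorm_pos[of k] by (simp add: gabor1_def norm_mult norm_divide norm_power)

lemma summable_gabor1: "summable (\<lambda>k. 16 * (real k + 1)\<^sup>2 * cmod (gabor1 k x y))"
proof -
  let ?R = "cmod (complex_of_real x - \<i> * complex_of_real y)"
  have "summable (\<lambda>k. (16 * exp (- (x\<^sup>2 + y\<^sup>2) / 4)) * ((real k + 1)\<^sup>2 * (?R ^ k / hnorm k)))"
    by (intro summable_mult summable_hnorm) simp
  then show ?thesis by (simp add: cmod_gabor1 mult_ac)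
qed

section \<open>Passage to several variables\<close>

lemma integral_prod_vec:
  fixes F :: "'n::finite \<Rightarrow> real \<Rightarrow> 'b::{real_normed_field,banach,second_countable_topology}"
  assumes F: "\<And>j. integrable lborel (F j)"
  shows "integral\<^sup>L lborel (\<lambda>x::real^'n. \<Prod>j\<in>UNIV. F j (x $ j)) = (\<Prod>j\<in>UNIV. \<integral>t. F j t \<partial>lborel)"
proof -
  define ix where "ix b = (THE j. axis j (1::real) = (b :: real^'n))" for b
  have ix: "ix (axis j 1) = j" for j
    unfolding ix_def by (rule the_equality) (auto simp: axis_eq_axis)
  have eq: "(\<Prod>j\<in>UNIV. F j (x $ j)) = (\<Prod>b\<in>Basis. F (ix b) (x \<bullet> b))" for x :: "real^'n"
    by (simp add: prod_Basis_vec ix inner_axis)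
  show ?thesis unfolding eq by (subst integral_lborel_prod) (auto simp: F prod_Basis_vec ix)
qed

lemma hermite_fun_le: "\<bar>hermite_fun k s\<bar> \<le> 16 * (real k + 1)\<^sup>2"
proof -
  have "16 * (real k + 1)\<^sup>2 * wt 1 s \<le> 16 * (real k + 1)\<^sup>2"
    using wt_le1[of 1 s] by (intro mult_left_le) auto
  then show ?thesis using hermite_fun_wt[of k s] by linarith
qed

text \<open>A bound for $\sup |\Phi_\alpha|$ that grows only polynomially in $\alpha$.\<close>

definition Phi_size :: "('n::finite \<Rightarrow> nat) \<Rightarrow> real" where
  "Phi_size \<alpha> = (\<Prod>j\<in>UNIV. 16 * (real (\<alpha> j) + 1)\<^sup>2)"

lemma Phi_size_ge1: "Phi_size \<alpha> \<ge> 1"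
  unfolding Phi_size_def
proof (rule prod_ge_1)
  fix j
  have "(1::real) \<le> (real (\<alpha> j) + 1)\<^sup>2" by (simp add: power2_eq_square algebra_simps)
  then show "1 \<le> 16 * (real (\<alpha> j) + 1)\<^sup>2" by linarith
qed

lemma hermite_Phi_bound: "\<bar>hermite_Phi \<alpha> x\<bar> \<le> Phi_size \<alpha> * wt 1 x"
proof -
  have "\<bar>hermite_Phi \<alpha> x\<bar> \<le> (\<Prod>j\<in>UNIV. 16 * (real (\<alpha> j) + 1)\<^sup>2 * (1 + (x $ j)\<^sup>2) powr (- 1))"
    unfolding hermite_Phi_def abs_prod
    by (intro prod_mono conjI) (use hermite_fun_wt in \<open>auto simp: wt_real powr_minus\<close>)
  then show ?thesis by (simp only: Phi_size_def wt_vec prod.distrib)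
qed

lemma hermite_Phi_bound': "\<bar>hermite_Phi \<alpha> x\<bar> \<le> Phi_size \<alpha>"
  using hermite_Phi_bound[of \<alpha> x] mult_left_le[OF wt_le1[of 1 x], of "Phi_size \<alpha>"] Phi_size_ge1[of \<alpha>] by linarith

lemma hermite_Phi_continuous: "continuous_on UNIV (hermite_Phi \<alpha>)"
  unfolding hermite_Phi_def[abs_def]
  by (intro continuous_on_prod continuous_on_compose2[OF hermite_fun_continuous] continuous_intros) auto

lemma hermite_Phi_measurable [measurable]: "hermite_Phi \<alpha> \<in> borel_measurable borel"
  by (rule borel_measurable_continuous_onI[OF hermite_Phi_continuous])

lemma gauss_window_eq_prod:
  "gauss_window t = (\<Prod>j\<in>UNIV. complex_of_real (hermite_fun 0 (t $ j)))"
proof -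
  have "exp (- (norm t)\<^sup>2 / 2) = (\<Prod>j\<in>UNIV. exp (- (t $ j)\<^sup>2 / 2))"
    unfolding gauss_prod prod_Basis_vec by (simp add: inner_axis)
  then show ?thesis
    unfolding gauss_window_def hermite_fun_0 by (simp only: of_real_prod[symmetric] prod.distrib prod_constant)
qed

lemma wave_eq_prod:
  "gauss_window (t - x) * iexpn (y \<bullet> t) = (\<Prod>j\<in>UNIV. wave1 (x $ j) (y $ j) (t $ j))"
  by (simp add: gauss_window_eq_prod wave1_def prod.distrib inner_vec_def sum_distrib_left sum_negf
      flip: exp_sum)

definition gabor :: "('n::finite \<Rightarrow> nat) \<Rightarrow> real ^ 'n \<Rightarrow> real ^ 'n \<Rightarrow> complex" where
  "gabor \<alpha> x y = (\<Prod>j\<in>UNIV. gabor1 (\<alpha> j) (x $ j) (y $ j))"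

lemma gabor_hermite_Phi:
  "(\<integral>t. complex_of_real (hermite_Phi \<alpha> t) * (gauss_window (t - x) * iexpn (y \<bullet> t)) \<partial>lborel) = gabor \<alpha> x y"
proof -
  have "complex_of_real (hermite_Phi \<alpha> t) * (gauss_window (t - x) * iexpn (y \<bullet> t))
    = (\<Prod>j\<in>UNIV. complex_of_real (hermite_fun (\<alpha> j) (t $ j)) * wave1 (x $ j) (y $ j) (t $ j))" for t
    by (simp only: wave_eq_prod hermite_Phi_def of_real_prod prod.distrib)
  then show ?thesis
    by (simp only: integral_prod_vec[OF integrable_hermite_wave1] gabor_hermite gabor_def)
qed

text \<open>Sums over multi-indices are treated as integrals against counting measure, so that
  dominated convergence and Fubini's theorem apply to them directly. Absolutely summable products
  then factor into one-dimensional series.\<close>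

lemma integrable_count_prod:
  fixes f :: "'n::finite \<Rightarrow> nat \<Rightarrow> 'c :: {real_normed_field,banach,second_countable_topology}"
  assumes "\<And>j. summable (\<lambda>k. norm (f j k))"
  shows "integrable (count_space UNIV) (\<lambda>\<alpha>. \<Prod>j\<in>UNIV. f j (\<alpha> j))"
    and "(\<integral>\<alpha>. (\<Prod>j\<in>UNIV. f j (\<alpha> j)) \<partial>count_space UNIV) = (\<Prod>j\<in>UNIV. \<Sum>k. f j k)"
proof -
  have s: "Infinite_Set_Sum.abs_summable_on (f j) UNIV" for j
    using assms[of j] by (simp add: Infinite_Set_Sum.abs_summable_on_def integrable_count_space_nat_iff)
  have P: "PiE (UNIV :: 'n set) (\<lambda>_. UNIV :: nat set) = UNIV" by auto
  show "integrable (count_space UNIV) (\<lambda>\<alpha>. \<Prod>j\<in>UNIV. f j (\<alpha> j))"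
    using abs_summable_on_prod_PiE[of "UNIV :: 'n set" "\<lambda>_. UNIV" f] s
    by (simp add: P Infinite_Set_Sum.abs_summable_on_def)
  have "infsetsum (f j) UNIV = (\<Sum>k. f j k)" for j
    using infsetsum_nat'[OF s[of j]] by simp
  then show "(\<integral>\<alpha>. (\<Prod>j\<in>UNIV. f j (\<alpha> j)) \<partial>count_space UNIV) = (\<Prod>j\<in>UNIV. \<Sum>k. f j k)"
    using infsetsum_prod_PiE[of "UNIV :: 'n set" "\<lambda>_. UNIV" f] s
    by (simp add: P infsetsum_def)
qed

lemma gabor_summable: "integrable (count_space UNIV) (\<lambda>\<alpha>. Phi_size \<alpha> * cmod (gabor \<alpha> x y))"
proof -
  have "integrable (count_space UNIV) (\<lambda>\<alpha>. \<Prod>j\<in>UNIV. 16 * (real (\<alpha> j) + 1)\<^sup>2 * cmod (gabor1 (\<alpha> j) (x $ j) (y $ j)))"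
    using summable_gabor1 by (intro integrable_count_prod) simp
  then show ?thesis by (simp add: Phi_size_def gabor_def prod.distrib prod_norm)
qed

section \<open>Rapid decay of the Hermite coefficients of Schwartz functions\<close>

definition hermite_op :: "'n::finite \<Rightarrow> (real ^ 'n \<Rightarrow> complex) \<Rightarrow> real ^ 'n \<Rightarrow> complex" where
  "hermite_op j f = (\<lambda>x. complex_of_real (x $ j) * (complex_of_real (x $ j) * f x) - partial_coord j (partial_coord j f) x)"

lemma schwartz_hermite_op: "f \<in> schwartz \<Longrightarrow> hermite_op j f \<in> schwartz"
  using schwartz_lincomb[OF schwartz_mult_coord[OF schwartz_mult_coord, of f j j] schwartz_partial_coord[OF schwartz_partial_coord, of f j j], where c = "-1"]
  by (simp add: hermite_op_def)

text \<open>Two integrations by parts move the operator onto \<Phi>_\<alpha>, which it multiplies by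
  its eigenvalue. Treating one coordinate at a time, instead of all of H, produces decay in each
  \<alpha>_j separately.\<close>

lemma hermite_coeff_hermite_op:
  fixes f :: "real ^ 'n::finite \<Rightarrow> complex"
  assumes f: "f \<in> schwartz"
  shows "hermite_coeff (hermite_op j f) \<alpha> = of_nat (2 * \<alpha> j + 1) * hermite_coeff f \<alpha>"
proof -
  let ?k = "\<alpha> j"
  \<comment> \<open>The factors of \<Phi>_\<alpha> that are constant along the j-th axis, so that
    the derivatives fall on one Hermite function only.\<close>
  define R where "R x = (\<Prod>i\<in>UNIV - {j}. hermite_fun (\<alpha> i) (x $ i))" for x :: "real ^ 'n"
  have Phi: "hermite_Phi \<alpha> x = hermite_fun ?k (x $ j) * R x" for x
    unfolding hermite_Phi_def R_def by (rule prod.remove) auto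
  have Rline: "R (x + t *\<^sub>R axis j 1) = R x" for x t
    unfolding R_def by (rule prod.cong) (auto simp: axis_def)
  have [measurable]: "R \<in> borel_measurable borel" unfolding R_def[abs_def] by measurable
  define \<Phi> where "\<Phi> x = complex_of_real (hermite_Phi \<alpha> x)" for x
  define \<Phi>' where "\<Phi>' x = complex_of_real (hermite_fun' ?k (x $ j) * R x)" for x
  define \<Phi>'' where "\<Phi>'' x = complex_of_real (((x $ j)\<^sup>2 - (2 * real ?k + 1)) * hermite_Phi \<alpha> x)" for x
  have [measurable]: "\<Phi> \<in> borel_measurable borel" "\<Phi>' \<in> borel_measurable borel" "\<Phi>'' \<in> borel_measurable borel"
    unfolding \<Phi>_def[abs_def] \<Phi>'_def[abs_def] \<Phi>''_def[abs_def] by measurable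
  have line: "((\<lambda>t. complex_of_real (u ((x + t *\<^sub>R axis j 1) $ j) * R (x + t *\<^sub>R axis j 1))) has_vector_derivative complex_of_real (u' * R x)) (at 0)"
    if "(u has_field_derivative u') (at (x $ j))" for u u' and x :: "real ^ 'n"
  proof -
    have "((\<lambda>t. u (x $ j + t)) has_field_derivative u') (at 0)"
      using that DERIV_shift[of u u' 0 "x $ j"] by (simp add: add.commute)
    then have "((\<lambda>t. u (x $ j + t) * R x) has_field_derivative u' * R x) (at 0)"
      by (rule DERIV_cmult_right)
    then have "((\<lambda>t. complex_of_real (u (x $ j + t) * R x)) has_vector_derivative complex_of_real (u' * R x)) (at 0)"
      by (intro has_vector_derivative_of_real) (simp add: has_real_derivative_iff_has_vector_derivative)
    moreover have "(x + t *\<^sub>R axis j 1) $ j = x $ j + t" for t by (simp add: axis_def)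
    ultimately show ?thesis by (simp only: Rline)
  qed
  have d1: "((\<lambda>t. \<Phi> (x + t *\<^sub>R axis j 1)) has_vector_derivative \<Phi>' x) (at 0)" for x
    unfolding \<Phi>_def Phi \<Phi>'_def by (rule line[OF hermite_fun_deriv])
  have d2: "((\<lambda>t. \<Phi>' (x + t *\<^sub>R axis j 1)) has_vector_derivative \<Phi>'' x) (at 0)" for x
    unfolding \<Phi>''_def Phi \<Phi>'_def mult.assoc[symmetric] by (rule line[OF hermite_fun_deriv2])
  define BR where "BR = (\<Prod>i\<in>UNIV - {j}. 16 * (real (\<alpha> i) + 1)\<^sup>2)"
  note hb = hermite_fun_le
  have BR: "\<bar>R x\<bar> \<le> BR" for x
    unfolding R_def BR_def abs_prod by (intro prod_mono conjI hb) auto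
  have BR0: "BR \<ge> 0" unfolding BR_def by (intro prod_nonneg) auto
  have xh: "(1 + s\<^sup>2) * \<bar>hermite_fun k s\<bar> \<le> 16 * (real k + 1)\<^sup>2" for k s by (rule hermite_fun_bound)
  have b1: "cmod (\<Phi>' x) \<le> (16 * (real ?k + 1)\<^sup>2 + sqrt (2 * real ?k + 2) * (16 * (real (Suc ?k) + 1)\<^sup>2)) * BR" for x
  proof -
    define s where "s = x $ j"
    have "\<bar>s\<bar> \<le> 1 + s\<^sup>2" using zero_le_power2[of "\<bar>s\<bar> - 1"] by (simp add: power2_diff)
    then have "\<bar>s\<bar> * \<bar>hermite_fun ?k s\<bar> \<le> 16 * (real ?k + 1)\<^sup>2"
      using mult_right_mono[of "\<bar>s\<bar>" "1 + s\<^sup>2" "\<bar>hermite_fun ?k s\<bar>"] xh[of s ?k] by simp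
    moreover have "sqrt (2 * real ?k + 2) * \<bar>hermite_fun (Suc ?k) s\<bar> \<le> sqrt (2 * real ?k + 2) * (16 * (real (Suc ?k) + 1)\<^sup>2)"
      by (intro mult_left_mono hb) auto
    moreover have "\<bar>hermite_fun' ?k s\<bar> \<le> \<bar>s\<bar> * \<bar>hermite_fun ?k s\<bar> + sqrt (2 * real ?k + 2) * \<bar>hermite_fun (Suc ?k) s\<bar>"
      unfolding hermite_fun'_def by (rule order_trans[OF abs_triangle_ineq4]) (simp add: abs_mult)
    ultimately have "\<bar>hermite_fun' ?k s\<bar> \<le> 16 * (real ?k + 1)\<^sup>2 + sqrt (2 * real ?k + 2) * (16 * (real (Suc ?k) + 1)\<^sup>2)"
      by linarith
    then show ?thesis unfolding \<Phi>'_def norm_of_real abs_mult s_def[symmetric]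
      by (intro mult_mono BR) auto
  qed
  have b0: "cmod (\<Phi> x) \<le> Phi_size \<alpha>" for x by (simp add: \<Phi>_def hermite_Phi_bound')
  have b2: "cmod (\<Phi>'' x) \<le> (2 * real ?k + 1) * (16 * (real ?k + 1)\<^sup>2) * BR" for x
  proof -
    define s where "s = x $ j"
    have "\<bar>s\<^sup>2 - (2 * real ?k + 1)\<bar> \<le> (2 * real ?k + 1) * (1 + s\<^sup>2)"
      using mult_nonneg_nonneg[of "2 * real ?k" "s\<^sup>2"] zero_le_power2[of s] unfolding abs_le_iff by (simp add: algebra_simps)
    then have "\<bar>s\<^sup>2 - (2 * real ?k + 1)\<bar> * \<bar>hermite_fun ?k s\<bar> \<le> (2 * real ?k + 1) * ((1 + s\<^sup>2) * \<bar>hermite_fun ?k s\<bar>)"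
      unfolding mult.assoc[symmetric] by (rule mult_right_mono) simp
    also have "\<dots> \<le> (2 * real ?k + 1) * (16 * (real ?k + 1)\<^sup>2)"
      by (intro mult_left_mono xh) auto
    finally have "\<bar>s\<^sup>2 - (2 * real ?k + 1)\<bar> * \<bar>hermite_fun ?k s\<bar> \<le> (2 * real ?k + 1) * (16 * (real ?k + 1)\<^sup>2)" .
    from mult_mono[OF this BR[of x]] show ?thesis
      by (simp add: \<Phi>''_def Phi abs_mult s_def mult.assoc del: of_real_mult)
  qed
  have pf: "partial_coord j f \<in> schwartz" by (rule schwartz_partial_coord[OF f])
  let ?f'' = "partial_coord j (partial_coord j f)"
  have ff: "?f'' \<in> schwartz" by (rule schwartz_partial_coord[OF pf])
  define B where "B = Max {Phi_size \<alpha>, (16 * (real ?k + 1)\<^sup>2 + sqrt (2 * real ?k + 2) * (16 * (real (Suc ?k) + 1)\<^sup>2)) * BR, (2 * real ?k + 1) * (16 * (real ?k + 1)\<^sup>2) * BR}"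
  have BB: "cmod (\<Phi> x) \<le> B" "cmod (\<Phi>' x) \<le> B" "cmod (\<Phi>'' x) \<le> B" for x
    unfolding B_def by (rule order_trans[OF b0 Max_ge] order_trans[OF b1 Max_ge] order_trans[OF b2 Max_ge]; simp)+
  have "(\<integral>x. ?f'' x * \<Phi> x \<partial>lborel) = - (\<integral>x. partial_coord j f x * \<Phi>' x \<partial>lborel)"
    by (rule schwartz_ibp[OF pf d1 _ _ BB(1,2)]) auto
  also have "(\<integral>x. partial_coord j f x * \<Phi>' x \<partial>lborel) = - (\<integral>x. f x * \<Phi>'' x \<partial>lborel)"
    by (rule schwartz_ibp[OF f d2 _ _ BB(2,3)]) auto
  finally have ibp: "(\<integral>x. ?f'' x * \<Phi> x \<partial>lborel) = (\<integral>x. f x * \<Phi>'' x \<partial>lborel)" by simp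
  have int: "integrable lborel (\<lambda>t. h t * k t)" if "h \<in> schwartz" "k \<in> borel_measurable borel"
    and "\<And>t. cmod (k t) \<le> B" for h k :: "real ^ 'n \<Rightarrow> complex" and B
    using integrable_mult_bounded[OF schwartz_integrable[OF that(1)], of k B] that by simp
  let ?g = "\<lambda>x. complex_of_real (x $ j) * (complex_of_real (x $ j) * f x)"
  have i1: "integrable lborel (\<lambda>x. ?g x * \<Phi> x)" by (rule int[OF schwartz_mult_coord[OF schwartz_mult_coord[OF f]] _ BB(1)]) auto
  have i2: "integrable lborel (\<lambda>x. ?f'' x * \<Phi> x)" by (rule int[OF ff _ BB(1)]) auto
  have i3: "integrable lborel (\<lambda>x. f x * \<Phi>'' x)" by (rule int[OF f _ BB(3)]) auto
  have "hermite_coeff (hermite_op j f) \<alpha> = (\<integral>x. ?g x * \<Phi> x - ?f'' x * \<Phi> x \<partial>lborel)"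
    by (simp add: hermite_coeff_def hermite_op_def \<Phi>_def left_diff_distrib)
  also have "\<dots> = (\<integral>x. ?g x * \<Phi> x - f x * \<Phi>'' x \<partial>lborel)"
    using i1 i2 i3 ibp by simp
  also have "\<dots> = (\<integral>x. of_nat (2 * \<alpha> j + 1) * (f x * \<Phi> x) \<partial>lborel)"
    by (rule Bochner_Integration.integral_cong) (auto simp: \<Phi>_def \<Phi>''_def power2_eq_square algebra_simps)
  also have "\<dots> = of_nat (2 * \<alpha> j + 1) * hermite_coeff f \<alpha>"
    unfolding hermite_coeff_def \<Phi>_def by (rule integral_mult_right_zero)
  finally show ?thesis .
qed

lemma hermite_coeff_bound:
  fixes f :: "real ^ 'n::finite \<Rightarrow> complex"
  assumes f: "f \<in> schwartz"
  shows "cmod (hermite_coeff f \<alpha>) \<le> (\<integral>x. cmod (f x) \<partial>lborel) * Phi_size \<alpha>"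
proof -
  have [measurable]: "f \<in> borel_measurable borel" by (rule schwartz_measurable[OF f])
  have b: "cmod (f x * complex_of_real (hermite_Phi \<alpha> x)) \<le> cmod (f x) * Phi_size \<alpha>" for x
    by (simp add: norm_mult mult_left_mono hermite_Phi_bound')
  have i: "integrable lborel (\<lambda>x. cmod (f x) * Phi_size \<alpha>)"
    using schwartz_integrable[OF f] by simp
  have "cmod (hermite_coeff f \<alpha>) \<le> (\<integral>x. cmod (f x) * Phi_size \<alpha> \<partial>lborel)"
    unfolding hermite_coeff_def
  proof (rule Bochner_Integration.integral_norm_bound_integral[OF _ i b])
    show "integrable lborel (\<lambda>x. f x * complex_of_real (hermite_Phi \<alpha> x))"
      by (rule Bochner_Integration.integrable_bound[OF i]) (use b Phi_size_ge1[of \<alpha>] in \<open>auto simp: abs_mult\<close>)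
  qed
  then show ?thesis by simp
qed

text \<open>Six applications of the operator in each coordinate divide the coefficient by (2
  \<alpha>_j + 1)^6. Four of these powers are spent: two on the factor \<open>Phi_size\<close> in
  the sum, two on the factor \<open>Phi_size\<close> in the a priori bound of the coefficient. The
  remaining (\<alpha>_j + 1)^(-2) is summable.\<close>

lemma hermite_coeff_summable:
  fixes f :: "real ^ 'n::finite \<Rightarrow> complex"
  assumes f: "f \<in> schwartz"
  shows "integrable (count_space UNIV) (\<lambda>\<alpha>. Phi_size \<alpha> * cmod (hermite_coeff f \<alpha>))"
proof -
  have iter: "\<exists>h\<in>schwartz. \<forall>\<alpha>. hermite_coeff h \<alpha> = of_nat (2 * \<alpha> j + 1) ^ N * hermite_coeff f \<alpha>"
    if "f \<in> schwartz" for f :: "real ^ 'n \<Rightarrow> complex" and j N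
  proof (induction N)
    case 0 then show ?case using that by auto
  next
    case (Suc N)
    then obtain h where h: "h \<in> schwartz" "\<And>\<alpha>. hermite_coeff h \<alpha> = of_nat (2 * \<alpha> j + 1) ^ N * hermite_coeff f \<alpha>" by blast
    show ?case
      by (rule bexI[OF _ schwartz_hermite_op[OF h(1), of j]]) (simp add: hermite_coeff_hermite_op[OF h(1)] h(2) mult.assoc del: of_nat_add of_nat_mult)
  qed
  have "\<exists>h\<in>schwartz. \<forall>\<alpha>. hermite_coeff h \<alpha> = (\<Prod>j\<in>J. of_nat (2 * \<alpha> j + 1) ^ 6) * hermite_coeff f \<alpha>" if "finite J" for J :: "'n set"
    using that
  proof (induction J)
    case empty then show ?case using f by auto
  next
    case (insert j J)
    then obtain h where h: "h \<in> schwartz" "\<And>\<alpha>. hermite_coeff h \<alpha> = (\<Prod>j\<in>J. of_nat (2 * \<alpha> j + 1) ^ 6) * hermite_coeff f \<alpha>" by blast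
    from iter[OF h(1), of j 6] obtain h' where "h' \<in> schwartz" "\<And>\<alpha>. hermite_coeff h' \<alpha> = of_nat (2 * \<alpha> j + 1) ^ 6 * hermite_coeff h \<alpha>" by blast
    then show ?case using insert.hyps h(2) by (intro bexI[of _ h']) (simp_all add: mult.assoc del: of_nat_add of_nat_mult)
  qed
  from this[of UNIV] obtain h where h: "h \<in> schwartz" "\<And>\<alpha>. hermite_coeff h \<alpha> = (\<Prod>j\<in>UNIV. of_nat (2 * \<alpha> j + 1) ^ 6) * hermite_coeff f \<alpha>" by auto
  define L where "L = (\<integral>x. cmod (h x) \<partial>lborel)"
  have L: "L \<ge> 0" unfolding L_def by simp
  have main: "Phi_size \<alpha> * cmod (hermite_coeff f \<alpha>) \<le> L * (\<Prod>j\<in>UNIV. 256 * inverse ((real (\<alpha> j) + 1)\<^sup>2))" for \<alpha>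
  proof -
    define Q where "Q = (\<Prod>j\<in>UNIV. (real (2 * \<alpha> j + 1)) ^ 6)"
    have Q: "Q > 0" unfolding Q_def by (intro prod_pos) auto
    have "cmod (hermite_coeff h \<alpha>) = Q * cmod (hermite_coeff f \<alpha>)"
      unfolding h(2) Q_def by (simp add: norm_mult prod_norm[symmetric] norm_power del: of_nat_add of_nat_mult of_nat_Suc)
    then have "Q * cmod (hermite_coeff f \<alpha>) \<le> L * Phi_size \<alpha>"
      using hermite_coeff_bound[OF h(1), of \<alpha>] by (simp add: L_def)
    then have "Phi_size \<alpha> * cmod (hermite_coeff f \<alpha>) \<le> Phi_size \<alpha> * (L * Phi_size \<alpha> / Q)"
      using Q Phi_size_ge1[of \<alpha>] by (intro mult_left_mono) (auto simp: field_simps)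
    also have "\<dots> = L * (\<Prod>j\<in>UNIV. (16 * (real (\<alpha> j) + 1)\<^sup>2) * (16 * (real (\<alpha> j) + 1)\<^sup>2) / (real (2 * \<alpha> j + 1)) ^ 6)"
      unfolding Q_def Phi_size_def prod_dividef prod.distrib by simp
    also have "\<dots> \<le> L * (\<Prod>j\<in>UNIV. 256 * inverse ((real (\<alpha> j) + 1)\<^sup>2))"
    proof (intro mult_left_mono prod_mono conjI L)
      fix j
      define n where "n = real (\<alpha> j) + 1"
      have n: "n > 0" by (simp add: n_def add_nonneg_pos)
      have "n ^ 6 \<le> (real (2 * \<alpha> j + 1)) ^ 6" using n by (intro power_mono) (auto simp: n_def)
      then have "(16 * n\<^sup>2) * (16 * n\<^sup>2) / (real (2 * \<alpha> j + 1)) ^ 6 \<le> (16 * n\<^sup>2) * (16 * n\<^sup>2) / n ^ 6"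
        using n by (intro divide_left_mono) auto
      also have "\<dots> = 256 * inverse (n\<^sup>2)" using n by (simp add: field_simps power_numeral_reduce)
      finally show "(16 * (real (\<alpha> j) + 1)\<^sup>2) * (16 * (real (\<alpha> j) + 1)\<^sup>2) / (real (2 * \<alpha> j + 1)) ^ 6 \<le> 256 * inverse ((real (\<alpha> j) + 1)\<^sup>2)"
        unfolding n_def .
    qed auto
    finally show ?thesis .
  qed
  have s: "summable (\<lambda>k. norm (256 * inverse ((real k + 1)\<^sup>2)))"
  proof -
    have "summable (\<lambda>k. inverse ((real (Suc k))\<^sup>2))"
      using inverse_power_summable[of 2, where 'a = real] by (subst summable_Suc_iff) auto
    then show ?thesis by (simp add: summable_mult add.commute)
  qed
  have "integrable (count_space UNIV) (\<lambda>\<alpha>::'n\<Rightarrow>nat. \<Prod>j\<in>UNIV. 256 * inverse ((real (\<alpha> j) + 1)\<^sup>2))"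
    by (rule integrable_count_prod(1)) (rule s)
  then have "integrable (count_space UNIV) (\<lambda>\<alpha>::'n\<Rightarrow>nat. L * (\<Prod>j\<in>UNIV. 256 * inverse ((real (\<alpha> j) + 1)\<^sup>2)))"
    by (rule integrable_mult_right)
  then show ?thesis
  proof (rule Bochner_Integration.integrable_bound)
    have "0 \<le> Phi_size \<alpha> * cmod (hermite_coeff f \<alpha>)" for \<alpha> using Phi_size_ge1[of \<alpha>] by simp
    then show "AE \<alpha> in count_space UNIV. norm (Phi_size \<alpha> * cmod (hermite_coeff f \<alpha>)) \<le> norm (L * (\<Prod>j\<in>UNIV. 256 * inverse ((real (\<alpha> j) + 1)\<^sup>2)))"
      by (auto simp: AE_count_space intro: order_trans[OF main abs_ge_self])
  qed simp
qed

lemma finite_multi_abs: "finite {\<alpha> :: 'n::finite \<Rightarrow> nat. multi_abs \<alpha> \<le> k}"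
proof (rule finite_subset)
  show "{\<alpha> :: 'n \<Rightarrow> nat. multi_abs \<alpha> \<le> k} \<subseteq> PiE UNIV (\<lambda>_. {..k})"
  proof
    fix \<alpha> :: "'n \<Rightarrow> nat" assume a: "\<alpha> \<in> {\<alpha>. multi_abs \<alpha> \<le> k}"
    have "\<alpha> j \<le> multi_abs \<alpha>" for j unfolding multi_abs_def by (rule member_le_sum) auto
    then show "\<alpha> \<in> PiE UNIV (\<lambda>_. {..k})" using a by (auto intro: order_trans)
  qed
qed (auto intro: finite_PiE)

text \<open>Links the series by degree in the definition of \<open>hermite_mult\<close> to the
  integral over all multi-indices, by dominated convergence along the truncations |\<alpha>| <
  K.\<close>

lemma suminf_by_degree:
  fixes F :: "('n::finite \<Rightarrow> nat) \<Rightarrow> complex"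
  assumes F: "integrable (count_space UNIV) F"
  shows "(\<Sum>k. \<Sum>\<alpha>\<in>{\<alpha>. multi_abs \<alpha> = k}. F \<alpha>) = (\<integral>\<alpha>. F \<alpha> \<partial>count_space UNIV)"
proof -
  have "(\<lambda>K. \<integral>\<alpha>. (if multi_abs \<alpha> < K then F \<alpha> else 0) \<partial>count_space UNIV) \<longlonglongrightarrow> (\<integral>\<alpha>. F \<alpha> \<partial>count_space UNIV)"
  proof (rule integral_dominated_convergence[where w = "\<lambda>\<alpha>. cmod (F \<alpha>)"])
    show "AE \<alpha> in count_space UNIV. (\<lambda>K. if multi_abs \<alpha> < K then F \<alpha> else 0) \<longlonglongrightarrow> F \<alpha>"
    proof (rule AE_I2)
      fix \<alpha> :: "'n \<Rightarrow> nat"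
      have "\<forall>\<^sub>F K in sequentially. (if multi_abs \<alpha> < K then F \<alpha> else 0) = F \<alpha>"
        using eventually_gt_at_top[of "multi_abs \<alpha>"] by eventually_elim simp
      then show "(\<lambda>K. if multi_abs \<alpha> < K then F \<alpha> else 0) \<longlonglongrightarrow> F \<alpha>" by (rule tendsto_eventually)
    qed
  qed (use F in auto)
  moreover have "(\<integral>\<alpha>. (if multi_abs \<alpha> < K then F \<alpha> else 0) \<partial>count_space UNIV) = (\<Sum>k<K. \<Sum>\<alpha>\<in>{\<alpha>. multi_abs \<alpha> = k}. F \<alpha>)" for K
  proof -
    have fin: "finite {\<alpha> :: 'n \<Rightarrow> nat. multi_abs \<alpha> < K}"
      by (rule finite_subset[OF _ finite_multi_abs[of K]]) auto
    have fin': "finite {\<alpha> :: 'n \<Rightarrow> nat. multi_abs \<alpha> = k}" for k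
      by (rule finite_subset[OF _ finite_multi_abs[of k]]) auto
    have "(\<integral>\<alpha>. (if multi_abs \<alpha> < K then F \<alpha> else 0) \<partial>count_space UNIV) = (\<Sum>\<alpha>\<in>{\<alpha>. multi_abs \<alpha> < K}. F \<alpha>)"
      by (subst lebesgue_integral_count_space_finite_support)
         (auto intro!: sum.mono_neutral_cong_left finite_subset[OF _ fin] fin split: if_splits)
    also have "{\<alpha> :: 'n \<Rightarrow> nat. multi_abs \<alpha> < K} = (\<Union>k<K. {\<alpha>. multi_abs \<alpha> = k})" by auto
    also have "(\<Sum>\<alpha>\<in>(\<Union>k<K. {\<alpha>. multi_abs \<alpha> = k}). F \<alpha>) = (\<Sum>k<K. \<Sum>\<alpha>\<in>{\<alpha>. multi_abs \<alpha> = k}. F \<alpha>)"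
      by (rule sum.UNION_disjoint) (auto simp: fin')
    finally show ?thesis .
  qed
  ultimately have "(\<lambda>k. \<Sum>\<alpha>\<in>{\<alpha>. multi_abs \<alpha> = k}. F \<alpha>) sums (\<integral>\<alpha>. F \<alpha> \<partial>count_space UNIV)"
    by (simp add: sums_def)
  then show ?thesis by (rule sums_unique[symmetric])
qed

section \<open>Multiplier sums against coherent states\<close>

lemma admissible_cutoff_continuous: "admissible_cutoff \<psi> \<Longrightarrow> continuous_on UNIV \<psi>"
proof -
  assume "admissible_cutoff \<psi>"
  then have "\<psi> differentiable (at x)" for x
    unfolding admissible_cutoff_def by (metis funpow_0)
  then show ?thesis by (simp add: continuous_at_imp_continuous_on differentiable_imp_continuous_within)
qed

text \<open>The definition leaves the value at the endpoint 1/2 open; it is a limit of zeros from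
  the left. Including this endpoint lets the integrals below be cut exactly at 1/2.\<close>

lemma admissible_cutoff_zero:
  assumes "admissible_cutoff \<psi>" "x \<le> 1/2 \<or> x > 1"
  shows "\<psi> x = 0"
proof (cases "x = 1/2")
  case True
  have "((\<lambda>k. \<psi> (1/2 - 1 / real (Suc k))) \<longlongrightarrow> \<psi> (1/2)) sequentially"
  proof (rule continuous_on_tendsto_compose[OF admissible_cutoff_continuous[OF assms(1)]])
    have "((\<lambda>k. 1/2 - 1 / real (Suc k)) \<longlongrightarrow> 1/2 - 0) sequentially"
      by (intro tendsto_intros) (use LIMSEQ_inverse_real_of_nat in \<open>simp add: inverse_eq_divide\<close>)
    then show "((\<lambda>k. 1/2 - 1 / real (Suc k)) \<longlongrightarrow> 1/2) sequentially" by simp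
  qed auto
  moreover have "\<psi> (1/2 - 1 / real (Suc k)) = 0" for k
    using assms(1) unfolding admissible_cutoff_def by force
  ultimately have "\<psi> (1/2) = 0" by (simp add: LIMSEQ_const_iff)
  then show ?thesis unfolding True .
next
  case False
  then show ?thesis using assms unfolding admissible_cutoff_def by force
qed

lemma integrable_compact_support:
  fixes f :: "real \<Rightarrow> complex"
  assumes cont: "continuous_on UNIV f" and z: "\<And>x. x \<notin> {a..b} \<Longrightarrow> f x = 0"
  shows "integrable lborel f" "\<exists>B. \<forall>x. cmod (f x) \<le> B"
proof -
  have c: "continuous_on {a..b} f" using cont continuous_on_subset by blast
  have "integrable lborel (\<lambda>x. indicator {a..b} x *\<^sub>R f x)"
    using borel_integrable_atLeastAtMost'[OF c] by (simp add: set_integrable_def)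
  moreover have "(\<lambda>x. indicator {a..b} x *\<^sub>R f x) = f"
    using z by (auto simp: indicator_def)
  ultimately show "integrable lborel f" by simp
  have "bounded (f ` {a..b})" by (intro compact_imp_bounded compact_continuous_image c) auto
  then obtain B where "\<forall>x\<in>{a..b}. cmod (f x) \<le> B" by (auto simp: bounded_iff)
  then have "cmod (f x) \<le> max B 0" for x using z[of x] by (cases "x \<in> {a..b}") (auto simp: le_max_iff_disj)
  then show "\<exists>B. \<forall>x. cmod (f x) \<le> B" by blast
qed

text \<open>The cutoff may change sign, so its integral against $ds/s$ can vanish; a suitable
  modulation $e^{i\kappa s}$ repairs this and only translates Fourier transforms.\<close>

lemma cutoff_partition:
  assumes \<psi>: "admissible_cutoff \<psi>"
  obtains \<kappa> :: real and c :: complex where "c \<noteq> 0"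
    "\<And>\<mu>. 1 \<le> \<mu> \<Longrightarrow> \<mu> \<le> 8 \<Longrightarrow>
      (\<integral>\<tau>. indicator {1..16} \<tau> *\<^sub>R (complex_of_real (\<psi> (\<mu> / \<tau>) / \<tau>) * iexp (\<kappa> * (\<mu> / \<tau>))) \<partial>lborel) = c"
proof -
  note cont = admissible_cutoff_continuous[OF \<psi>]
  define w where "w s = complex_of_real (\<psi> s / s)" for s
  have w0: "w s = 0" if "s \<le> 1/2 \<or> s > 1" for s
    using admissible_cutoff_zero[OF \<psi> that] by (simp add: w_def)
  have wcont: "continuous_on UNIV w"
  proof -
    have "continuous_on {0<..} w" unfolding w_def by (intro continuous_intros continuous_on_subset[OF cont]) auto
    moreover have "continuous_on {..<1/2} w"
      by (rule continuous_on_cong[THEN iffD2, OF refl _ continuous_on_const[of _ 0]]) (auto simp: w0)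
    ultimately have "continuous_on ({0<..} \<union> {..<1/2}) w" by (intro continuous_on_open_Un) auto
    moreover have "{0<..} \<union> {..<1/2::real} = UNIV" by (auto simp: not_less intro: less_le_trans)
    ultimately show ?thesis by simp
  qed
  have wz: "s \<notin> {1/2..1} \<Longrightarrow> w s = 0" for s using w0 by force
  obtain Bw where Bw: "\<And>x. cmod (w x) \<le> Bw" using integrable_compact_support(2)[OF wcont wz] by blast
  have wint: "integrable lborel w" by (rule integrable_compact_support(1)[OF wcont wz])
  \<comment> \<open>If the transform of \<psi>(s)/s vanished identically, inversion would give
    \<psi> = 0. With \<kappa> = -\<xi> the integral of \<psi>(s) exp (i \<kappa> s) ds/s equals this
    nonzero value.\<close>
  have "\<exists>\<xi>. fint w \<xi> \<noteq> 0"
  proof (rule ccontr)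
    assume "\<nexists>\<xi>. fint w \<xi> \<noteq> 0"
    then have z: "fint w = (\<lambda>_. 0)" by auto
    have "w x = 0" for x
      by (subst fourier_inversion[OF wcont Bw wint]) (simp_all add: z)
    then have "\<psi> x = 0" for x
      using admissible_cutoff_zero[OF \<psi>, of x] by (cases "x = 0") (auto simp: w_def)
    then show False using \<psi> by (simp add: admissible_cutoff_def)
  qed
  then obtain \<xi> where \<xi>: "fint w \<xi> \<noteq> 0" by blast
  define \<kappa> where "\<kappa> = - \<xi>"
  define G where "G s = w s * iexp (\<kappa> * s)" for s
  define c where "c = fint w \<xi>"
  have Gcont: "continuous_on UNIV G" unfolding G_def by (intro continuous_intros wcont)
  have G0: "G s = 0" if "s \<le> 1/2 \<or> s > 1" for s using w0[OF that] by (simp add: G_def)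
  have Gz: "s \<notin> {1/2..1} \<Longrightarrow> G s = 0" for s using G0 by force
  have Gint: "integrable lborel G" by (rule integrable_compact_support(1)[OF Gcont Gz])
  have cG: "c = integral UNIV G"
    using integral_lborel[OF Gint]
    by (simp add: c_def fint_def G_def[abs_def] \<kappa>_def)
  define P where "P x = integral {0..x} G" for x
  have Pder: "(P has_vector_derivative G x) (at x)" if "0 < x" "x < 10" for x
  proof -
    have "continuous_on {0..10} G" using Gcont continuous_on_subset by blast
    then have "(P has_vector_derivative G x) (at x within {0..10})"
      unfolding P_def using that by (intro integral_has_vector_derivative) auto
    then show ?thesis using that by (simp add: at_within_Icc_at)
  qed
  have "(\<integral>\<tau>. indicator {1..16} \<tau> *\<^sub>R (complex_of_real (\<psi> (\<mu> / \<tau>) / \<tau>) * iexp (\<kappa> * (\<mu> / \<tau>))) \<partial>lborel) = c"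
    if \<mu>: "1 \<le> \<mu>" "\<mu> \<le> 8" for \<mu>
  proof -
    \<comment> \<open>The substitution s = \<mu>/\<tau>, carried out with an antiderivative. As
      \<tau> runs over [1, 16], s runs over [\<mu>/16, \<mu>], and this contains the support
      [1/2, 1] exactly because 1 \<le> \<mu> \<le> 8.\<close>
    have "(\<integral>\<tau>. indicator {1..16} \<tau> *\<^sub>R (complex_of_real (\<mu> / \<tau>\<^sup>2) * G (\<mu> / \<tau>)) \<partial>lborel) = - P (\<mu> / 16) - - P (\<mu> / 1)"
    proof (rule integral_FTC_atLeastAtMost[where F = "\<lambda>\<tau>. - P (\<mu> / \<tau>)"])
      fix \<tau> :: real assume \<tau>: "1 \<le> \<tau>" "\<tau> \<le> 16"
      have r: "0 < \<mu> / \<tau>" "\<mu> / \<tau> < 10" using \<mu> \<tau> by (auto simp: field_simps)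
      have "((\<lambda>\<tau>. \<mu> / \<tau>) has_real_derivative - (\<mu> / \<tau>\<^sup>2)) (at \<tau>)"
        using \<tau> by (auto intro!: derivative_eq_intros simp: power2_eq_square)
      then have "((\<lambda>\<tau>. \<mu> / \<tau>) has_vector_derivative - (\<mu> / \<tau>\<^sup>2)) (at \<tau>)"
        by (simp add: has_real_derivative_iff_has_vector_derivative)
      from vector_diff_chain_at[OF this Pder[OF r]]
      have "((\<lambda>\<tau>. P (\<mu> / \<tau>)) has_vector_derivative - (\<mu> / \<tau>\<^sup>2) *\<^sub>R G (\<mu> / \<tau>)) (at \<tau>)" by (simp add: o_def)
      from has_vector_derivative_minus[OF this]
      have "((\<lambda>\<tau>. - P (\<mu> / \<tau>)) has_vector_derivative complex_of_real (\<mu> / \<tau>\<^sup>2) * G (\<mu> / \<tau>)) (at \<tau>)"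
        by (simp only: scaleR_minus_left minus_minus scaleR_conv_of_real of_real_minus mult_minus_left)
      then show "((\<lambda>\<tau>. - P (\<mu> / \<tau>)) has_vector_derivative complex_of_real (\<mu> / \<tau>\<^sup>2) * G (\<mu> / \<tau>)) (at \<tau> within {1..16})"
        by (rule has_vector_derivative_at_within)
    next
      show "continuous_on {1..16} (\<lambda>\<tau>. complex_of_real (\<mu> / \<tau>\<^sup>2) * G (\<mu> / \<tau>))"
        by (intro continuous_intros continuous_on_compose2[OF Gcont]) auto
    qed simp
    also have "P (\<mu> / 16) = 0"
    proof -
      have "P (\<mu> / 16) = integral {0..\<mu> / 16} (\<lambda>_. 0)"
        unfolding P_def by (rule integral_cong) (use \<mu> in \<open>auto intro!: G0\<close>)
      then show ?thesis by simp
    qed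
    also have "P (\<mu> / 1) = c"
    proof -
      have "(\<lambda>x. if x \<in> {0..\<mu>} then G x else 0) = G" using \<mu> by (auto intro!: ext G0)
      then show ?thesis using integral_restrict_UNIV[of "{0..\<mu>}" G] by (simp add: P_def cG)
    qed
    finally have "(\<integral>\<tau>. indicator {1..16} \<tau> *\<^sub>R (complex_of_real (\<mu> / \<tau>\<^sup>2) * G (\<mu> / \<tau>)) \<partial>lborel) = c" by simp
    moreover have "indicator {1..16} \<tau> *\<^sub>R (complex_of_real (\<mu> / \<tau>\<^sup>2) * G (\<mu> / \<tau>)) = indicator {1..16} \<tau> *\<^sub>R (complex_of_real (\<psi> (\<mu> / \<tau>) / \<tau>) * iexp (\<kappa> * (\<mu> / \<tau>)))" for \<tau>
      using \<mu> by (auto simp: indicator_def G_def w_def power2_eq_square)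
    ultimately show ?thesis by (simp only:)
  qed
  then show thesis using that[of c \<kappa>] \<xi> by (simp add: c_def)
qed

section \<open>From the localized Sobolev norm to weighted Fourier bounds\<close>

lemma powr_exp_bound:
  fixes c \<gamma> :: real
  assumes "c > 0" "\<gamma> > 0"
  obtains K where "K > 0" "\<And>D. D \<ge> 0 \<Longrightarrow> exp (- c * D) \<le> K * (1 + D) powr (- \<gamma>)"
proof
  \<comment> \<open>The maximum of (1 + D)^\<gamma> exp (-c D) over 1 + D > 0, attained at 1 + D =
    \<gamma>/c. The bound itself is ln X \<le> X - 1 at X = (1 + D) c/\<gamma>.\<close>
  let ?K = "exp (c - \<gamma> - \<gamma> * ln (c / \<gamma>))"
  fix D :: real assume D: "D \<ge> 0"
  have "ln ((1 + D) * (c / \<gamma>)) \<le> (1 + D) * (c / \<gamma>) - 1"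
    using assms D by (intro ln_le_minus_one) auto
  moreover have "ln ((1 + D) * (c / \<gamma>)) = ln (1 + D) + ln (c / \<gamma>)"
    using assms D by (intro ln_mult_pos) auto
  ultimately have "\<gamma> * (ln (1 + D) + ln (c / \<gamma>)) \<le> \<gamma> * ((1 + D) * (c / \<gamma>) - 1)"
    using assms D by (intro mult_left_mono) auto
  also have "\<dots> = (1 + D) * c - \<gamma>" using assms by (simp add: field_simps)
  finally have "- c * D \<le> (c - \<gamma> - \<gamma> * ln (c / \<gamma>)) + - \<gamma> * ln (1 + D)" by (simp add: algebra_simps)
  then have "exp (- c * D) \<le> ?K * exp (- \<gamma> * ln (1 + D))" by (simp only: exp_le_cancel_iff exp_add[symmetric])
  then show "exp (- c * D) \<le> ?K * (1 + D) powr (- \<gamma>)" using D by (simp add: powr_def)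
qed simp

text \<open>The weighted transform is split as a b, where a carries (1 + \<xi>^2)^(\<beta>/2) and is
  controlled by the Sobolev norm, while b^2 is at most a constant times (1 + \<xi>^2)^(-(\<beta> -
  \<gamma>)), integrable because \<gamma> < \<beta> - 1/2. The inequality a b \<le> a^2 + b^2 takes
  the place of Cauchy-Schwarz. The bound W does not depend on the scale t, since the norm is a
  supremum over all scales.\<close>

lemma sloc_fourier_weight:
  fixes m :: "real \<Rightarrow> complex"
  assumes \<psi>: "admissible_cutoff \<psi>" and m_cont: "continuous_on {0<..} m"
    and sloc: "sloc_norm \<psi> \<beta> m < \<infinity>" and \<gamma>: "0 < \<gamma>" "\<gamma> < \<beta> - 1/2"
  defines "u \<equiv> \<lambda>t s. complex_of_real (\<psi> s) * m (t * s)"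
  obtains W where "\<And>t s. t > 0 \<Longrightarrow> u t s = complex_of_real (1 / (2 * pi)) * (\<integral>\<xi>. fint (u t) \<xi> * iexp (\<xi> * s) \<partial>lborel)"
    "\<And>t. t > 0 \<Longrightarrow> integrable lborel (\<lambda>\<xi>. cmod (fint (u t) \<xi>) * (1 + \<bar>\<xi>\<bar>) powr \<gamma>)"
    "\<And>t. t > 0 \<Longrightarrow> (\<integral>\<xi>. cmod (fint (u t) \<xi>) * (1 + \<bar>\<xi>\<bar>) powr \<gamma> \<partial>lborel) \<le> W"
proof -
  note cont = admissible_cutoff_continuous[OF \<psi>]
  have u0: "s \<notin> {1/2..1} \<Longrightarrow> u t s = 0" for t s
    using admissible_cutoff_zero[OF \<psi>, of s] by (force simp: u_def)
  \<comment> \<open>On the positive half-line this is the continuity of m and \<psi>; on {..<1/2}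
    the function vanishes. These two open sets cover the real line.\<close>
  have ucont: "continuous_on UNIV (u t)" if t: "t > 0" for t
  proof -
    have "continuous_on {0<..} (u t)"
      unfolding u_def using t by (intro continuous_intros continuous_on_subset[OF cont] continuous_on_compose2[OF m_cont]) auto
    moreover have "continuous_on {..<1/2} (u t)"
      by (rule continuous_on_cong[THEN iffD2, OF refl _ continuous_on_const[of _ 0]]) (auto intro!: u0)
    ultimately have "continuous_on ({0<..} \<union> {..<1/2}) (u t)" by (intro continuous_on_open_Un) auto
    moreover have "{0<..} \<union> {..<1/2::real} = UNIV" by (auto simp: not_less intro: less_le_trans)
    ultimately show ?thesis by simp
  qed
  have uint: "integrable lborel (u t)" if "t > 0" for t
    by (rule integrable_compact_support(1)[OF ucont[OF that] u0])
  obtain S where S: "S \<ge> 0" "sloc_norm \<psi> \<beta> m = ennreal S" using sloc by (cases "sloc_norm \<psi> \<beta> m") auto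
  have sob: "(\<integral>\<^sup>+\<xi>. ennreal ((1 + \<xi>\<^sup>2) powr \<beta> * (cmod (fourier1 (u t) \<xi>))\<^sup>2) \<partial>lborel) \<le> ennreal (S\<^sup>2)" if t: "t > 0" for t
  proof -
    let ?I = "\<integral>\<^sup>+\<xi>. ennreal ((1 + \<xi>\<^sup>2) powr \<beta> * (cmod (fourier1 (u t) \<xi>))\<^sup>2) \<partial>lborel"
    have "sobolev_norm \<beta> (u t) \<le> sloc_norm \<psi> \<beta> m"
      unfolding sloc_norm_def u_def using t by (intro SUP_upper) auto
    then have le: "enn_powr ?I (1/2) \<le> ennreal S" by (simp add: sobolev_norm_def S)
    show ?thesis
    proof (cases ?I)
      case (real r)
      then have "r powr (1/2) \<le> S" using le S by (simp add: enn_powr_def)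
      then have "sqrt r \<le> S" using real by (simp add: powr_half_sqrt)
      then have "r \<le> S\<^sup>2" using real real_sqrt_le_iff[of r "S\<^sup>2"] S by (simp add: sqrt_le_D)
      then show ?thesis using real by (simp add: ennreal_leI)
    next
      case top
      then show ?thesis using le by (simp add: enn_powr_def top_unique)
    qed
  qed
  have f1: "fourier1 (u t) \<xi> = complex_of_real ((2 * pi) powr (-1/2)) * fint (u t) \<xi>" for t \<xi>
    by (simp add: fourier1_def fint_def mult.commute)
  define k where "k = (2 * pi) powr (-1/2)"
  have k: "k > 0" by (simp add: k_def)
  define W where "W = (S\<^sup>2 + 2 powr \<gamma> * (\<integral>\<xi>. (1 + \<xi>\<^sup>2) powr (- (\<beta> - \<gamma>)) \<partial>lborel)) / k"
  have iw: "integrable lborel (\<lambda>\<xi>. 2 powr \<gamma> * (1 + \<xi>\<^sup>2) powr (- (\<beta> - \<gamma>)))"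
    using integrable_wt1[of "\<beta> - \<gamma>"] \<gamma> by simp
  have main: "integrable lborel (\<lambda>\<xi>. cmod (fint (u t) \<xi>) * (1 + \<bar>\<xi>\<bar>) powr \<gamma>) \<and>
      (\<integral>\<xi>. cmod (fint (u t) \<xi>) * (1 + \<bar>\<xi>\<bar>) powr \<gamma> \<partial>lborel) \<le> W" if t: "t > 0" for t
  proof -
    have [measurable]: "u t \<in> borel_measurable borel" using ucont[OF t] by (rule borel_measurable_continuous_onI)
    let ?E = "\<lambda>\<xi>. (1 + \<xi>\<^sup>2) powr \<beta> * (k * cmod (fint (u t) \<xi>))\<^sup>2"
    have E: "(1 + \<xi>\<^sup>2) powr \<beta> * (cmod (fourier1 (u t) \<xi>))\<^sup>2 = ?E \<xi>" for \<xi>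
      using k by (simp add: f1 norm_mult k_def)
    have Eint: "integrable lborel ?E"
      using sob[OF t] unfolding E by (intro integrableI_bounded) (auto simp: less_top[symmetric] top_unique)
    have EI: "(\<integral>\<xi>. ?E \<xi> \<partial>lborel) \<le> S\<^sup>2"
      using sob[OF t] unfolding E by (subst (asm) nn_integral_eq_integral[OF Eint]) (auto simp: integral_nonneg)
    have bd: "cmod (fint (u t) \<xi>) * (1 + \<bar>\<xi>\<bar>) powr \<gamma> \<le> (?E \<xi> + 2 powr \<gamma> * (1 + \<xi>\<^sup>2) powr (- (\<beta> - \<gamma>))) / k" for \<xi>
    proof -
      define p where "p = 1 + \<xi>\<^sup>2"
      have p: "p > 0" by (simp add: p_def add_pos_nonneg)
      define F where "F = k * cmod (fint (u t) \<xi>)"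
      define a where "a = p powr (\<beta> / 2) * F"
      define b where "b = p powr (- \<beta> / 2) * (1 + \<bar>\<xi>\<bar>) powr \<gamma>"
      have ab: "a * b = F * (1 + \<bar>\<xi>\<bar>) powr \<gamma>"
        using p by (simp add: a_def b_def powr_minus field_simps)
      have a2: "a\<^sup>2 = p powr \<beta> * F\<^sup>2"
        by (simp add: a_def power_mult_distrib power2_eq_square powr_add[symmetric])
      have "(1 + \<bar>\<xi>\<bar>)\<^sup>2 \<le> 2 * p" using zero_le_power2[of "\<bar>\<xi>\<bar> - 1"] by (simp add: p_def power2_diff power2_sum)
      then have "((1 + \<bar>\<xi>\<bar>)\<^sup>2) powr \<gamma> \<le> (2 * p) powr \<gamma>" using \<gamma> by (intro powr_mono2) auto
      also have "((1 + \<bar>\<xi>\<bar>)\<^sup>2) powr \<gamma> = ((1 + \<bar>\<xi>\<bar>) powr \<gamma>)\<^sup>2"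
        by (simp add: power2_eq_square powr_mult)
      finally have "((1 + \<bar>\<xi>\<bar>) powr \<gamma>)\<^sup>2 \<le> 2 powr \<gamma> * p powr \<gamma>" using p by (simp add: powr_mult)
      then have "p powr (- \<beta>) * ((1 + \<bar>\<xi>\<bar>) powr \<gamma>)\<^sup>2 \<le> p powr (- \<beta>) * (2 powr \<gamma> * p powr \<gamma>)"
        by (intro mult_left_mono) auto
      moreover have "b\<^sup>2 = p powr (- \<beta>) * ((1 + \<bar>\<xi>\<bar>) powr \<gamma>)\<^sup>2"
      proof -
        have "(p powr (- \<beta> / 2))\<^sup>2 = p powr (- \<beta>)" by (simp add: power2_eq_square powr_add[symmetric])
        then show ?thesis by (simp only: b_def power_mult_distrib)
      qed
      moreover have "p powr (- \<beta>) * (2 powr \<gamma> * p powr \<gamma>) = 2 powr \<gamma> * p powr (- (\<beta> - \<gamma>))"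
        using p by (simp add: powr_add[symmetric])
      ultimately have b2: "b\<^sup>2 \<le> 2 powr \<gamma> * p powr (- (\<beta> - \<gamma>))" by simp
      have "a * b \<le> a\<^sup>2 + b\<^sup>2" using sum_squares_bound[of a b] zero_le_power2[of a] zero_le_power2[of b]
        by linarith
      then have "F * (1 + \<bar>\<xi>\<bar>) powr \<gamma> \<le> p powr \<beta> * F\<^sup>2 + 2 powr \<gamma> * p powr (- (\<beta> - \<gamma>))"
        using b2 by (simp add: ab a2)
      then show ?thesis using k by (simp add: F_def p_def field_simps)
    qed
    have rhs: "integrable lborel (\<lambda>\<xi>. (?E \<xi> + 2 powr \<gamma> * (1 + \<xi>\<^sup>2) powr (- (\<beta> - \<gamma>))) / k)"
      using Eint iw by simp
    have bdn: "norm (cmod (fint (u t) \<xi>) * (1 + \<bar>\<xi>\<bar>) powr \<gamma>) \<le> norm ((?E \<xi> + 2 powr \<gamma> * (1 + \<xi>\<^sup>2) powr (- (\<beta> - \<gamma>))) / k)" for \<xi>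
    proof -
      have "0 \<le> cmod (fint (u t) \<xi>) * (1 + \<bar>\<xi>\<bar>) powr \<gamma>" by simp
      then show ?thesis using order_trans[OF bd[of \<xi>] abs_ge_self] unfolding real_norm_def by (simp only: abs_of_nonneg)
    qed
    have i: "integrable lborel (\<lambda>\<xi>. cmod (fint (u t) \<xi>) * (1 + \<bar>\<xi>\<bar>) powr \<gamma>)"
      by (rule Bochner_Integration.integrable_bound[OF rhs]) (use bdn in auto)
    have "(\<integral>\<xi>. cmod (fint (u t) \<xi>) * (1 + \<bar>\<xi>\<bar>) powr \<gamma> \<partial>lborel) \<le> (\<integral>\<xi>. (?E \<xi> + 2 powr \<gamma> * (1 + \<xi>\<^sup>2) powr (- (\<beta> - \<gamma>))) / k \<partial>lborel)"
      by (rule integral_mono[OF i rhs bd])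
    also have "\<dots> \<le> W"
      using Eint iw EI k unfolding W_def by (simp add: divide_right_mono)
    finally show ?thesis using i by blast
  qed
  have inv: "u t s = complex_of_real (1 / (2 * pi)) * (\<integral>\<xi>. fint (u t) \<xi> * iexp (\<xi> * s) \<partial>lborel)" if t: "t > 0" for t s
  proof -
    have [measurable]: "u t \<in> borel_measurable borel" using ucont[OF t] by (rule borel_measurable_continuous_onI)
    obtain B where B: "\<And>x. cmod (u t x) \<le> B" using integrable_compact_support(2)[OF ucont[OF t] u0] by blast
    have "integrable lborel (fint (u t))"
    proof (rule Bochner_Integration.integrable_bound[OF conjunct1[OF main[OF t]]])
      have "cmod (fint (u t) \<xi>) * 1 \<le> cmod (fint (u t) \<xi>) * (1 + \<bar>\<xi>\<bar>) powr \<gamma>" for \<xi>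
        using \<gamma> by (intro mult_left_mono ge_one_powr_ge_zero) auto
      then show "AE \<xi> in lborel. norm (fint (u t) \<xi>) \<le> norm (cmod (fint (u t) \<xi>) * (1 + \<bar>\<xi>\<bar>) powr \<gamma>)" by simp
    qed measurable
    from fourier_inversion[OF ucont[OF t] B uint[OF t] this, of s] show ?thesis by simp
  qed
  show thesis using that[of W] inv main by blast
qed

lemma Fubini_count:
  fixes f :: "'i::countable \<Rightarrow> 'a::euclidean_space \<Rightarrow> complex"
  assumes [measurable]: "\<And>i. f i \<in> borel_measurable borel"
    and a: "integrable (count_space UNIV) a" and w: "integrable lborel w"
    and bd: "\<And>i x. cmod (f i x) \<le> a i * w x" and nn: "\<And>i. 0 \<le> a i" "\<And>x. 0 \<le> w x"
  shows "(\<integral>i. (\<integral>x. f i x \<partial>lborel) \<partial>count_space UNIV) = (\<integral>x. (\<integral>i. f i x \<partial>count_space UNIV) \<partial>lborel)"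
proof -
  interpret C: sigma_finite_measure "count_space (UNIV :: 'i set)"
    by (rule sigma_finite_measure_count_space_countable) auto
  interpret pair_sigma_finite "count_space (UNIV :: 'i set)" "lborel :: 'a measure" ..
  have [measurable]: "w \<in> borel_measurable borel" using w by (auto dest: borel_measurable_integrable)
  have m: "(\<lambda>(i, x). f i x) \<in> borel_measurable (count_space UNIV \<Otimes>\<^sub>M lborel)"
    by (rule measurable_pair_measure_countable1) auto
  have m2: "(\<lambda>(i, x). a i * w x) \<in> borel_measurable (count_space UNIV \<Otimes>\<^sub>M lborel)"
    by (rule measurable_pair_measure_countable1) auto
  have "integrable (count_space UNIV \<Otimes>\<^sub>M lborel) (\<lambda>(i, x). a i * w x)"
  proof (rule Fubini_integrable)
    show "integrable (count_space UNIV) (\<lambda>i. LINT x|lborel. norm (case (i, x) of (i, x) \<Rightarrow> a i * w x))"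
      using a nn by (simp add: abs_mult)
  qed (use w m2 in auto)
  then have "integrable (count_space UNIV \<Otimes>\<^sub>M lborel) (\<lambda>(i, x). f i x)"
    by (rule Bochner_Integration.integrable_bound) (use m bd nn in \<open>auto intro!: order_trans[OF bd abs_ge_self]\<close>)
  from Fubini_integral[OF this] show ?thesis by simp
qed

text \<open>A non-integrable f has Bochner integral 0 by convention, so an integrable majorant
  settles both cases and the uses below carry no integrability obligation for f.\<close>

lemma norm_integral_le:
  fixes f :: "'a \<Rightarrow> 'b::{banach,second_countable_topology}"
  assumes g: "integrable M g" and bd: "\<And>x. norm (f x) \<le> g x"
  shows "norm (\<integral>x. f x \<partial>M) \<le> (\<integral>x. g x \<partial>M)"
proof (cases "integrable M f")
  case True
  have "norm (\<integral>x. f x \<partial>M) \<le> (\<integral>x. norm (f x) \<partial>M)" by (rule integral_norm_bound)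
  also have "\<dots> \<le> (\<integral>x. g x \<partial>M)" by (rule integral_mono[OF integrable_norm[OF True] g bd])
  finally show ?thesis .
next
  case False
  moreover have "0 \<le> (\<integral>x. g x \<partial>M)" using order_trans[OF norm_ge_zero bd] by (intro Bochner_Integration.integral_nonneg) auto
  ultimately show ?thesis by (simp add: not_integrable_integral_eq)
qed

text \<open>Here $a$ stands for the Hermite expansion of a matrix entry: its weights behave like a Poisson
  distribution of mean at most $A$, and $D$ is a quarter of the squared phase-space distance. The sum is
  split by a cutoff that equals $1$ for $A \le 2N + d \le 8A$; outside, the moments with $s = 1/2$ and
  $s = 2$ give exponential smallness in $A \ge D/2$.\<close>

lemma multiplier_sum_bound:
  fixes m :: "real \<Rightarrow> complex" and d :: nat
  assumes \<psi>: "admissible_cutoff \<psi>" and m_cont: "continuous_on {0<..} m"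
    and sloc: "sloc_norm \<psi> \<beta> m < \<infinity>" and \<gamma>: "0 < \<gamma>" "\<gamma> < \<beta> - 1/2"
    and M: "\<And>x. x > 0 \<Longrightarrow> cmod (m x) \<le> M" and d: "d \<ge> 1"
  obtains C where "C \<ge> 0"
    "\<And>(a :: 'i::countable \<Rightarrow> complex) N A D. 0 \<le> D \<Longrightarrow> D \<le> 2 * A \<Longrightarrow>
      (\<And>s. s \<in> {1/2, 1, 2} \<Longrightarrow> integrable (count_space UNIV) (\<lambda>i. cmod (a i) * s ^ N i)) \<Longrightarrow>
      (\<And>s. s \<in> {1/2, 1, 2} \<Longrightarrow> (\<integral>i. cmod (a i) * s ^ N i \<partial>count_space UNIV) \<le> exp ((s - 1) * A)) \<Longrightarrow>
      (\<And>\<phi>. cmod (\<integral>i. a i * iexp (\<phi> * real (N i)) \<partial>count_space UNIV) \<le> exp (\<phi>\<^sup>2 * A - D / 2)) \<Longrightarrow>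
      cmod (\<integral>i. m (real (2 * N i + d)) * a i \<partial>count_space UNIV) \<le> C * (1 + D) powr (- \<gamma>)"
proof -
  note cont = admissible_cutoff_continuous[OF \<psi>]
  have [measurable]: "\<psi> \<in> borel_measurable borel" using cont by (rule borel_measurable_continuous_onI)
  define u where "u t s = complex_of_real (\<psi> s) * m (t * s)" for t s
  obtain W where W: "\<And>t s. t > 0 \<Longrightarrow> u t s = complex_of_real (1 / (2 * pi)) * (\<integral>\<xi>. fint (u t) \<xi> * iexp (\<xi> * s) \<partial>lborel)"
    "\<And>t. t > 0 \<Longrightarrow> integrable lborel (\<lambda>\<xi>. cmod (fint (u t) \<xi>) * (1 + \<bar>\<xi>\<bar>) powr \<gamma>)"
    "\<And>t. t > 0 \<Longrightarrow> (\<integral>\<xi>. cmod (fint (u t) \<xi>) * (1 + \<bar>\<xi>\<bar>) powr \<gamma> \<partial>lborel) \<le> W"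
    using sloc_fourier_weight[OF \<psi> m_cont sloc \<gamma>] unfolding u_def by blast
  obtain \<kappa> :: real and c :: complex where c: "c \<noteq> 0" and
    \<kappa>: "\<And>\<mu>. 1 \<le> \<mu> \<Longrightarrow> \<mu> \<le> 8 \<Longrightarrow>
      (\<integral>\<tau>. indicator {1..16::real} \<tau> *\<^sub>R (complex_of_real (\<psi> (\<mu> / \<tau>) / \<tau>) * iexp (\<kappa> * (\<mu> / \<tau>))) \<partial>lborel) = c"
    using cutoff_partition[OF \<psi>] by blast
  obtain K1 where K1: "K1 > 0" "\<And>D. D \<ge> 0 \<Longrightarrow> exp (- (1/4) * D) \<le> K1 * (1 + D) powr (- \<gamma>)"
    using powr_exp_bound[of "1/4" \<gamma>] \<gamma> by auto
  obtain K2 where K2: "K2 > 0" "\<And>D. D \<ge> 0 \<Longrightarrow> exp (- (1/16) * D) \<le> K2 * (1 + D) powr (- \<gamma>)"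
    using powr_exp_bound[of "1/16" \<gamma>] \<gamma> by auto
  have M0: "M \<ge> 0" using order_trans[OF norm_ge_zero M[of 1]] by simp
  have W0: "W \<ge> 0" using order_trans[OF _ W(3)[of 1]] by simp
  have "\<exists>B. \<forall>x. cmod (complex_of_real (\<psi> x)) \<le> B"
  proof (rule integrable_compact_support(2))
    show "continuous_on UNIV (\<lambda>x. complex_of_real (\<psi> x))" by (intro continuous_intros cont)
    show "x \<notin> {1/2..1} \<Longrightarrow> complex_of_real (\<psi> x) = 0" for x using admissible_cutoff_zero[OF \<psi>, of x] by force
  qed
  then obtain B where B: "\<And>x. \<bar>\<psi> x\<bar> \<le> B" by auto
  have B0: "B \<ge> 0" using order_trans[OF abs_ge_zero B] .
  define J where "J \<mu> \<tau> = complex_of_real (\<psi> (\<mu> / \<tau>) / \<tau>) * iexp (\<kappa> * (\<mu> / \<tau>))" for \<mu> \<tau>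
  \<comment> \<open>An average of copies of the cutoff at the scales A \<tau>, \<tau> in [1, 16],
    when \<mu> = l/A. By the choice of \<kappa> and c it equals 1 on [1, 8]; elsewhere only its
    boundedness matters.\<close>
  define \<theta> where "\<theta> \<mu> = (\<integral>\<tau>. indicator {1..16::real} \<tau> *\<^sub>R J \<mu> \<tau> \<partial>lborel) / c" for \<mu>
  have [measurable]: "J \<mu> \<in> borel_measurable borel" for \<mu> unfolding J_def[abs_def] by measurable
  have iind: "integrable lborel (\<lambda>\<tau>::real. K * indicator {1..16::real} \<tau>)" for K :: real
    by (intro integrable_mult_right integrable_real_indicator) auto
  have vind: "(\<integral>\<tau>. K * indicator {1..16::real} \<tau> \<partial>lborel) = 15 * K" for K :: real by simp
  have Jb: "cmod (indicator {1..16::real} \<tau> *\<^sub>R J \<mu> \<tau>) \<le> B * indicator {1..16::real} \<tau>" for \<mu> \<tau>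
  proof (cases "\<tau> \<in> {1..16}")
    case True
    then have "\<bar>\<psi> (\<mu> / \<tau>)\<bar> / \<tau> \<le> B / 1" using B B0 by (intro frac_le) auto
    then show ?thesis using True by (simp add: J_def norm_mult norm_divide)
  qed simp
  define \<Theta> where "\<Theta> = 15 * B / cmod c"
  have \<Theta>: "cmod (\<theta> \<mu>) \<le> \<Theta>" for \<mu>
  proof -
    have "cmod (\<integral>\<tau>. indicator {1..16::real} \<tau> *\<^sub>R J \<mu> \<tau> \<partial>lborel) \<le> (\<integral>\<tau>. B * indicator {1..16::real} \<tau> \<partial>lborel)"
      by (rule norm_integral_le[OF iind Jb])
    then show ?thesis unfolding vind using c by (simp add: \<theta>_def \<Theta>_def norm_divide divide_right_mono)
  qed
  have \<Theta>0: "\<Theta> \<ge> 0" using order_trans[OF norm_ge_zero \<Theta>] .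
  have \<theta>1: "\<theta> \<mu> = 1" if "1 \<le> \<mu>" "\<mu> \<le> 8" for \<mu>
    using \<kappa>[OF that] c by (simp add: \<theta>_def J_def)
  define C4 where "C4 = K1 + (7 + 6 * \<bar>\<kappa>\<bar>) powr \<gamma>"
  have C40: "C4 \<ge> 0" using K1 by (simp add: C4_def)
  define C where "C = M * (1 + 2 * real d) powr \<gamma> + 2 * M * (1 + \<Theta>) * K2 + 15 * (C4 * W) / cmod c"
  have parts: "0 \<le> M * (1 + 2 * real d) powr \<gamma>" "0 \<le> 2 * M * (1 + \<Theta>) * K2" "0 \<le> 15 * (C4 * W) / cmod c"
    using M0 \<Theta>0 K2 C40 W0 by auto
  have main: "cmod (\<integral>i. m (real (2 * N i + d)) * a i \<partial>count_space UNIV) \<le> C * (1 + D) powr (- \<gamma>)"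
    if D: "0 \<le> D" "D \<le> 2 * A"
      and a: "\<And>s. s \<in> {1/2, 1, 2} \<Longrightarrow> integrable (count_space UNIV) (\<lambda>i. cmod (a i) * s ^ N i)"
      and aI: "\<And>s. s \<in> {1/2, 1, 2} \<Longrightarrow> (\<integral>i. cmod (a i) * s ^ N i \<partial>count_space UNIV) \<le> exp ((s - 1) * A)"
      and osc: "\<And>\<phi>. cmod (\<integral>i. a i * iexp (\<phi> * real (N i)) \<partial>count_space UNIV) \<le> exp (\<phi>\<^sup>2 * A - D / 2)"
    for a :: "'i \<Rightarrow> complex" and N A D
  proof -
    have a1: "integrable (count_space UNIV) (\<lambda>i. cmod (a i))" using a[of 1] by simp
    have aI1: "(\<integral>i. cmod (a i) \<partial>count_space UNIV) \<le> 1" using aI[of 1] by simp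
    have ab: "integrable (count_space UNIV) (\<lambda>i. h i * a i)" if "\<And>i. cmod (h i) \<le> L" for h and L :: real
    proof (rule Bochner_Integration.integrable_bound)
      show "integrable (count_space UNIV) (\<lambda>i. L * cmod (a i))" using a1 by simp
      show "AE i in count_space UNIV. norm (h i * a i) \<le> norm (L * cmod (a i))"
        using that order_trans[OF norm_ge_zero that] by (auto simp: norm_mult abs_mult intro!: mult_right_mono)
    qed simp
    have abI: "cmod (\<integral>i. h i * a i \<partial>count_space UNIV) \<le> L" if h: "\<And>i. cmod (h i) \<le> L" for h and L :: real
    proof -
      have L: "L \<ge> 0" using order_trans[OF norm_ge_zero h] .
      have "cmod (\<integral>i. h i * a i \<partial>count_space UNIV) \<le> (\<integral>i. L * cmod (a i) \<partial>count_space UNIV)"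
        by (rule norm_integral_le)
           (use a1 h in \<open>auto simp: norm_mult intro: mult_right_mono\<close>)
      also have "\<dots> \<le> L" using mult_left_le[OF aI1 L] by simp
      finally show ?thesis .
    qed
    define l where "l i = real (2 * N i + d)" for i
    have l0: "l i > 0" for i using d by (simp add: l_def)
    have hM: "cmod (m (l i)) \<le> M" for i by (rule M[OF l0])
    define P where "P = (1 + D) powr (- \<gamma>)"
    have P0: "P > 0" using D by (simp add: P_def)
    show ?thesis
    proof (cases "A < real d")
      \<comment> \<open>Here D \<le> 2 A < 2 d is bounded, so the trivial bound M suffices. In the
        other case A \<ge> d, and the shift by d in 2N + d is absorbed into A.\<close>
      case True
      have "1 + D \<le> 1 + 2 * real d" using True D by simp
      then have "(1 + 2 * real d) powr (- \<gamma>) \<le> P"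
        using D \<gamma> unfolding P_def by (intro powr_mono2') auto
      then have "(1 + 2 * real d) powr \<gamma> * (1 + 2 * real d) powr (- \<gamma>) \<le> (1 + 2 * real d) powr \<gamma> * P"
        by (intro mult_left_mono) auto
      moreover have "(1 + 2 * real d) powr \<gamma> * (1 + 2 * real d) powr (- \<gamma>) = 1"
        by (simp add: powr_add[symmetric] del: powr_minus)
      ultimately have "1 \<le> (1 + 2 * real d) powr \<gamma> * P" by simp
      then have "M \<le> (M * (1 + 2 * real d) powr \<gamma>) * P" using mult_left_mono[OF _ M0, of 1] by (simp add: mult.assoc)
      also have "\<dots> \<le> C * P" unfolding C_def using parts P0 by (intro mult_right_mono) auto
      finally show ?thesis using abI[of "\<lambda>i. m (l i)" M, OF hM] by (simp add: l_def P_def)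
    next
      case False
      then have A: "A \<ge> real d" "A \<ge> 1" using d by auto
      have A0: "A > 0" using A by simp
      \<comment> \<open>A single scale t, which is A \<tau> with \<tau> \<ge> 1 in the application.
        Fourier inversion writes the localized multiplier as a superposition of exponentials, so
        that the oscillating sums assumed small in terms of D appear under an integral over
        \<xi>.\<close>
      have near1: "cmod (\<integral>i. (u t (l i / t) * iexp (\<kappa> * (l i / t))) * a i \<partial>count_space UNIV) \<le> C4 * W * P"
        if t: "t \<ge> A" for t
      proof -
        have t0: "t > 0" using t A0 by simp
        have [measurable]: "fint (u t) \<in> borel_measurable borel"
          using W(2)[OF t0]
        proof -
          have "continuous_on {0<..} (u t)"
            unfolding u_def using t0 by (intro continuous_intros continuous_on_subset[OF cont] continuous_on_compose2[OF m_cont]) auto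
          then have "(\<lambda>s. indicator {0<..} s *\<^sub>R u t s) \<in> borel_measurable borel"
            by (intro borel_measurable_continuous_on_indicator) auto
          moreover have "(\<lambda>s. indicator {0<..} s *\<^sub>R u t s) = u t"
            using admissible_cutoff_zero[OF \<psi>] by (auto simp: indicator_def u_def fun_eq_iff)
          ultimately have "u t \<in> borel_measurable borel" by simp
          then show ?thesis by (rule fint_measurable)
        qed
        define wt' where "wt' \<xi> = cmod (fint (u t) \<xi>) * (1 + \<bar>\<xi>\<bar>) powr \<gamma>" for \<xi>
        have fw: "cmod (fint (u t) \<xi>) \<le> wt' \<xi>" for \<xi>
          unfolding wt'_def using \<gamma> mult_left_mono[of 1 "(1 + \<bar>\<xi>\<bar>) powr \<gamma>" "cmod (fint (u t) \<xi>)"]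
          by (simp add: ge_one_powr_ge_zero)
        let ?f = "\<lambda>i \<xi>. fint (u t) \<xi> * (iexp ((\<xi> + \<kappa>) * (l i / t)) * a i)"
        have "(\<integral>i. (u t (l i / t) * iexp (\<kappa> * (l i / t))) * a i \<partial>count_space UNIV)
          = (\<integral>i. complex_of_real (1 / (2 * pi)) * (\<integral>\<xi>. ?f i \<xi> \<partial>lborel) \<partial>count_space UNIV)"
        proof (rule Bochner_Integration.integral_cong[OF refl])
          fix i
          have "(u t (l i / t) * iexp (\<kappa> * (l i / t))) * a i
            = complex_of_real (1 / (2 * pi)) * ((\<integral>\<xi>. fint (u t) \<xi> * iexp (\<xi> * (l i / t)) \<partial>lborel) * (iexp (\<kappa> * (l i / t)) * a i))"
            by (subst W(1)[OF t0]) (simp only: mult.assoc)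
          also have "(\<integral>\<xi>. fint (u t) \<xi> * iexp (\<xi> * (l i / t)) \<partial>lborel) * (iexp (\<kappa> * (l i / t)) * a i)
            = (\<integral>\<xi>. (fint (u t) \<xi> * iexp (\<xi> * (l i / t))) * (iexp (\<kappa> * (l i / t)) * a i) \<partial>lborel)"
            by (rule integral_mult_left_zero[symmetric])
          also have "\<dots> = (\<integral>\<xi>. ?f i \<xi> \<partial>lborel)"
          proof (rule Bochner_Integration.integral_cong[OF refl])
            fix \<xi>
            have "iexp ((\<xi> + \<kappa>) * (l i / t)) = iexp (\<xi> * (l i / t)) * iexp (\<kappa> * (l i / t))"
              unfolding mult_exp_exp by (simp add: distrib_right distrib_left add_divide_distrib)
            then show "(fint (u t) \<xi> * iexp (\<xi> * (l i / t))) * (iexp (\<kappa> * (l i / t)) * a i) = ?f i \<xi>"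
              by (simp only: mult.assoc)
          qed
          finally show "(u t (l i / t) * iexp (\<kappa> * (l i / t))) * a i = complex_of_real (1 / (2 * pi)) * (\<integral>\<xi>. ?f i \<xi> \<partial>lborel)" .
        qed
        also have "\<dots> = complex_of_real (1 / (2 * pi)) * (\<integral>i. (\<integral>\<xi>. ?f i \<xi> \<partial>lborel) \<partial>count_space UNIV)"
          by (rule integral_mult_right_zero)
        also have "(\<integral>i. (\<integral>\<xi>. ?f i \<xi> \<partial>lborel) \<partial>count_space UNIV) = (\<integral>\<xi>. (\<integral>i. ?f i \<xi> \<partial>count_space UNIV) \<partial>lborel)"
        proof (rule Fubini_count[where a = "\<lambda>i. cmod (a i)" and w = wt'])
          show "integrable lborel wt'" unfolding wt'_def by (rule W(2)[OF t0])
          show "cmod (?f i \<xi>) \<le> cmod (a i) * wt' \<xi>" for i \<xi>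
            using mult_right_mono[OF fw[of \<xi>], of "cmod (a i)"] by (simp add: norm_mult mult_ac)
        qed (use a1 in \<open>auto simp: wt'_def\<close>)
        finally have eq: "(\<integral>i. (u t (l i / t) * iexp (\<kappa> * (l i / t))) * a i \<partial>count_space UNIV)
          = complex_of_real (1 / (2 * pi)) * (\<integral>\<xi>. (\<integral>i. ?f i \<xi> \<partial>count_space UNIV) \<partial>lborel)" .
        have bd: "cmod (\<integral>i. ?f i \<xi> \<partial>count_space UNIV) \<le> (C4 * P) * wt' \<xi>" for \<xi>
        proof -
          \<comment> \<open>The factor 2 comes from l = 2N + d; the summand d contributes only a
            unimodular constant.\<close>
          define \<phi> where "\<phi> = 2 * (\<xi> + \<kappa>) / t"
          define b where "b = cmod (\<integral>i. a i * iexp (\<phi> * real (N i)) \<partial>count_space UNIV)"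
          have ex: "iexp ((\<xi> + \<kappa>) * (l i / t)) = iexp ((\<xi> + \<kappa>) * (real d / t)) * iexp (\<phi> * real (N i))" for i
          proof -
            have "(\<xi> + \<kappa>) * (l i / t) = (\<xi> + \<kappa>) * (real d / t) + \<phi> * real (N i)"
              using t0 by (simp add: l_def \<phi>_def field_simps)
            then show ?thesis unfolding mult_exp_exp by (simp only: of_real_add distrib_left)
          qed
          have "(\<integral>i. ?f i \<xi> \<partial>count_space UNIV) = (\<integral>i. (fint (u t) \<xi> * iexp ((\<xi> + \<kappa>) * (real d / t))) * (a i * iexp (\<phi> * real (N i))) \<partial>count_space UNIV)"
            unfolding ex by (simp only: mult_ac)
          also have "\<dots> = (fint (u t) \<xi> * iexp ((\<xi> + \<kappa>) * (real d / t))) * (\<integral>i. a i * iexp (\<phi> * real (N i)) \<partial>count_space UNIV)"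
            by (rule integral_mult_right_zero)
          finally have "cmod (\<integral>i. ?f i \<xi> \<partial>count_space UNIV) = cmod (fint (u t) \<xi>) * b"
            by (simp only: norm_mult norm_exp_i_times b_def mult_1_right)
          moreover have "b \<le> C4 * P * (1 + \<bar>\<xi>\<bar>) powr \<gamma>"
          \<comment> \<open>If the rotation is small, half of the exponent D/2 survives. Otherwise D
            A < 16 (\<xi> + \<kappa>)^2, and D \<le> 2 A turns this into D^2 \<le> 32 (\<xi> +
            \<kappa>)^2, whence the factor 6: then the weight (1 + |\<xi>|)^\<gamma> itself pays for
            (1 + D)^\<gamma>.\<close>
          proof (cases "\<phi>\<^sup>2 * A \<le> D / 4")
            case True
            have "b \<le> exp (\<phi>\<^sup>2 * A - D / 2)" unfolding b_def by (rule osc)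
            also have "\<dots> \<le> exp (- (1/4) * D)" using True by simp
            also have "\<dots> \<le> K1 * P" unfolding P_def by (rule K1(2)[OF D(1)])
            also have "\<dots> \<le> C4 * P * 1" using P0 by (simp add: C4_def)
            also have "\<dots> \<le> C4 * P * (1 + \<bar>\<xi>\<bar>) powr \<gamma>"
              using C40 P0 \<gamma> by (intro mult_left_mono ge_one_powr_ge_zero) auto
            finally show ?thesis .
          next
            case False
            have "b \<le> 1"
              using abI[of "\<lambda>i. iexp (\<phi> * real (N i))" 1] by (simp add: b_def mult.commute)
            have "\<phi>\<^sup>2 * A = 4 * (\<xi> + \<kappa>)\<^sup>2 * A / t\<^sup>2" unfolding \<phi>_def power_divide power_mult_distrib by simp
            also have "\<dots> \<le> 4 * (\<xi> + \<kappa>)\<^sup>2 * A / A\<^sup>2"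
              using t A0 t0 by (intro divide_left_mono power_mono) auto
            also have "\<dots> = 4 * (\<xi> + \<kappa>)\<^sup>2 / A" using A0 by (simp add: power2_eq_square)
            finally have "D / 4 < 4 * (\<xi> + \<kappa>)\<^sup>2 / A" using False by linarith
            then have "D * A < 16 * (\<xi> + \<kappa>)\<^sup>2" using A0 by (simp add: field_simps)
            moreover have "D * (D / 2) \<le> D * A" using D by (intro mult_left_mono) auto
            ultimately have "D\<^sup>2 \<le> 32 * (\<xi> + \<kappa>)\<^sup>2" by (simp add: power2_eq_square)
            also have "\<dots> \<le> (6 * \<bar>\<xi> + \<kappa>\<bar>)\<^sup>2" by (simp add: power_mult_distrib)
            finally have "D \<le> 6 * \<bar>\<xi> + \<kappa>\<bar>" by (rule power2_le_imp_le) simp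
            then have "1 + D \<le> (7 + 6 * \<bar>\<kappa>\<bar>) + (7 + 6 * \<bar>\<kappa>\<bar>) * \<bar>\<xi>\<bar>"
              using mult_nonneg_nonneg[OF abs_ge_zero[of \<kappa>] abs_ge_zero[of \<xi>]] abs_ge_zero[of \<xi>] abs_triangle_ineq[of \<xi> \<kappa>] unfolding distrib_right mult.assoc by linarith
            then have "1 + D \<le> (7 + 6 * \<bar>\<kappa>\<bar>) * (1 + \<bar>\<xi>\<bar>)" by (simp add: distrib_left)
            then have "(1 + D) powr \<gamma> \<le> ((7 + 6 * \<bar>\<kappa>\<bar>) * (1 + \<bar>\<xi>\<bar>)) powr \<gamma>"
              using D \<gamma> by (intro powr_mono2) auto
            then have le: "(1 + D) powr \<gamma> \<le> (7 + 6 * \<bar>\<kappa>\<bar>) powr \<gamma> * (1 + \<bar>\<xi>\<bar>) powr \<gamma>"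
              by (simp add: powr_mult)
            have "1 = P * (1 + D) powr \<gamma>" using D by (simp add: P_def powr_add[symmetric] del: powr_minus)
            also have "\<dots> \<le> P * ((7 + 6 * \<bar>\<kappa>\<bar>) powr \<gamma> * (1 + \<bar>\<xi>\<bar>) powr \<gamma>)"
              using le P0 by (intro mult_left_mono) auto
            also have "\<dots> = ((7 + 6 * \<bar>\<kappa>\<bar>) powr \<gamma> * P) * (1 + \<bar>\<xi>\<bar>) powr \<gamma>" by (simp only: mult_ac)
            also have "\<dots> \<le> (C4 * P) * (1 + \<bar>\<xi>\<bar>) powr \<gamma>"
              using K1 P0 by (intro mult_right_mono) (auto simp: C4_def)
            finally show ?thesis using \<open>b \<le> 1\<close> by linarith
          qed
          ultimately have "cmod (\<integral>i. ?f i \<xi> \<partial>count_space UNIV) \<le> cmod (fint (u t) \<xi>) * (C4 * P * (1 + \<bar>\<xi>\<bar>) powr \<gamma>)"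
            by (simp only: mult_left_mono norm_ge_zero)
          then show ?thesis unfolding wt'_def by (simp only: mult_ac)
        qed
        have iw: "integrable lborel (\<lambda>\<xi>. (C4 * P) * wt' \<xi>)" using W(2)[OF t0] by (simp add: wt'_def)
        have "cmod (\<integral>\<xi>. (\<integral>i. ?f i \<xi> \<partial>count_space UNIV) \<partial>lborel) \<le> (\<integral>\<xi>. (C4 * P) * wt' \<xi> \<partial>lborel)"
          by (rule norm_integral_le[OF iw bd])
        also have "\<dots> \<le> (C4 * P) * W"
          using W(3)[OF t0] C40 P0 by (simp add: wt'_def mult_left_mono)
        finally have F: "cmod (\<integral>\<xi>. (\<integral>i. ?f i \<xi> \<partial>count_space UNIV) \<partial>lborel) \<le> C4 * W * P" by (simp add: mult_ac)
        have "1 / (2 * pi) \<le> 1" using pi_gt3 by simp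
        then have "(1 / (2 * pi)) * cmod (\<integral>\<xi>. (\<integral>i. ?f i \<xi> \<partial>count_space UNIV) \<partial>lborel) \<le> 1 * (C4 * W * P)"
          using F by (intro mult_mono) auto
        moreover have "cmod (complex_of_real (1 / (2 * pi)) * z) = (1 / (2 * pi)) * cmod z" for z
          by (simp add: norm_mult norm_divide)
        ultimately show ?thesis unfolding eq by (simp only: mult_1)
      qed
      have J: "m (l i) * J (l i / A) \<tau> = (u (A * \<tau>) (l i / (A * \<tau>)) * iexp (\<kappa> * (l i / (A * \<tau>)))) / complex_of_real \<tau>" if "\<tau> \<ge> 1" for i \<tau>
        using that A0 by (simp add: J_def u_def)
      have near: "cmod (\<integral>i. (m (l i) * \<theta> (l i / A)) * a i \<partial>count_space UNIV) \<le> 15 * (C4 * W) / cmod c * P"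
      proof -
        let ?g = "\<lambda>i \<tau>. indicator {1..16::real} \<tau> *\<^sub>R J (l i / A) \<tau> * (m (l i) * a i)"
        have "(\<integral>i. (m (l i) * \<theta> (l i / A)) * a i \<partial>count_space UNIV) = (\<integral>i. (\<integral>\<tau>. ?g i \<tau> \<partial>lborel) / c \<partial>count_space UNIV)"
          unfolding integral_mult_left_zero by (simp add: \<theta>_def mult_ac)
        also have "\<dots> = (\<integral>i. (\<integral>\<tau>. ?g i \<tau> \<partial>lborel) \<partial>count_space UNIV) / c" by (rule integral_divide_zero)
        also have "(\<integral>i. (\<integral>\<tau>. ?g i \<tau> \<partial>lborel) \<partial>count_space UNIV) = (\<integral>\<tau>. (\<integral>i. ?g i \<tau> \<partial>count_space UNIV) \<partial>lborel)"
        proof (rule Fubini_count[where a = "\<lambda>i. M * cmod (a i)" and w = "\<lambda>\<tau>. B * indicator {1..16::real} \<tau>"])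
          show "cmod (?g i \<tau>) \<le> M * cmod (a i) * (B * indicator {1..16::real} \<tau>)" for i \<tau>
          proof -
            have "cmod (?g i \<tau>) = cmod (indicator {1..16::real} \<tau> *\<^sub>R J (l i / A) \<tau>) * (cmod (m (l i)) * cmod (a i))"
              by (simp only: norm_mult)
            also have "\<dots> \<le> (B * indicator {1..16::real} \<tau>) * (M * cmod (a i))"
              using B0 M0 by (intro mult_mono Jb hM) auto
            finally show ?thesis by (simp only: mult_ac)
          qed
          show "0 \<le> M * cmod (a i)" for i using M0 by simp
          show "integrable (count_space UNIV) (\<lambda>i. M * cmod (a i))" using a1 by simp
          show "integrable lborel (\<lambda>\<tau>. B * indicator {1..16::real} \<tau>)" by (rule iind)
        qed (use B0 in auto)
        finally have eq: "(\<integral>i. (m (l i) * \<theta> (l i / A)) * a i \<partial>count_space UNIV) = (\<integral>\<tau>. (\<integral>i. ?g i \<tau> \<partial>count_space UNIV) \<partial>lborel) / c" .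
        have bd: "cmod (\<integral>i. ?g i \<tau> \<partial>count_space UNIV) \<le> (C4 * W * P) * indicator {1..16::real} \<tau>" for \<tau>
        proof (cases "\<tau> \<in> {1..16}")
          case True
          then have \<tau>: "\<tau> \<ge> 1" by simp
          have "?g i \<tau> = ((u (A * \<tau>) (l i / (A * \<tau>)) * iexp (\<kappa> * (l i / (A * \<tau>)))) * a i) / complex_of_real \<tau>" for i
          proof -
            have "?g i \<tau> = (m (l i) * J (l i / A) \<tau>) * a i" using True by (simp add: mult_ac)
            then show ?thesis unfolding J[OF \<tau>] by simp
          qed
          then have "cmod (\<integral>i. ?g i \<tau> \<partial>count_space UNIV) = cmod (\<integral>i. (u (A * \<tau>) (l i / (A * \<tau>)) * iexp (\<kappa> * (l i / (A * \<tau>)))) * a i \<partial>count_space UNIV) / \<tau>"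
            using \<tau> by (simp only: integral_divide_zero norm_divide norm_of_real abs_of_nonneg)
          also have "\<dots> \<le> (C4 * W * P) / 1"
            using near1[of "A * \<tau>"] \<tau> A0 C40 W0 P0 by (intro frac_le) auto
          finally show ?thesis using True by simp
        next
          case False
          then show ?thesis by simp
        qed
        have "cmod (\<integral>\<tau>. (\<integral>i. ?g i \<tau> \<partial>count_space UNIV) \<partial>lborel) \<le> (\<integral>\<tau>. (C4 * W * P) * indicator {1..16::real} \<tau> \<partial>lborel)"
          by (rule norm_integral_le[OF iind bd])
        then have "cmod (\<integral>\<tau>. (\<integral>i. ?g i \<tau> \<partial>count_space UNIV) \<partial>lborel) \<le> 15 * (C4 * W * P)" unfolding vind .
        then show ?thesis unfolding eq norm_divide using c by (simp add: divide_right_mono field_simps)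
      qed
      have far: "cmod (\<integral>i. (m (l i) * (1 - \<theta> (l i / A))) * a i \<partial>count_space UNIV) \<le> 2 * M * (1 + \<Theta>) * K2 * P"
      proof -
        define L where "L = M * (1 + \<Theta>)"
        have L0: "L \<ge> 0" using M0 \<Theta>0 by (simp add: L_def)
        \<comment> \<open>A Chernoff majorant. If l < A then N \<le> A/2 and 2^(A/2) (1/2)^N \<ge>
          1; if l > 8 A then d \<le> A gives N \<ge> 7A/2 and 2^(-7A/2) 2^N \<ge> 1. In between, 1 -
          \<theta> vanishes.\<close>
        let ?r = "\<lambda>i. L * (2 powr (A / 2) * (cmod (a i) * (1/2) ^ N i) + 2 powr (- (7/2) * A) * (cmod (a i) * 2 ^ N i))"
        have rint: "integrable (count_space UNIV) ?r"
          using a[of "1/2"] a[of 2] by (intro integrable_mult_right Bochner_Integration.integrable_add) auto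
        have hb: "cmod (m (l i) * (1 - \<theta> (l i / A))) \<le> L" for i
          unfolding norm_mult L_def using M0 order_trans[OF norm_triangle_ineq4[of 1 "\<theta> (l i / A)"]] \<Theta>[of "l i / A"]
          by (intro mult_mono hM) auto
        have bd: "cmod ((m (l i) * (1 - \<theta> (l i / A))) * a i) \<le> ?r i" for i
        proof -
          have n1: "0 \<le> 2 powr (A / 2) * (cmod (a i) * (1/2) ^ N i)" and n2: "0 \<le> 2 powr (- (7/2) * A) * (cmod (a i) * 2 ^ N i)" by auto
          have gen: ?thesis if "cmod (a i) \<le> 2 powr (A / 2) * (cmod (a i) * (1/2) ^ N i) + 2 powr (- (7/2) * A) * (cmod (a i) * 2 ^ N i)"
            using mult_mono[OF hb[of i] that L0 norm_ge_zero] by (simp only: norm_mult)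
          consider "1 \<le> l i / A \<and> l i / A \<le> 8" | "l i < A" | "l i > 8 * A"
            using A0 by (fastforce simp: field_simps)
          then show ?thesis
          proof cases
            case 1
            then have "\<theta> (l i / A) = 1" using \<theta>1 by blast
            moreover have "0 \<le> ?r i" by (intro mult_nonneg_nonneg L0 add_nonneg_nonneg n1 n2)
            ultimately show ?thesis by simp
          next
            case 2
            then have "real (N i) \<le> A / 2" by (simp add: l_def)
            then have "2 powr (real (N i)) \<le> 2 powr (A / 2)" by (intro powr_mono) auto
            then have "1 \<le> 2 powr (A / 2) * (1/2) ^ N i"
              by (simp add: powr_realpow power_divide field_simps)
            from mult_left_mono[OF this norm_ge_zero[of "a i"]]
            have "cmod (a i) \<le> 2 powr (A / 2) * (cmod (a i) * (1/2) ^ N i)" by (simp add: mult_ac)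
            then show ?thesis using n2 by (intro gen) linarith
          next
            case 3
            then have "7/2 * A \<le> real (N i)" using A by (simp add: l_def)
            then have "2 powr (7/2 * A) \<le> 2 powr (real (N i))" by (intro powr_mono) auto
            then have "2 powr (- (7/2) * A) * 2 powr (7/2 * A) \<le> 2 powr (- (7/2) * A) * 2 powr (real (N i))"
              by (intro mult_left_mono) auto
            then have "1 \<le> 2 powr (- (7/2) * A) * 2 ^ N i"
              by (simp add: powr_add[symmetric] powr_realpow del: powr_minus)
            from mult_left_mono[OF this norm_ge_zero[of "a i"]]
            have "cmod (a i) \<le> 2 powr (- (7/2) * A) * (cmod (a i) * 2 ^ N i)" by (simp add: mult_ac)
            then show ?thesis using n1 by (intro gen) linarith
          qed
        qed
        have "cmod (\<integral>i. (m (l i) * (1 - \<theta> (l i / A))) * a i \<partial>count_space UNIV) \<le> (\<integral>i. ?r i \<partial>count_space UNIV)"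
          by (rule norm_integral_le[OF rint bd])
        also have "\<dots> = L * (2 powr (A / 2) * (\<integral>i. cmod (a i) * (1/2) ^ N i \<partial>count_space UNIV) + 2 powr (- (7/2) * A) * (\<integral>i. cmod (a i) * 2 ^ N i \<partial>count_space UNIV))"
          using a[of "1/2"] a[of 2] by (simp del: powr_minus)
        also have "\<dots> \<le> L * (2 powr (A / 2) * exp ((1/2 - 1) * A) + 2 powr (- (7/2) * A) * exp ((2 - 1) * A))"
          using aI[of "1/2"] aI[of 2] L0 by (intro mult_left_mono add_mono) auto
        \<comment> \<open>The two exponents are A (ln 2 - 1)/2 and A (1 - (7/2) ln 2). With 1/2
          \<le> ln 2 \<le> 25/36 they are at most -(11/72) A and -(3/4) A, hence both below -A/8
          \<le> -D/16.\<close>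
        also have "\<dots> \<le> L * (exp (- (1/16) * D) + exp (- (1/16) * D))"
        proof (intro mult_left_mono add_mono L0)
          have D8: "- (1/8) * A \<le> - (1/16) * D" using D by simp
          have ln2: "ln 2 \<le> (25/36 :: real)" by (rule ln2_le_25_over_36)
          have "(1/2 :: real) \<le> ln 2"
          proof -
            have "exp (1/2 :: real) \<le> 2"
            proof -
              have "(exp (1/2 :: real))\<^sup>2 \<le> 2\<^sup>2" using exp_le by (simp add: power2_eq_square mult_exp_exp)
              then show ?thesis by (rule power2_le_imp_le) simp
            qed
            then show ?thesis using ln_ge_iff[of 2 "1/2"] by linarith
          qed
          then have "A * (1/2) \<le> A * ln 2" using A0 by (intro mult_left_mono) auto
          moreover have "- (7/2) * X + A \<le> - (1/16) * D" if "A * (1/2) \<le> X" for X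
            using that D8 A0 by linarith
          ultimately have "- (7/2) * (A * ln 2) + A \<le> - (1/16) * D" by blast
          then have "- (7/2) * A * ln 2 + (2 - 1) * A \<le> - (1/16) * D" by simp
          then show "2 powr (- (7/2) * A) * exp ((2 - 1) * A) \<le> exp (- (1/16) * D)"
            by (simp add: powr_def mult_exp_exp mult_ac)
          have "A * ln 2 \<le> A * (25/36)" using A0 ln2 by (intro mult_left_mono) auto
          moreover have "(1/2) * X + (1/2 - 1) * A \<le> - (1/16) * D" if "X \<le> A * (25/36)" for X
            using that D8 A0 by simp
          ultimately have "(1/2) * (A * ln 2) + (1/2 - 1) * A \<le> - (1/16) * D" by blast
          then have "A / 2 * ln 2 + (1/2 - 1) * A \<le> - (1/16) * D" by simp
          then show "2 powr (A / 2) * exp ((1/2 - 1) * A) \<le> exp (- (1/16) * D)"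
            by (simp add: powr_def mult_exp_exp mult_ac)
        qed
        also have "\<dots> \<le> L * (K2 * P + K2 * P)"
          unfolding P_def using K2(2)[OF D(1)] by (intro mult_left_mono add_mono L0) auto
        also have "\<dots> = 2 * M * (1 + \<Theta>) * K2 * P" by (simp add: L_def)
        finally show ?thesis .
      qed
      have hb1: "cmod (m (l i) * \<theta> (l i / A)) \<le> M * \<Theta>" for i
        unfolding norm_mult using M0 by (intro mult_mono hM \<Theta>) auto
      have hb2: "cmod (m (l i) * (1 - \<theta> (l i / A))) \<le> M * (1 + \<Theta>)" for i
        unfolding norm_mult using M0 order_trans[OF norm_triangle_ineq4[of 1 "\<theta> (l i / A)"]] \<Theta>[of "l i / A"]
        by (intro mult_mono hM) auto
      have "(\<integral>i. m (l i) * a i \<partial>count_space UNIV) = (\<integral>i. (m (l i) * \<theta> (l i / A)) * a i + (m (l i) * (1 - \<theta> (l i / A))) * a i \<partial>count_space UNIV)"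
        by (rule Bochner_Integration.integral_cong) (auto simp: algebra_simps)
      also have "\<dots> = (\<integral>i. (m (l i) * \<theta> (l i / A)) * a i \<partial>count_space UNIV) + (\<integral>i. (m (l i) * (1 - \<theta> (l i / A))) * a i \<partial>count_space UNIV)"
        by (rule Bochner_Integration.integral_add[OF ab[of "\<lambda>i. m (l i) * \<theta> (l i / A)", OF hb1] ab[of "\<lambda>i. m (l i) * (1 - \<theta> (l i / A))", OF hb2]])
      finally have "cmod (\<integral>i. m (l i) * a i \<partial>count_space UNIV) \<le> 15 * (C4 * W) / cmod c * P + 2 * M * (1 + \<Theta>) * K2 * P"
        using norm_triangle_le[OF add_mono[OF near far]] by simp
      also have "\<dots> \<le> C * P" unfolding C_def using parts(1) P0 by (simp add: distrib_right)
      finally show ?thesis by (simp add: l_def P_def)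
    qed
  qed
  have "C \<ge> 0" unfolding C_def using parts by linarith
  then show thesis using that[of C] main by blast
qed

section \<open>The coherent state matrix of a multiplier\<close>

abbreviation zbar :: "real \<Rightarrow> real \<Rightarrow> complex" where
  "zbar x y \<equiv> complex_of_real x - \<i> * complex_of_real y"

lemma cmod_zbar_sq: "(cmod (zbar x y))\<^sup>2 = x\<^sup>2 + y\<^sup>2"
  by (simp add: cmod_power2)

text \<open>The two normalizations combine to 2^k k!, so the products are terms of an exponential
  series: this is the reproducing kernel of Bargmann space, up to Gaussian factors and
  phases.\<close>

lemma gabor1_cross:
  defines "e x y \<equiv> exp (- complex_of_real (x\<^sup>2 + y\<^sup>2) / 4 - \<i> * complex_of_real (x * y) / 2)"
  shows "gabor1 k x y * cnj (gabor1 k x' y') = (zbar x y * cnj (zbar x' y') / 2) ^ k / fact k * (e x y * cnj (e x' y'))"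
proof -
  have h: "complex_of_real (hnorm k) * complex_of_real (hnorm k) = 2 ^ k * fact k"
    unfolding of_real_mult[symmetric] hnorm_sq by simp
  have "gabor1 k x y * cnj (gabor1 k x' y') = (zbar x y * cnj (zbar x' y')) ^ k / (complex_of_real (hnorm k) * complex_of_real (hnorm k)) * (e x y * cnj (e x' y'))"
    unfolding gabor1_def e_def complex_cnj_mult complex_cnj_divide complex_cnj_power complex_cnj_complex_of_real power_mult_distrib
    by (simp only: times_divide_times_eq times_divide_eq_left times_divide_eq_right divide_divide_eq_left mult_ac)
  then show ?thesis unfolding h by (simp add: power_divide)
qed

text \<open>With absolute values the sum is a product of Poisson generating functions. With a
  unimodular w it is the overlap of one coherent state with the other one rotated in phase space by
  the argument of w; the phases disappear under the modulus.\<close>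

lemma
  fixes x y x' y' :: "real ^ 'n::finite" and s :: real and w :: complex
  defines "E \<equiv> \<lambda>j. exp (- ((x $ j)\<^sup>2 + (y $ j)\<^sup>2) / 4) * exp (- ((x' $ j)\<^sup>2 + (y' $ j)\<^sup>2) / 4)"
    and "q \<equiv> \<lambda>j. zbar (x $ j) (y $ j) * cnj (zbar (x' $ j) (y' $ j))"
  shows gabor_cross_integrable: "s \<ge> 0 \<Longrightarrow> integrable (count_space UNIV) (\<lambda>\<alpha>. cmod (gabor \<alpha> x y * cnj (gabor \<alpha> x' y')) * s ^ multi_abs \<alpha>)"
    and gabor_cross_sum: "s \<ge> 0 \<Longrightarrow> (\<integral>\<alpha>. cmod (gabor \<alpha> x y * cnj (gabor \<alpha> x' y')) * s ^ multi_abs \<alpha> \<partial>count_space UNIV) = (\<Prod>j\<in>UNIV. exp (s * cmod (q j) / 2) * E j)"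
    and gabor_cross_osc: "cmod (\<integral>\<alpha>. (gabor \<alpha> x y * cnj (gabor \<alpha> x' y')) * w ^ multi_abs \<alpha> \<partial>count_space UNIV) = (\<Prod>j\<in>UNIV. exp (Re (w * q j) / 2) * E j)"
proof -
  define e where "e x y = exp (- complex_of_real (x\<^sup>2 + y\<^sup>2) / 4 - \<i> * complex_of_real (x * y) / 2)" for x y
  define F where "F j = e (x $ j) (y $ j) * cnj (e (x' $ j) (y' $ j))" for j
  have E: "cmod (F j) = E j" for j
    by (simp add: F_def E_def e_def norm_mult)
  have a: "gabor \<alpha> x y * cnj (gabor \<alpha> x' y') = (\<Prod>j\<in>UNIV. (q j / 2) ^ \<alpha> j / fact (\<alpha> j) * F j)" for \<alpha>
    unfolding gabor_def cnj_prod prod.distrib[symmetric] gabor1_cross q_def F_def e_def ..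
  have wpow: "w ^ multi_abs \<alpha> = (\<Prod>j\<in>UNIV. w ^ \<alpha> j)" for w :: "'c::comm_monoid_mult" and \<alpha> :: "'n \<Rightarrow> nat"
    by (simp add: multi_abs_def power_sum)
  have sm: "(\<lambda>k. (c ^ k / fact k) * K) sums (exp c * K)" for c K :: "'c::{real_normed_field,banach}"
  proof -
    have "(\<lambda>k. c ^ k /\<^sub>R fact k) sums exp c" by (rule exp_converges)
    then have "(\<lambda>k. (c ^ k /\<^sub>R fact k) * K) sums (exp c * K)" by (rule sums_mult2)
    then show ?thesis by (simp add: scaleR_conv_of_real divide_inverse mult.commute)
  qed
  have eq1: "cmod (gabor \<alpha> x y * cnj (gabor \<alpha> x' y')) * s ^ multi_abs \<alpha> = (\<Prod>j\<in>UNIV. (s * cmod (q j) / 2) ^ \<alpha> j / fact (\<alpha> j) * E j)" for \<alpha>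
    unfolding a wpow prod_norm[symmetric] prod.distrib[symmetric]
    by (rule prod.cong) (auto simp: norm_mult norm_divide norm_power E power_mult_distrib power_divide)
  have E0: "E j \<ge> 0" for j by (simp add: E_def)
  show "integrable (count_space UNIV) (\<lambda>\<alpha>. cmod (gabor \<alpha> x y * cnj (gabor \<alpha> x' y')) * s ^ multi_abs \<alpha>)"
    and "(\<integral>\<alpha>. cmod (gabor \<alpha> x y * cnj (gabor \<alpha> x' y')) * s ^ multi_abs \<alpha> \<partial>count_space UNIV) = (\<Prod>j\<in>UNIV. exp (s * cmod (q j) / 2) * E j)" if "s \<ge> 0"
  proof -
    have sum: "summable (\<lambda>k. norm ((s * cmod (q j) / 2) ^ k / fact k * E j))" for j
      using sm[of "s * cmod (q j) / 2" "E j"] that E0[of j] by (simp add: sums_iff abs_mult)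
    show "integrable (count_space UNIV) (\<lambda>\<alpha>. cmod (gabor \<alpha> x y * cnj (gabor \<alpha> x' y')) * s ^ multi_abs \<alpha>)"
      unfolding eq1 by (rule integrable_count_prod(1)[OF sum])
    show "(\<integral>\<alpha>. cmod (gabor \<alpha> x y * cnj (gabor \<alpha> x' y')) * s ^ multi_abs \<alpha> \<partial>count_space UNIV) = (\<Prod>j\<in>UNIV. exp (s * cmod (q j) / 2) * E j)"
      unfolding eq1 integrable_count_prod(2)[OF sum]
      by (rule prod.cong[OF refl]) (rule sums_unique[OF sm, symmetric])
  qed
  have eq2: "(gabor \<alpha> x y * cnj (gabor \<alpha> x' y')) * w ^ multi_abs \<alpha> = (\<Prod>j\<in>UNIV. (w * q j / 2) ^ \<alpha> j / fact (\<alpha> j) * F j)" for \<alpha>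
    unfolding a wpow prod.distrib[symmetric]
    by (rule prod.cong) (auto simp: power_mult_distrib power_divide)
  have sum2: "summable (\<lambda>k. norm ((w * q j / 2) ^ k / fact k * F j))" for j
    using sm[of "norm (w * q j / 2)" "norm (F j)"] by (simp add: sums_iff norm_mult norm_divide norm_power power_divide)
  have "(\<integral>\<alpha>. (gabor \<alpha> x y * cnj (gabor \<alpha> x' y')) * w ^ multi_abs \<alpha> \<partial>count_space UNIV) = (\<Prod>j\<in>UNIV. exp (w * q j / 2) * F j)"
    unfolding eq2 integrable_count_prod(2)[OF sum2]
    by (rule prod.cong[OF refl]) (rule sums_unique[OF sm, symmetric])
  then show "cmod (\<integral>\<alpha>. (gabor \<alpha> x y * cnj (gabor \<alpha> x' y')) * w ^ multi_abs \<alpha> \<partial>count_space UNIV) = (\<Prod>j\<in>UNIV. exp (Re (w * q j) / 2) * E j)"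
    by (simp add: prod_norm[symmetric] norm_mult E)
qed

text \<open>The abstract sum bound is used with A = (|z|^2 + |z'|^2)/4 and D = |z - z'|^2/4. The sum
  over multi-indices is the matrix entry of m(H) between two wave packets, and the radial decay in D
  is finally relaxed to a product weight.\<close>

theorem kernel_bound:
  fixes m :: "real \<Rightarrow> complex"
  assumes \<psi>: "admissible_cutoff \<psi>" and m_cont: "continuous_on {0<..} m"
    and sloc: "sloc_norm \<psi> \<beta> m < \<infinity>" and \<gamma>: "0 < \<gamma>" "\<gamma> < \<beta> - 1/2"
    and M: "\<And>x. x > 0 \<Longrightarrow> cmod (m x) \<le> M"
  obtains C where "C \<ge> 0"
    "\<And>x y x' y' :: real ^ 'n::finite.
      cmod (\<integral>\<alpha>. m (real (2 * multi_abs \<alpha> + CARD('n))) * (gabor \<alpha> x y * cnj (gabor \<alpha> x' y')) \<partial>count_space UNIV)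
      \<le> C * wt (\<gamma> / (2 * real CARD('n))) (x - x') * wt (\<gamma> / (2 * real CARD('n))) (y - y')"
proof -
  have d: "CARD('n) \<ge> 1" by (simp add: Suc_leI)
  obtain C where C: "C \<ge> 0"
    "\<And>(a :: ('n \<Rightarrow> nat) \<Rightarrow> complex) N A D. 0 \<le> D \<Longrightarrow> D \<le> 2 * A \<Longrightarrow>
      (\<And>s. s \<in> {1/2, 1, 2} \<Longrightarrow> integrable (count_space UNIV) (\<lambda>i. cmod (a i) * s ^ N i)) \<Longrightarrow>
      (\<And>s. s \<in> {1/2, 1, 2} \<Longrightarrow> (\<integral>i. cmod (a i) * s ^ N i \<partial>count_space UNIV) \<le> exp ((s - 1) * A)) \<Longrightarrow>
      (\<And>\<phi>. cmod (\<integral>i. a i * iexp (\<phi> * real (N i)) \<partial>count_space UNIV) \<le> exp (\<phi>\<^sup>2 * A - D / 2)) \<Longrightarrow>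
      cmod (\<integral>i. m (real (2 * N i + CARD('n))) * a i \<partial>count_space UNIV) \<le> C * (1 + D) powr (- \<gamma>)"
    by (rule multiplier_sum_bound[OF \<psi> m_cont sloc \<gamma> M d]) blast+
  \<comment> \<open>The decay (1 + D)^(-\<gamma>) is shared equally among the 2d real coordinates of
    phase space, where 1 + D is at least a quarter of each 1 + v_j^2; so each receives
    \<gamma>/(2d), which exceeds 1/2 when \<gamma> > d.\<close>
  define b where "b = \<gamma> / (2 * real CARD('n))"
  have b0: "b > 0" using \<gamma> by (simp add: b_def)
  have "cmod (\<integral>\<alpha>. m (real (2 * multi_abs \<alpha> + CARD('n))) * (gabor \<alpha> x y * cnj (gabor \<alpha> x' y')) \<partial>count_space UNIV)
      \<le> (C * 4 powr \<gamma>) * wt b (x - x') * wt b (y - y')" for x y x' y' :: "real ^ 'n"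
  proof -
    define z where "z j = zbar (x $ j) (y $ j)" for j
    define z' where "z' j = zbar (x' $ j) (y' $ j)" for j
    define Aj where "Aj j = ((cmod (z j))\<^sup>2 + (cmod (z' j))\<^sup>2) / 4" for j
    define Dj where "Dj j = (cmod (z j - z' j))\<^sup>2 / 4" for j
    define A where "A = (\<Sum>j\<in>UNIV. Aj j)"
    define D where "D = (\<Sum>j\<in>UNIV. Dj j)"
    define q where "q j = z j * cnj (z' j)" for j
    have Ej: "exp (- ((x $ j)\<^sup>2 + (y $ j)\<^sup>2) / 4) * exp (- ((x' $ j)\<^sup>2 + (y' $ j)\<^sup>2) / 4) = exp (- Aj j)" for j
      unfolding mult_exp_exp Aj_def z_def z'_def cmod_zbar_sq by (simp add: field_simps)
    have D0: "0 \<le> D" unfolding D_def Dj_def by (intro sum_nonneg) auto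
    have expand: "(cmod (w * u - v))\<^sup>2 = (cmod u)\<^sup>2 + (cmod v)\<^sup>2 - 2 * Re (w * (u * cnj v))" if "cmod w = 1" for w u v
    proof -
      have "(cmod (w * u - v))\<^sup>2 = (cmod (w * u))\<^sup>2 + (cmod v)\<^sup>2 - 2 * Re ((w * u) * cnj v)"
        unfolding cmod_power2 by (simp add: power2_eq_square algebra_simps)
      then show ?thesis using that by (simp add: norm_mult mult.assoc)
    qed
    have par: "(cmod (u - v))\<^sup>2 \<le> 2 * (cmod u)\<^sup>2 + 2 * (cmod v)\<^sup>2" for u v :: complex
    proof -
      have "(cmod (u - v))\<^sup>2 \<le> (cmod u + cmod v)\<^sup>2" by (intro power_mono norm_triangle_ineq4) auto
      also have "\<dots> \<le> 2 * (cmod u)\<^sup>2 + 2 * (cmod v)\<^sup>2"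
        using sum_squares_bound[of "cmod u" "cmod v"] by (simp add: power2_sum)
      finally show ?thesis .
    qed
    have DA: "D \<le> 2 * A"
      unfolding D_def A_def sum_distrib_left
    proof (rule sum_mono)
      fix j show "Dj j \<le> 2 * Aj j" using par[of "z j" "z' j"] by (simp add: Dj_def Aj_def)
    qed
    \<comment> \<open>The arithmetic-geometric mean inequality. It bounds the Poisson mean |q_j|/2
      by A_j, which is the moment hypothesis of the sum bound.\<close>
    have q2: "cmod (q j) / 2 \<le> Aj j" for j
      using sum_squares_bound[of "cmod (z j)" "cmod (z' j)"] by (simp add: q_def Aj_def norm_mult mult_ac)
    have "cmod (\<integral>\<alpha>. m (real (2 * multi_abs \<alpha> + CARD('n))) * (gabor \<alpha> x y * cnj (gabor \<alpha> x' y')) \<partial>count_space UNIV)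
      \<le> C * (1 + D) powr (- \<gamma>)"
    proof (rule C(2)[OF D0 DA])
      fix s :: real assume s: "s \<in> {1/2, 1, 2}"
      then have s0: "s \<ge> 0" by auto
      show "integrable (count_space UNIV) (\<lambda>\<alpha>. cmod (gabor \<alpha> x y * cnj (gabor \<alpha> x' y')) * s ^ multi_abs \<alpha>)"
        by (rule gabor_cross_integrable[OF s0])
      have "(\<integral>\<alpha>. cmod (gabor \<alpha> x y * cnj (gabor \<alpha> x' y')) * s ^ multi_abs \<alpha> \<partial>count_space UNIV) = (\<Prod>j\<in>UNIV. exp (s * cmod (q j) / 2 - Aj j))"
        unfolding gabor_cross_sum[OF s0] Ej q_def z_def z'_def by (simp only: mult_exp_exp diff_conv_add_uminus)
      also have "\<dots> \<le> (\<Prod>j\<in>UNIV. exp ((s - 1) * Aj j))"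
      proof (intro prod_mono conjI)
        fix j
        have "s * (cmod (q j) / 2) \<le> s * Aj j" using s0 q2 by (intro mult_left_mono)
        then show "exp (s * cmod (q j) / 2 - Aj j) \<le> exp ((s - 1) * Aj j)" by (simp add: algebra_simps)
      qed auto
      also have "\<dots> = exp ((s - 1) * A)" by (simp add: exp_sum[symmetric] A_def sum_distrib_left)
      finally show "(\<integral>\<alpha>. cmod (gabor \<alpha> x y * cnj (gabor \<alpha> x' y')) * s ^ multi_abs \<alpha> \<partial>count_space UNIV) \<le> exp ((s - 1) * A)" .
    next
      fix \<phi> :: real
      let ?w = "iexp \<phi>"
      have "iexp (\<phi> * real k) = ?w ^ k" for k
        by (simp add: exp_of_nat_mult[symmetric] mult_ac)
      then have "cmod (\<integral>\<alpha>. (gabor \<alpha> x y * cnj (gabor \<alpha> x' y')) * iexp (\<phi> * real (multi_abs \<alpha>)) \<partial>count_space UNIV)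
        = cmod (\<integral>\<alpha>. (gabor \<alpha> x y * cnj (gabor \<alpha> x' y')) * ?w ^ multi_abs \<alpha> \<partial>count_space UNIV)" by simp
      also have "\<dots> = (\<Prod>j\<in>UNIV. exp (Re (?w * q j) / 2 - Aj j))"
        unfolding gabor_cross_osc Ej q_def z_def z'_def by (simp only: mult_exp_exp diff_conv_add_uminus)
      also have "\<dots> \<le> (\<Prod>j\<in>UNIV. exp (\<phi>\<^sup>2 * Aj j - Dj j / 2))"
      proof (intro prod_mono conjI)
        fix j
        have "cmod (?w - 1) \<le> \<bar>\<phi>\<bar>" using iexp_approx1[of \<phi> 0] by simp
        then have "(cmod (?w - 1))\<^sup>2 \<le> \<phi>\<^sup>2" by (metis abs_norm_cancel abs_le_square_iff)
        then have "(cmod ((?w - 1) * z j))\<^sup>2 \<le> \<phi>\<^sup>2 * (cmod (z j))\<^sup>2"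
          by (simp add: norm_mult power_mult_distrib mult_right_mono)
        moreover have "(cmod (z j - z' j))\<^sup>2 \<le> 2 * (cmod (?w * z j - z' j))\<^sup>2 + 2 * (cmod ((?w - 1) * z j))\<^sup>2"
          \<comment> \<open>By \<open>expand\<close>, Re (w q_j)/2 - A_j = -|w z_j - z'_j|^2/4. The
            distance between the unrotated points exceeds the rotated one only through (w - 1) z_j,
            of size at most |\<phi>| |z_j|; the parallelogram bound costs half of D_j.\<close>
          using par[of "?w * z j - z' j" "(?w - 1) * z j"] by (simp add: algebra_simps)
        moreover have "(cmod (?w * z j - z' j))\<^sup>2 = (cmod (z j))\<^sup>2 + (cmod (z' j))\<^sup>2 - 2 * Re (?w * q j)"
          unfolding q_def by (rule expand) simp
        moreover have "0 \<le> \<phi>\<^sup>2 * (cmod (z' j))\<^sup>2" by simp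
        ultimately have "Re (?w * q j) / 2 - Aj j \<le> \<phi>\<^sup>2 * Aj j - Dj j / 2"
          unfolding Aj_def Dj_def distrib_left add_divide_distrib times_divide_eq_right by linarith
        then show "exp (Re (?w * q j) / 2 - Aj j) \<le> exp (\<phi>\<^sup>2 * Aj j - Dj j / 2)" by simp
      qed auto
      also have "\<dots> = exp (\<phi>\<^sup>2 * A - D / 2)"
        by (simp add: exp_sum[symmetric] A_def D_def sum_distrib_left sum_subtractf sum_divide_distrib)
      finally show "cmod (\<integral>\<alpha>. (gabor \<alpha> x y * cnj (gabor \<alpha> x' y')) * iexp (\<phi> * real (multi_abs \<alpha>)) \<partial>count_space UNIV) \<le> exp (\<phi>\<^sup>2 * A - D / 2)" .
    qed
    also have "C * (1 + D) powr (- \<gamma>) \<le> C * (4 powr \<gamma> * (wt b (x - x') * wt b (y - y')))"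
    proof (rule mult_left_mono[OF _ C(1)])
      have coord: "1 + ((x - x') $ j)\<^sup>2 \<le> 4 * (1 + D)" "1 + ((y - y') $ j)\<^sup>2 \<le> 4 * (1 + D)" for j
      proof -
        have "Dj j \<le> D" unfolding D_def by (rule member_le_sum) (auto simp: Dj_def)
        moreover have "4 * Dj j = ((x - x') $ j)\<^sup>2 + ((y - y') $ j)\<^sup>2"
          by (simp add: Dj_def z_def z'_def cmod_power2 power2_commute[of "y' $ j"])
        ultimately have "((x - x') $ j)\<^sup>2 + ((y - y') $ j)\<^sup>2 \<le> 4 * D" by linarith
        moreover have "0 \<le> ((x - x') $ j)\<^sup>2" "0 \<le> ((y - y') $ j)\<^sup>2" by simp_all
        ultimately have "1 + ((x - x') $ j)\<^sup>2 \<le> 4 + 4 * D" "1 + ((y - y') $ j)\<^sup>2 \<le> 4 + 4 * D"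
          by (linarith, linarith)
        then show "1 + ((x - x') $ j)\<^sup>2 \<le> 4 * (1 + D)" "1 + ((y - y') $ j)\<^sup>2 \<le> 4 * (1 + D)"
          by (simp_all add: distrib_left)
      qed
      \<comment> \<open>Each of the d coordinates of v contributes the exponent b, and d b =
        \<gamma>/2; the x part and the y part together give \<gamma>.\<close>
      have lower: "(4 * (1 + D)) powr (- \<gamma> / 2) \<le> wt b v" if "\<And>j. 1 + (v $ j)\<^sup>2 \<le> 4 * (1 + D)" for v :: "real ^ 'n"
      proof -
        have "(\<Prod>j\<in>(UNIV :: 'n set). (4 * (1 + D)) powr (- b)) \<le> wt b v"
          unfolding wt_vec using b0 that by (intro prod_mono conjI powr_mono2') (auto simp: add_pos_nonneg)
        moreover have "(\<Prod>j\<in>(UNIV :: 'n set). (4 * (1 + D)) powr (- b)) = (4 * (1 + D)) powr (- \<gamma> / 2)"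
          using D0 by (simp add: powr_power b_def del: powr_minus)
        ultimately show ?thesis by simp
      qed
      have "(4 * (1 + D)) powr (- \<gamma> / 2) * (4 * (1 + D)) powr (- \<gamma> / 2) \<le> wt b (x - x') * wt b (y - y')"
        by (intro mult_mono lower coord) (auto simp: less_imp_le[OF wt_pos])
      moreover have "(4 * (1 + D)) powr (- \<gamma> / 2) * (4 * (1 + D)) powr (- \<gamma> / 2) = 4 powr (- \<gamma>) * (1 + D) powr (- \<gamma>)"
        using D0 by (simp add: powr_add[symmetric] powr_mult[symmetric] del: powr_minus)
      ultimately have "4 powr \<gamma> * (4 powr (- \<gamma>) * (1 + D) powr (- \<gamma>)) \<le> 4 powr \<gamma> * (wt b (x - x') * wt b (y - y'))"
        by (intro mult_left_mono) auto
      moreover have "4 powr \<gamma> * (4 powr (- \<gamma>) * (1 + D) powr (- \<gamma>)) = (1 + D) powr (- \<gamma>)"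
        by (simp add: mult.assoc[symmetric] powr_add[symmetric] del: powr_minus)
      ultimately show "(1 + D) powr (- \<gamma>) \<le> 4 powr \<gamma> * (wt b (x - x') * wt b (y - y'))" by simp
    qed
    finally show ?thesis by (simp only: mult.assoc)
  qed
  then show thesis using that[of "C * 4 powr \<gamma>"] C(1) unfolding b_def by simp
qed

section \<open>Minkowski's and Young's inequalities in mixed norms\<close>

lemma enn_powr_ennreal [simp]: "c \<ge> 0 \<Longrightarrow> enn_powr (ennreal c) e = ennreal (c powr e)"
  by (simp add: enn_powr_def)

lemma enn_powr_top [simp]: "enn_powr top e = top" "enn_powr \<infinity> e = \<infinity>"
  by (simp_all add: enn_powr_def infinity_ennreal_def)

lemma enn_powr_measurable [measurable (raw)]:
  assumes [measurable]: "f \<in> borel_measurable M"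
  shows "(\<lambda>x. enn_powr (f x) e) \<in> borel_measurable M"
  unfolding enn_powr_def by measurable

lemma enn_powr_mono:
  assumes "a \<le> b" "e \<ge> 0" shows "enn_powr a e \<le> enn_powr b e"
proof (cases b)
  case (real y)
  then obtain x where "a = ennreal x" "x \<ge> 0" "x \<le> y" using assms by (cases a) (auto simp: top_unique)
  then show ?thesis using real assms by (auto intro!: ennreal_leI powr_mono2)
qed auto

lemma enn_powr_powr: "enn_powr (enn_powr a e) f = enn_powr a (e * f)"
  by (cases a) (auto simp: powr_powr)

lemma enn_powr_one [simp]: "enn_powr a 1 = a"
  by (cases a) auto

lemma enn_powr_cmult:
  assumes "c > 0" shows "enn_powr (ennreal c * a) e = ennreal (c powr e) * enn_powr a e"
proof (cases a)
  case (real x)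
  then show ?thesis using assms by (simp add: ennreal_mult[symmetric] powr_mult)
next
  case top
  then show ?thesis using assms by (simp add: ennreal_mult_top)
qed

definition Lnorm :: "real \<Rightarrow> 'a measure \<Rightarrow> ('a \<Rightarrow> ennreal) \<Rightarrow> ennreal" where
  "Lnorm r M U = enn_powr (\<integral>\<^sup>+x. enn_powr (U x) r \<partial>M) (1 / r)"

lemma Lnorm_mono: "r > 0 \<Longrightarrow> (\<And>x. U x \<le> V x) \<Longrightarrow> Lnorm r M U \<le> Lnorm r M V"
  unfolding Lnorm_def by (intro enn_powr_mono nn_integral_mono) auto

lemma Lnorm_cmult:
  assumes "c > 0" "r > 0" and [measurable]: "U \<in> borel_measurable M"
  shows "Lnorm r M (\<lambda>x. ennreal c * U x) = ennreal c * Lnorm r M U"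
proof -
  have "Lnorm r M (\<lambda>x. ennreal c * U x) = enn_powr (ennreal (c powr r) * (\<integral>\<^sup>+x. enn_powr (U x) r \<partial>M)) (1 / r)"
    unfolding Lnorm_def using assms by (simp add: enn_powr_cmult nn_integral_cmult)
  also have "\<dots> = ennreal ((c powr r) powr (1 / r)) * Lnorm r M U"
    unfolding Lnorm_def using assms by (simp add: enn_powr_cmult)
  also have "(c powr r) powr (1 / r) = c" using assms by (simp add: powr_powr)
  finally show ?thesis .
qed

text \<open>The convex function \<alpha> \<mapsto> b^(1-r) \<alpha>^r lies above its tangent at
  \<alpha> = t b. The bound is linear in A, so it can be integrated before t is chosen, and
  optimizing t afterwards recovers Jensen's inequality.\<close>

lemma weighted_young:
  fixes A :: ennreal and b t r :: real
  assumes b: "b > 0" and t: "t \<ge> 0" and r: "r \<ge> 1"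
  shows "ennreal (r * t powr (r - 1)) * A \<le> ennreal (b powr (1 - r)) * enn_powr A r + ennreal ((r - 1) * t powr r * b)"
proof (cases A)
  case (real \<alpha>)
  have main: "r * t powr (r - 1) * \<alpha> \<le> b powr (1 - r) * \<alpha> powr r + (r - 1) * t powr r * b"
  proof (cases "r = 1")
    case True
    have "t powr 0 * \<alpha> \<le> 1 * \<alpha>" using real by (intro mult_right_mono) auto
    then show ?thesis using True b real by simp
  next
    case False
    then have r1: "r > 1" using r by simp
    define s where "s = \<alpha> / b"
    have s: "s \<ge> 0" using real b by (simp add: s_def)
    have "s * t powr (r - 1) \<le> s powr r / r + (t powr (r - 1)) powr (r / (r - 1)) / (r / (r - 1))"
      using r1 s by (intro Youngs_inequality) (auto simp: field_simps)
    also have "(t powr (r - 1)) powr (r / (r - 1)) = t powr r" using r1 by (simp add: powr_powr)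
    finally have "r * (s * t powr (r - 1)) \<le> r * (s powr r / r + t powr r / (r / (r - 1)))"
      using r1 by (intro mult_left_mono) auto
    also have "\<dots> = s powr r + (r - 1) * t powr r" using r1 by (simp add: field_simps)
    finally have "b * (r * (s * t powr (r - 1))) \<le> b * (s powr r + (r - 1) * t powr r)"
      using b by (intro mult_left_mono) auto
    moreover have "b * s powr r = b powr (1 - r) * \<alpha> powr r"
      using b real by (simp add: s_def powr_divide powr_diff)
    moreover have "b * (r * (s * t powr (r - 1))) = r * t powr (r - 1) * \<alpha>"
      using b by (simp add: s_def)
    ultimately show ?thesis by (simp add: algebra_simps)
  qed
  then have "ennreal (r * t powr (r - 1) * \<alpha>) \<le> ennreal (b powr (1 - r) * \<alpha> powr r + (r - 1) * t powr r * b)"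
    by (rule ennreal_leI)
  moreover have "ennreal (r * t powr (r - 1)) * A = ennreal (r * t powr (r - 1) * \<alpha>)"
    unfolding real(2) using real(1) t r by (subst ennreal_mult) auto
  moreover have "ennreal (b powr (1 - r)) * enn_powr A r + ennreal ((r - 1) * t powr r * b) = ennreal (b powr (1 - r) * \<alpha> powr r + (r - 1) * t powr r * b)"
    unfolding real(2) enn_powr_ennreal[OF real(1)] using t r b
    by (subst ennreal_mult[symmetric]; (subst ennreal_plus[symmetric])?) auto
  ultimately show ?thesis by simp
next
  case top
  then show ?thesis using b by (simp add: ennreal_mult_top)
qed

text \<open>Jensen's inequality with the weight $b(u) = \|A(\cdot,u)\|_r + \delta$, in the linearized form
  \<open>weighted_young\<close>: unlike the usual proof by duality this never divides by
  $\|\int A\,du\|_r$, which may be infinite.\<close>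

theorem minkowski_integral:
  fixes A :: "'a \<Rightarrow> 'b \<Rightarrow> ennreal" and r :: real
  assumes M: "sigma_finite_measure M" and N: "finite_measure N" and r: "r \<ge> 1"
    and [measurable]: "(\<lambda>(x, u). A x u) \<in> borel_measurable (M \<Otimes>\<^sub>M N)"
  shows "Lnorm r M (\<lambda>x. \<integral>\<^sup>+u. A x u \<partial>N) \<le> (\<integral>\<^sup>+u. Lnorm r M (\<lambda>x. A x u) \<partial>N)"
proof (cases "(\<integral>\<^sup>+u. Lnorm r M (\<lambda>x. A x u) \<partial>N) = \<infinity>")
  case fin: False
  interpret M: sigma_finite_measure M by fact
  interpret N: finite_measure N by fact
  interpret MN: pair_sigma_finite M N ..
  have [measurable]: "(\<lambda>(u, x). A x u) \<in> borel_measurable (N \<Otimes>\<^sub>M M)"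
    using measurable_compose[OF measurable_pair_swap', of "\<lambda>(x, u). A x u" M N borel] assms(4)
    by (simp add: split_def)
  define a where "a u = Lnorm r M (\<lambda>x. A x u)" for u
  have [measurable]: "a \<in> borel_measurable N" unfolding a_def[abs_def] Lnorm_def by measurable
  have apow: "(\<integral>\<^sup>+x. enn_powr (A x u) r \<partial>M) = enn_powr (a u) r" for u
    using r by (simp add: a_def Lnorm_def enn_powr_powr)
  obtain I where I: "I \<ge> 0" "(\<integral>\<^sup>+u. a u \<partial>N) = ennreal I" using fin by (cases "\<integral>\<^sup>+u. a u \<partial>N") (auto simp: a_def)
  have aefin: "AE u in N. a u \<noteq> \<infinity>" by (rule nn_integral_noteq_infinite) (auto simp: I)
  \<comment> \<open>The added 1 keeps V positive even for the zero measure, so that \<delta> = e/V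
    is available at the end.\<close>
  define V where "V = measure N (space N) + 1"
  have V: "V > 0" by (simp add: V_def add_nonneg_pos)
  let ?S = "\<lambda>x. \<integral>\<^sup>+u. A x u \<partial>N"
  have eps: "Lnorm r M ?S \<le> ennreal (I + \<delta> * V)" if \<delta>: "\<delta> > 0" for \<delta> :: real
  proof -
    \<comment> \<open>The summand \<delta> keeps the weight positive where the norm of A is 0; N
      being finite, it adds at most \<delta> V to the integral.\<close>
    define b where "b u = enn2real (a u) + \<delta>" for u
    have b: "b u > 0" for u using \<delta> by (simp add: b_def add_nonneg_pos)
    have [measurable]: "b \<in> borel_measurable N" unfolding b_def[abs_def] by measurable
    define J where "J = I + \<delta> * V"
    have J: "J > 0" using I \<delta> V by (simp add: J_def add_nonneg_pos)
    have bJ: "(\<integral>\<^sup>+u. ennreal (b u) \<partial>N) \<le> ennreal J"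
    proof -
      have "(\<integral>\<^sup>+u. ennreal (b u) \<partial>N) = (\<integral>\<^sup>+u. ennreal (enn2real (a u)) + ennreal \<delta> \<partial>N)"
        unfolding b_def using \<delta> by simp
      also have "\<dots> = (\<integral>\<^sup>+u. ennreal (enn2real (a u)) \<partial>N) + ennreal \<delta> * emeasure N (space N)"
        by (subst nn_integral_add) auto
      also have "\<dots> \<le> ennreal I + ennreal \<delta> * ennreal V"
      proof (intro add_mono mult_left_mono)
        have "(\<integral>\<^sup>+u. ennreal (enn2real (a u)) \<partial>N) \<le> (\<integral>\<^sup>+u. a u \<partial>N)"
          by (rule nn_integral_mono) (metis ennreal_enn2real_if order_refl zero_le)
        then show "(\<integral>\<^sup>+u. ennreal (enn2real (a u)) \<partial>N) \<le> ennreal I" by (simp add: I)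
        show "emeasure N (space N) \<le> ennreal V" by (simp add: N.emeasure_eq_measure V_def ennreal_leI)
      qed simp
      also have "\<dots> = ennreal J" using I \<delta> V by (simp add: J_def ennreal_mult[symmetric] ennreal_plus[symmetric] del: ennreal_plus)
      finally show ?thesis .
    qed
    define Q where "Q x = (\<integral>\<^sup>+u. ennreal (b u powr (1 - r)) * enn_powr (A x u) r \<partial>N)" for x
    have young: "ennreal (r * t powr (r - 1)) * ?S x \<le> Q x + ennreal ((r - 1) * t powr r * J)" if x: "x \<in> space M" and t: "t \<ge> 0" for x t
    proof -
      have [measurable]: "A x \<in> borel_measurable N"
        using measurable_compose[OF measurable_Pair1'[OF x] assms(4)] by simp
      have "ennreal (r * t powr (r - 1)) * ?S x = (\<integral>\<^sup>+u. ennreal (r * t powr (r - 1)) * A x u \<partial>N)"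
        by (simp add: nn_integral_cmult)
      also have "\<dots> \<le> (\<integral>\<^sup>+u. ennreal (b u powr (1 - r)) * enn_powr (A x u) r + ennreal ((r - 1) * t powr r * b u) \<partial>N)"
        by (intro nn_integral_mono weighted_young b t r)
      also have "\<dots> = Q x + (\<integral>\<^sup>+u. ennreal ((r - 1) * t powr r * b u) \<partial>N)"
        unfolding Q_def by (rule nn_integral_add) auto
      also have "(\<integral>\<^sup>+u. ennreal ((r - 1) * t powr r * b u) \<partial>N) = ennreal ((r - 1) * t powr r) * (\<integral>\<^sup>+u. ennreal (b u) \<partial>N)"
        using r b by (subst nn_integral_cmult[symmetric]) (auto simp: ennreal_mult[symmetric] less_imp_le)
      also have "\<dots> \<le> ennreal ((r - 1) * t powr r) * ennreal J" by (intro mult_left_mono bJ) simp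
      also have "\<dots> = ennreal ((r - 1) * t powr r * J)" using r J by (simp add: ennreal_mult)
      finally show ?thesis by (simp add: add_left_mono)
    qed
    have SQ: "enn_powr (?S x) r \<le> ennreal (J powr (r - 1)) * Q x" if x: "x \<in> space M" for x
    proof (cases "Q x")
      case top
      then show ?thesis using J by (simp add: ennreal_mult_top)
    next
      case (real \<rho>)
      show ?thesis
      proof (cases "?S x")
        \<comment> \<open>The value t = 1 already forces Q x to be infinite, against the assumption
          of this case.\<close>
        case top
        then have "ennreal (r * 1 powr (r - 1)) * top \<le> Q x + ennreal ((r - 1) * 1 powr r * J)"
          using young[OF x, of 1] by simp
        then have "Q x + ennreal ((r - 1) * J) = top" using r by (simp add: ennreal_mult_top top_unique)
        then show ?thesis using real by simp
      next
        case (real s)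
        \<comment> \<open>The optimal slope: at s = t J the linearized inequality loses nothing, and
          it becomes t^r J \<le> \<rho>.\<close>
        define t where "t = s / J"
        have t: "t \<ge> 0" using real J by (simp add: t_def)
        have "ennreal (r * t powr (r - 1) * s) \<le> ennreal (\<rho> + (r - 1) * t powr r * J)"
          using young[OF x t] real \<open>Q x = ennreal \<rho>\<close> \<open>0 \<le> \<rho>\<close> r J by (simp add: ennreal_mult[symmetric] ennreal_plus[symmetric] del: ennreal_plus)
        then have le: "r * t powr (r - 1) * s \<le> \<rho> + (r - 1) * t powr r * J"
          using \<open>0 \<le> \<rho>\<close> r J by (subst (asm) ennreal_le_iff) auto
        have "s powr r \<le> J powr (r - 1) * \<rho>"
        proof (cases "s = 0")
          case True then show ?thesis using \<open>0 \<le> \<rho>\<close> by simp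
        next
          case False
          then have s: "s > 0" using real by simp
          then have t0: "t > 0" using J by (simp add: t_def)
          have st: "s = t * J" using J by (simp add: t_def)
          have e: "t powr (r - 1) * s = t powr r * J" using t0 by (simp add: st powr_diff)
          have "r * (t powr r * J) \<le> \<rho> + (r - 1) * (t powr r * J)" using le unfolding mult.assoc e .
          then have "t powr r * J \<le> \<rho>" by (simp add: algebra_simps)
          then have "J powr (r - 1) * (t powr r * J) \<le> J powr (r - 1) * \<rho>" by (intro mult_left_mono) auto
          moreover have "J powr (r - 1) * (t powr r * J) = s powr r"
            using J t0 by (simp add: st powr_mult powr_diff)
          ultimately show ?thesis by simp
        qed
        then show ?thesis using real \<open>Q x = ennreal \<rho>\<close> \<open>0 \<le> \<rho>\<close> by (simp add: ennreal_mult[symmetric] ennreal_leI)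
      qed
    qed
    have "(\<integral>\<^sup>+x. enn_powr (?S x) r \<partial>M) \<le> (\<integral>\<^sup>+x. ennreal (J powr (r - 1)) * Q x \<partial>M)"
      by (intro nn_integral_mono SQ)
    also have "\<dots> = ennreal (J powr (r - 1)) * (\<integral>\<^sup>+x. Q x \<partial>M)"
      unfolding Q_def by (subst nn_integral_cmult) auto
    also have "(\<integral>\<^sup>+x. Q x \<partial>M) = (\<integral>\<^sup>+u. \<integral>\<^sup>+x. ennreal (b u powr (1 - r)) * enn_powr (A x u) r \<partial>M \<partial>N)"
      unfolding Q_def by (rule MN.Fubini'[symmetric]) measurable
    also have "\<dots> = (\<integral>\<^sup>+u. ennreal (b u powr (1 - r)) * enn_powr (a u) r \<partial>N)"
      by (intro nn_integral_cong) (auto simp: nn_integral_cmult apow)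
    \<comment> \<open>The reason for this choice of weight: almost everywhere a \<le> b, hence
      b^(1-r) a^r \<le> b, whose integral is at most J.\<close>
    also have "\<dots> \<le> (\<integral>\<^sup>+u. ennreal (b u) \<partial>N)"
    proof (rule nn_integral_mono_AE, use aefin in eventually_elim)
      case (elim u)
      then obtain c where c: "a u = ennreal c" "c \<ge> 0" by (cases "a u") auto
      have "c powr r \<le> b u powr r" using c r \<delta> by (intro powr_mono2) (auto simp: b_def)
      then have "b u powr (1 - r) * c powr r \<le> b u powr (1 - r) * b u powr r" by (intro mult_left_mono) auto
      also have "\<dots> = b u" using b[of u] by (simp add: powr_add[symmetric])
      finally show ?case using c by (simp add: ennreal_mult[symmetric] ennreal_leI)
    qed
    also note bJ
    finally have "(\<integral>\<^sup>+x. enn_powr (?S x) r \<partial>M) \<le> ennreal (J powr (r - 1)) * ennreal J" by (simp add: mult_left_mono)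
    also have "\<dots> = ennreal (J powr r)" using J by (simp add: ennreal_mult[symmetric] powr_diff)
    finally have "Lnorm r M ?S \<le> enn_powr (ennreal (J powr r)) (1 / r)"
      unfolding Lnorm_def using r by (intro enn_powr_mono) auto
    also have "\<dots> = ennreal J" using J r by (simp add: powr_powr)
    finally show ?thesis by (simp add: J_def)
  qed
  have "Lnorm r M ?S \<le> ennreal I"
  proof (rule ennreal_le_epsilon)
    fix e :: real assume e: "0 < e"
    have "Lnorm r M ?S \<le> ennreal (I + (e / V) * V)" by (rule eps) (use e V in simp)
    then show "Lnorm r M ?S \<le> ennreal I + ennreal e" using e V I by simp
  qed
  then show ?thesis using I by (simp add: a_def)
qed simp

lemma nn_integral_lborel_reflect:
  fixes f :: "'a::euclidean_space \<Rightarrow> ennreal"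
  assumes [measurable]: "f \<in> borel_measurable borel"
  shows "(\<integral>\<^sup>+x. f (c - x) \<partial>lborel) = (\<integral>\<^sup>+x. f x \<partial>lborel)" "(\<integral>\<^sup>+x. f (x - c) \<partial>lborel) = (\<integral>\<^sup>+x. f x \<partial>lborel)"
proof -
  show "(\<integral>\<^sup>+x. f (c - x) \<partial>lborel) = (\<integral>\<^sup>+x. f x \<partial>lborel)"
    by (subst (2) lborel_affine[of "-1" c]) (simp_all add: nn_integral_density nn_integral_distr)
  show "(\<integral>\<^sup>+x. f (x - c) \<partial>lborel) = (\<integral>\<^sup>+x. f x \<partial>lborel)"
    by (subst (2) lborel_affine[of "1" "-c"]) (simp_all add: nn_integral_density nn_integral_distr)
qed

section \<open>Convolution with a finite measure in mixed norms\<close>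

definition mixed_norm :: "real \<Rightarrow> real \<Rightarrow> ('a::euclidean_space \<Rightarrow> 'a \<Rightarrow> ennreal) \<Rightarrow> ennreal" where
  "mixed_norm r s F = Lnorm s lborel (\<lambda>y. Lnorm r lborel (\<lambda>x. F x y))"

text \<open>The convolution kernel is encoded as a measure on phase space, finite for b > 1/2, so
  that convolution is a superposition of translates and Minkowski's inequality applies to
  it.\<close>

definition wt_measure :: "real \<Rightarrow> ('a::euclidean_space \<times> 'a) measure" where
  "wt_measure b = density (lborel \<Otimes>\<^sub>M lborel) (\<lambda>p. ennreal (wt b (fst p) * wt b (snd p)))"

lemma sets_wt_measure [measurable_cong]: "sets (wt_measure b) = sets (lborel \<Otimes>\<^sub>M lborel)"
  by (simp add: wt_measure_def)

lemma nn_integral_wt_measure: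
  fixes F :: "'a::euclidean_space \<Rightarrow> 'a \<Rightarrow> ennreal"
  assumes [measurable]: "(\<lambda>(x, y). F x y) \<in> borel_measurable (lborel \<Otimes>\<^sub>M lborel)"
  shows "(\<integral>\<^sup>+p. F (fst p) (snd p) \<partial>wt_measure b) = (\<integral>\<^sup>+x. \<integral>\<^sup>+y. ennreal (wt b x * wt b y) * F x y \<partial>lborel \<partial>lborel)"
proof -
  have "(\<integral>\<^sup>+p. F (fst p) (snd p) \<partial>wt_measure b) = (\<integral>\<^sup>+p. ennreal (wt b (fst p) * wt b (snd p)) * F (fst p) (snd p) \<partial>(lborel \<Otimes>\<^sub>M lborel))"
    unfolding wt_measure_def
    by (rule nn_integral_density) (use assms in \<open>auto simp: split_def\<close>)
  also have "\<dots> = (\<integral>\<^sup>+x. \<integral>\<^sup>+y. ennreal (wt b x * wt b y) * F x y \<partial>lborel \<partial>lborel)"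
    using lborel.nn_integral_fst[of "\<lambda>(x, y). ennreal (wt b x * wt b y) * F x y" "lborel :: 'a measure"]
    by (simp add: split_def)
  finally show ?thesis .
qed

lemma finite_wt_measure: "b > 1/2 \<Longrightarrow> finite_measure (wt_measure b :: ('a::euclidean_space \<times> 'a) measure)"
proof
  assume b: "b > 1/2"
  have i: "(\<integral>\<^sup>+x. ennreal (wt b x) \<partial>(lborel :: 'a measure)) < \<infinity>"
    using wt_integrable[OF b, where 'a = 'a] unfolding integrable_iff_bounded
    by (simp add: less_imp_le[OF wt_pos] abs_of_nonneg)
  have "emeasure (wt_measure b) (space (wt_measure b :: ('a \<times> 'a) measure)) = (\<integral>\<^sup>+p. 1 \<partial>(wt_measure b :: ('a \<times> 'a) measure))" by simp
  also have "\<dots> = (\<integral>\<^sup>+x. \<integral>\<^sup>+y. ennreal (wt b (x::'a)) * ennreal (wt b (y::'a)) \<partial>lborel \<partial>lborel)"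
    using nn_integral_wt_measure[of "\<lambda>(x::'a) (y::'a). 1::ennreal" b]
    by (simp add: ennreal_mult less_imp_le[OF wt_pos])
  also have "\<dots> = (\<integral>\<^sup>+x. ennreal (wt b (x::'a)) \<partial>lborel) * (\<integral>\<^sup>+x. ennreal (wt b (x::'a)) \<partial>lborel)"
    by (simp add: nn_integral_cmult nn_integral_multc)
  also have "\<dots> \<noteq> \<infinity>" using i by (simp add: ennreal_mult_eq_top_iff)
  finally show "emeasure (wt_measure b) (space (wt_measure b :: ('a \<times> 'a) measure)) \<noteq> \<infinity>" .
qed

text \<open>Minkowski's inequality, in x for fixed y and then in y; each time translation invariance
  removes the shift. The constant is K times the total mass of the kernel.\<close>

theorem mixed_young:
  fixes H B :: "'a::euclidean_space \<Rightarrow> 'a \<Rightarrow> ennreal"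
  assumes r: "r \<ge> 1" and s: "s \<ge> 1" and b: "b > 1/2" and K: "K > 0"
    and [measurable]: "(\<lambda>(x, y). B x y) \<in> borel_measurable (borel \<Otimes>\<^sub>M borel)"
    and H: "\<And>x y. H x y \<le> ennreal K * (\<integral>\<^sup>+p. B (x - fst p) (y - snd p) \<partial>wt_measure b)"
  shows "mixed_norm r s H \<le> ennreal (K * measure (wt_measure b :: ('a \<times> 'a) measure) (space (wt_measure b))) * mixed_norm r s B"
proof -
  let ?N = "wt_measure b :: ('a \<times> 'a) measure"
  interpret N: finite_measure ?N by (rule finite_wt_measure[OF b])
  have sf: "sigma_finite_measure (lborel :: 'a measure)" by standard
  define g where "g y = Lnorm r lborel (\<lambda>x. B x y)" for y
  have [measurable]: "g \<in> borel_measurable borel"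
    unfolding g_def[abs_def] Lnorm_def by measurable
  let ?S = "\<lambda>x y. \<integral>\<^sup>+p. B (x - fst p) (y - snd p) \<partial>?N"
  have [measurable]: "(\<lambda>x. ?S x y) \<in> borel_measurable lborel" for y by measurable
  have gshift: "Lnorm r lborel (\<lambda>x. B (x - u) y) = g y" for u y
    unfolding g_def Lnorm_def
    by (rule arg_cong[where f = "\<lambda>I. enn_powr I (1 / r)"]) (rule nn_integral_lborel_reflect(2)[of "\<lambda>x. enn_powr (B x y) r"], measurable)
  have inner: "Lnorm r lborel (\<lambda>x. H x y) \<le> ennreal K * (\<integral>\<^sup>+p. g (y - snd p) \<partial>?N)" for y
  proof -
    have "Lnorm r lborel (\<lambda>x. H x y) \<le> Lnorm r lborel (\<lambda>x. ennreal K * ?S x y)"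
      using r H by (intro Lnorm_mono) auto
    also have "\<dots> = ennreal K * Lnorm r lborel (\<lambda>x. ?S x y)"
      using K r by (intro Lnorm_cmult) auto
    also have "Lnorm r lborel (\<lambda>x. ?S x y) \<le> (\<integral>\<^sup>+p. Lnorm r lborel (\<lambda>x. B (x - fst p) (y - snd p)) \<partial>?N)"
      by (rule minkowski_integral[OF sf N.finite_measure_axioms r]) measurable
    also have "\<dots> = (\<integral>\<^sup>+p. g (y - snd p) \<partial>?N)" by (simp add: gshift)
    finally show ?thesis by (simp add: mult_left_mono)
  qed
  have "mixed_norm r s H \<le> Lnorm s lborel (\<lambda>y. ennreal K * (\<integral>\<^sup>+p. g (y - snd p) \<partial>?N))"
    unfolding mixed_norm_def using s inner by (intro Lnorm_mono) auto
  also have "\<dots> = ennreal K * Lnorm s lborel (\<lambda>y. \<integral>\<^sup>+p. g (y - snd p) \<partial>?N)"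
    using K s by (intro Lnorm_cmult) auto
  also have "Lnorm s lborel (\<lambda>y. \<integral>\<^sup>+p. g (y - snd p) \<partial>?N) \<le> (\<integral>\<^sup>+p. Lnorm s lborel (\<lambda>y. g (y - snd p)) \<partial>?N)"
    by (rule minkowski_integral[OF sf N.finite_measure_axioms s]) measurable
  also have "\<dots> = (\<integral>\<^sup>+p. Lnorm s lborel g \<partial>?N)"
  proof (rule nn_integral_cong)
    fix p
    show "Lnorm s lborel (\<lambda>y. g (y - snd p)) = Lnorm s lborel g"
      unfolding Lnorm_def
      by (rule arg_cong[where f = "\<lambda>I. enn_powr I (1 / s)"]) (rule nn_integral_lborel_reflect(2)[of "\<lambda>y. enn_powr (g y) s"], measurable)
  qed
  also have "\<dots> = Lnorm s lborel g * ennreal (measure ?N (space ?N))"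
    by (simp add: N.emeasure_eq_measure)
  finally have "mixed_norm r s H \<le> ennreal K * (Lnorm s lborel g * ennreal (measure ?N (space ?N)))"
    by (simp add: mult_left_mono)
  also have "\<dots> = ennreal (K * measure ?N (space ?N)) * mixed_norm r s B"
    using K unfolding mixed_norm_def g_def[symmetric] by (simp add: ennreal_mult mult_ac)
  finally show ?thesis .
qed

lemma mod_norm_mixed_norm:
  fixes f g :: "real ^ 'n::finite \<Rightarrow> complex"
  assumes "r > 0" "s > 0"
  shows "mod_norm g r s f = mixed_norm r s (\<lambda>x y. ennreal (cmod (stft g f x y)))"
  unfolding mod_norm_def mixed_norm_def Lnorm_def using assms by (simp add: enn_powr_powr)

section \<open>Boundedness on modulation spaces\<close>

lemma stft_measurable:
  fixes f g :: "real ^ 'n::finite \<Rightarrow> complex"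
  assumes [measurable]: "f \<in> borel_measurable borel" "g \<in> borel_measurable borel"
  shows "(\<lambda>(x, y). stft g f x y) \<in> borel_measurable (borel \<Otimes>\<^sub>M borel)"
  unfolding stft_def by measurable

text \<open>If h is concentrated near (x, y) in phase space, Moyal's inequality bounds its pairing
  with f by an average of |\<open>stft g f\<close>| around (x, y). In its uses h is a wave packet of
  one of the two windows, or the image of a wave packet under the adjoint of m(H).\<close>

theorem stft_convolution_bound:
  fixes f h g :: "real ^ 'n::finite \<Rightarrow> complex"
  assumes f: "integrable lborel f"
    and h: "continuous_on UNIV h" "\<And>x. cmod (h x) \<le> B" "integrable lborel h"
    and g: "continuous_on UNIV g" "\<And>x. cmod (g x) \<le> B'" "integrable lborel g"
    and K: "K \<ge> 0" and b: "b > 1/2"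
    and bd: "\<And>x' y'. cmod (stft g h x' y') \<le> K * wt b (x - x') * wt b (y - y')"
  shows "ennreal (cmod (\<integral>t. f t * cnj (h t) \<partial>lborel) * (\<integral>t. (cmod (g t))\<^sup>2 \<partial>lborel))
    \<le> ennreal K * (\<integral>\<^sup>+p. ennreal (cmod (stft g f (x - fst p) (y - snd p))) \<partial>wt_measure b)"
proof -
  have [measurable]: "f \<in> borel_measurable borel" "h \<in> borel_measurable borel" "g \<in> borel_measurable borel"
    using f h g by (auto dest: borel_measurable_integrable)
  have [measurable]: "(\<lambda>(x, y). stft g f x y) \<in> borel_measurable (borel \<Otimes>\<^sub>M borel)"
    "(\<lambda>(x, y). stft g h x y) \<in> borel_measurable (borel \<Otimes>\<^sub>M borel)"
    by (intro stft_measurable; measurable)+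
  have wtint: "integrable lborel (\<lambda>y'. wt b (y - y'))"
    using wt_integrable[OF b, where 'a = "real ^ 'n"] lborel_integrable_affine_iff[of "-1" "wt b :: real ^ 'n \<Rightarrow> real" y] by simp
  \<comment> \<open>The integrability in y' that Moyal's inequality asks of the transform of h comes
    from the decay \<open>bd\<close> itself, as b > 1/2.\<close>
  have int: "integrable lborel (stft g h x')" for x'
  proof (rule Bochner_Integration.integrable_bound)
    show "integrable lborel (\<lambda>y'. K * wt b (x - x') * wt b (y - y'))" using wtint by simp
    show "AE y' in lborel. norm (stft g h x' y') \<le> norm (K * wt b (x - x') * wt b (y - y'))"
      using bd K by (auto simp: abs_mult less_imp_le[OF wt_pos])
  qed measurable
  define F where "F x' y' = ennreal (cmod (stft g f (x - x') (y - y')))" for x' y'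
  have [measurable]: "(\<lambda>(x', y'). F x' y') \<in> borel_measurable (lborel \<Otimes>\<^sub>M lborel)"
    unfolding F_def by measurable
  have "ennreal (cmod (\<integral>t. f t * cnj (h t) \<partial>lborel) * (\<integral>t. (cmod (g t))\<^sup>2 \<partial>lborel))
    \<le> (\<integral>\<^sup>+x'. \<integral>\<^sup>+y'. ennreal (cmod (stft g f x' y') * cmod (stft g h x' y')) \<partial>lborel \<partial>lborel)"
    by (rule moyal_inequality[OF f h g int])
  also have "\<dots> \<le> (\<integral>\<^sup>+x'. \<integral>\<^sup>+y'. ennreal (cmod (stft g f x' y')) * ennreal (K * (wt b (x - x') * wt b (y - y'))) \<partial>lborel \<partial>lborel)"
  proof (intro nn_integral_mono)
    fix x' y'
    have "ennreal (cmod (stft g f x' y') * cmod (stft g h x' y')) = ennreal (cmod (stft g f x' y')) * ennreal (cmod (stft g h x' y'))"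
      by (simp add: ennreal_mult)
    also have "\<dots> \<le> ennreal (cmod (stft g f x' y')) * ennreal (K * (wt b (x - x') * wt b (y - y')))"
      using bd[of x' y'] by (intro mult_left_mono ennreal_leI) (auto simp: mult.assoc)
    finally show "ennreal (cmod (stft g f x' y') * cmod (stft g h x' y')) \<le> ennreal (cmod (stft g f x' y')) * ennreal (K * (wt b (x - x') * wt b (y - y')))" .
  qed
  also have "\<dots> = (\<integral>\<^sup>+x'. \<integral>\<^sup>+y'. F x' y' * ennreal (K * (wt b x' * wt b y')) \<partial>lborel \<partial>lborel)"
  proof -
    have "(\<integral>\<^sup>+y'. ennreal (cmod (stft g f x' y')) * ennreal (K * (wt b (x - x') * wt b (y - y'))) \<partial>lborel)
       = (\<integral>\<^sup>+y'. ennreal (cmod (stft g f x' (y - y'))) * ennreal (K * (wt b (x - x') * wt b y')) \<partial>lborel)" for x'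
      using nn_integral_lborel_reflect(1)[of "\<lambda>y'. ennreal (cmod (stft g f x' (y - y'))) * ennreal (K * (wt b (x - x') * wt b y'))" y]
      by simp
    moreover have "(\<integral>\<^sup>+x'. \<integral>\<^sup>+y'. ennreal (cmod (stft g f x' (y - y'))) * ennreal (K * (wt b (x - x') * wt b y')) \<partial>lborel \<partial>lborel)
       = (\<integral>\<^sup>+x'. \<integral>\<^sup>+y'. F x' y' * ennreal (K * (wt b x' * wt b y')) \<partial>lborel \<partial>lborel)"
      using nn_integral_lborel_reflect(1)[of "\<lambda>x'. \<integral>\<^sup>+y'. ennreal (cmod (stft g f (x - x') (y - y'))) * ennreal (K * (wt b x' * wt b y')) \<partial>lborel" x]
      by (simp add: F_def)
    ultimately show ?thesis by simp
  qed
  also have "\<dots> = (\<integral>\<^sup>+x'. \<integral>\<^sup>+y'. ennreal K * (ennreal (wt b x' * wt b y') * F x' y') \<partial>lborel \<partial>lborel)"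
    using K by (intro nn_integral_cong) (simp add: ennreal_mult less_imp_le[OF wt_pos] mult_ac)
  also have "\<dots> = ennreal K * (\<integral>\<^sup>+x'. \<integral>\<^sup>+y'. ennreal (wt b x' * wt b y') * F x' y' \<partial>lborel \<partial>lborel)"
    by (simp add: nn_integral_cmult)
  also have "(\<integral>\<^sup>+x'. \<integral>\<^sup>+y'. ennreal (wt b x' * wt b y') * F x' y' \<partial>lborel \<partial>lborel) = (\<integral>\<^sup>+p. F (fst p) (snd p) \<partial>wt_measure b)"
    by (rule nn_integral_wt_measure[symmetric]) measurable
  finally show ?thesis by (simp add: F_def)
qed

text \<open>Covariance under phase-space shifts; the phase exp (i (y - y') x) is lost under the
  modulus.\<close>

lemma stft_shift:
  fixes f g :: "real ^ 'n::finite \<Rightarrow> complex"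
  assumes [measurable]: "f \<in> borel_measurable borel" "g \<in> borel_measurable borel"
  shows "cmod (stft g (\<lambda>t. f (t - x) * iexp (y \<bullet> t)) x' y') = cmod (stft g f (x' - x) (y' - y))"
proof -
  have "(\<integral>t. f (t - x) * iexp (y \<bullet> t) * cnj (g (t - x')) * iexpn (y' \<bullet> t) \<partial>lborel)
    = (\<integral>t. f (x + 1 *\<^sub>R t - x) * iexp (y \<bullet> (x + 1 *\<^sub>R t)) * cnj (g (x + 1 *\<^sub>R t - x')) * iexpn (y' \<bullet> (x + 1 *\<^sub>R t)) \<partial>lborel)"
    by (subst lborel_integral_affine[of 1 _ x]) auto
  also have "\<dots> = (\<integral>t. iexp ((y - y') \<bullet> x) * (f t * cnj (g (t - (x' - x))) * iexpn ((y' - y) \<bullet> t)) \<partial>lborel)"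
  proof (rule Bochner_Integration.integral_cong[OF refl])
    fix t
    have "iexp (y \<bullet> (x + 1 *\<^sub>R t)) * iexpn (y' \<bullet> (x + 1 *\<^sub>R t))
      = iexp ((y - y') \<bullet> x) * iexpn ((y' - y) \<bullet> t)"
      unfolding mult_exp_exp by (rule arg_cong[where f = exp]) (simp add: inner_add_right inner_diff_left algebra_simps)
    note e = this
    have v: "x + 1 *\<^sub>R t - x = t" "x + 1 *\<^sub>R t - x' = t - (x' - x)" by simp_all
    have ac: "F * a * G * b = c * (F * G * d)" if "a * b = c * d" for F G a b c d :: complex
    proof -
      have "F * a * G * b = F * G * (a * b)" by (simp only: mult_ac)
      then show ?thesis unfolding that by (simp only: mult_ac)
    qed
    show "f (x + 1 *\<^sub>R t - x) * iexp (y \<bullet> (x + 1 *\<^sub>R t)) * cnj (g (x + 1 *\<^sub>R t - x')) * iexpn (y' \<bullet> (x + 1 *\<^sub>R t))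
       = iexp ((y - y') \<bullet> x) * (f t * cnj (g (t - (x' - x))) * iexpn ((y' - y) \<bullet> t))"
      unfolding v by (rule ac) (rule e)
  qed
  also have "\<dots> = iexp ((y - y') \<bullet> x) * (\<integral>t. f t * cnj (g (t - (x' - x))) * iexpn ((y' - y) \<bullet> t) \<partial>lborel)"
    by (rule integral_mult_right_zero)
  finally show ?thesis
    unfolding stft_def by (simp only: norm_mult norm_exp_i_times mult_1)
qed

text \<open>Conjugate symmetry of the inner product of two wave packets. It makes one decay estimate
  serve for both orders of the windows.\<close>

lemma stft_swap:
  fixes f g :: "real ^ 'n::finite \<Rightarrow> complex"
  shows "cmod (stft g (\<lambda>t. f (t - x) * iexp (y \<bullet> t)) x' y')
    = cmod (stft f (\<lambda>t. g (t - x') * iexp (y' \<bullet> t)) x y)"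
proof -
  have "(\<integral>t. f (t - x) * iexp (y \<bullet> t) * cnj (g (t - x')) * iexpn (y' \<bullet> t) \<partial>lborel)
    = cnj (\<integral>t. g (t - x') * iexp (y' \<bullet> t) * cnj (f (t - x)) * iexpn (y \<bullet> t) \<partial>lborel)"
    by (subst Bochner_Integration.integral_cnj[symmetric]) (simp add: exp_cnj mult_ac)
  then show ?thesis unfolding stft_def by (simp only: norm_mult complex_mod_cnj)
qed

lemma stft_eq_inner:
  fixes f g :: "real ^ 'n::finite \<Rightarrow> complex"
  shows "cmod (stft g f x y) = (2 * pi) powr (- real CARD('n) / 2) * cmod (\<integral>t. f t * cnj (g (t - x) * iexp (y \<bullet> t)) \<partial>lborel)"
  by (simp add: stft_def norm_mult exp_cnj mult.assoc)

text \<open>A common form for two functions: m(H) f, and the adjoint of m(H) applied to a wave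
  packet. Summability against \<open>Phi_size\<close> makes either of them continuous with decay
  \<open>wt 1\<close>, and lets it be paired termwise with bounded functions.\<close>

definition hermite_series :: "(('n::finite \<Rightarrow> nat) \<Rightarrow> complex) \<Rightarrow> real ^ 'n \<Rightarrow> complex" where
  "hermite_series b t = (\<integral>\<alpha>. b \<alpha> * complex_of_real (hermite_Phi \<alpha> t) \<partial>count_space UNIV)"

context
  fixes b :: "('n::finite \<Rightarrow> nat) \<Rightarrow> complex"
  assumes b: "integrable (count_space UNIV) (\<lambda>\<alpha>. Phi_size \<alpha> * cmod (b \<alpha>))"
begin

lemma hermite_series_term_bound: "cmod (b \<alpha> * complex_of_real (hermite_Phi \<alpha> t)) \<le> (Phi_size \<alpha> * cmod (b \<alpha>)) * wt 1 t"
  using mult_left_mono[OF hermite_Phi_bound[of \<alpha> t], of "cmod (b \<alpha>)"] by (simp add: norm_mult mult_ac)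

lemma hermite_series_bound: "cmod (hermite_series b t) \<le> (\<integral>\<alpha>. Phi_size \<alpha> * cmod (b \<alpha>) \<partial>count_space UNIV) * wt 1 t"
proof -
  have "cmod (hermite_series b t) \<le> (\<integral>\<alpha>. (Phi_size \<alpha> * cmod (b \<alpha>)) * wt 1 t \<partial>count_space UNIV)"
    unfolding hermite_series_def by (rule norm_integral_le[OF _ hermite_series_term_bound]) (use b in simp)
  then show ?thesis by (simp only: integral_mult_left_zero)
qed

lemma hermite_series_continuous: "continuous_on UNIV (hermite_series b)"
  unfolding continuous_on_sequentially comp_def
proof (intro allI impI ballI)
  fix t :: "nat \<Rightarrow> real ^ 'n" and t0 assume t: "(\<forall>n. t n \<in> UNIV) \<and> t \<longlonglongrightarrow> t0"
  show "(\<lambda>n. hermite_series b (t n)) \<longlonglongrightarrow> hermite_series b t0"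
    unfolding hermite_series_def
  proof (rule integral_dominated_convergence[where w = "\<lambda>\<alpha>. Phi_size \<alpha> * cmod (b \<alpha>)"])
    show "AE \<alpha> in count_space UNIV. (\<lambda>n. b \<alpha> * complex_of_real (hermite_Phi \<alpha> (t n))) \<longlonglongrightarrow> b \<alpha> * complex_of_real (hermite_Phi \<alpha> t0)"
      using t by (intro AE_I2 tendsto_intros continuous_on_tendsto_compose[OF hermite_Phi_continuous]) auto
    show "AE \<alpha> in count_space UNIV. cmod (b \<alpha> * complex_of_real (hermite_Phi \<alpha> (t n))) \<le> Phi_size \<alpha> * cmod (b \<alpha>)" for n
    proof (rule AE_I2)
      fix \<alpha> :: "'n \<Rightarrow> nat"
      show "cmod (b \<alpha> * complex_of_real (hermite_Phi \<alpha> (t n))) \<le> Phi_size \<alpha> * cmod (b \<alpha>)"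
        using mult_left_mono[OF hermite_Phi_bound'[of \<alpha> "t n"], of "cmod (b \<alpha>)"] by (simp add: norm_mult mult_ac)
    qed
  qed (use b in simp_all)
qed

lemma hermite_series_measurable: "hermite_series b \<in> borel_measurable borel"
  by (rule borel_measurable_continuous_onI[OF hermite_series_continuous])

lemma hermite_series_integrable: "integrable lborel (hermite_series b)"
proof (rule Bochner_Integration.integrable_bound)
  show "integrable lborel (\<lambda>t::real^'n. (\<integral>\<alpha>. Phi_size \<alpha> * cmod (b \<alpha>) \<partial>count_space UNIV) * wt 1 t)"
    using wt_integrable[of 1, where 'a = "real ^ 'n"] by simp
  show "AE t in lborel. norm (hermite_series b t) \<le> norm ((\<integral>\<alpha>. Phi_size \<alpha> * cmod (b \<alpha>) \<partial>count_space UNIV) * wt 1 t)"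
    by (rule AE_I2) (unfold real_norm_def, rule order_trans[OF hermite_series_bound abs_ge_self])
qed (use hermite_series_measurable in simp)

lemma hermite_series_bounded: "cmod (hermite_series b t) \<le> (\<integral>\<alpha>. Phi_size \<alpha> * cmod (b \<alpha>) \<partial>count_space UNIV)"
proof (rule order_trans[OF hermite_series_bound])
  have "0 \<le> Phi_size \<alpha> * cmod (b \<alpha>)" for \<alpha> using Phi_size_ge1[of \<alpha>] by simp
  then show "(\<integral>\<alpha>. Phi_size \<alpha> * cmod (b \<alpha>) \<partial>count_space UNIV) * wt 1 t \<le> (\<integral>\<alpha>. Phi_size \<alpha> * cmod (b \<alpha>) \<partial>count_space UNIV)"
    by (intro mult_left_le wt_le1 Bochner_Integration.integral_nonneg) auto
qed

lemma hermite_series_integral: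
  assumes [measurable]: "k \<in> borel_measurable borel" and k: "\<And>t. cmod (k t) \<le> L"
  shows "(\<integral>t. hermite_series b t * k t \<partial>lborel) = (\<integral>\<alpha>. b \<alpha> * (\<integral>t. complex_of_real (hermite_Phi \<alpha> t) * k t \<partial>lborel) \<partial>count_space UNIV)"
proof -
  have L: "L \<ge> 0" using order_trans[OF norm_ge_zero k] .
  have "(\<integral>\<alpha>. b \<alpha> * (\<integral>t. complex_of_real (hermite_Phi \<alpha> t) * k t \<partial>lborel) \<partial>count_space UNIV)
    = (\<integral>\<alpha>. (\<integral>t. b \<alpha> * complex_of_real (hermite_Phi \<alpha> t) * k t \<partial>lborel) \<partial>count_space UNIV)"
    by (subst integral_mult_right_zero[symmetric]) (simp only: mult.assoc)
  also have "\<dots> = (\<integral>t. (\<integral>\<alpha>. b \<alpha> * complex_of_real (hermite_Phi \<alpha> t) * k t \<partial>count_space UNIV) \<partial>lborel)"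
  proof (rule Fubini_count[where a = "\<lambda>\<alpha>. Phi_size \<alpha> * cmod (b \<alpha>)" and w = "\<lambda>t. L * wt 1 t"])
    show "integrable lborel (\<lambda>t::real^'n. L * wt 1 t)"
      using wt_integrable[of 1, where 'a = "real ^ 'n"] by simp
    show "0 \<le> Phi_size \<alpha> * cmod (b \<alpha>)" for \<alpha> using Phi_size_ge1[of \<alpha>] by simp
    show "0 \<le> L * wt 1 t" for t :: "real ^ 'n" using L wt_pos[of 1 t] by simp
    show "cmod (b \<alpha> * complex_of_real (hermite_Phi \<alpha> t) * k t) \<le> Phi_size \<alpha> * cmod (b \<alpha>) * (L * wt 1 t)" for \<alpha> t
    proof -
      have "0 \<le> Phi_size \<alpha> * cmod (b \<alpha>) * wt 1 t" using Phi_size_ge1[of \<alpha>] wt_pos[of 1 t] by simp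
      then have "cmod (b \<alpha> * complex_of_real (hermite_Phi \<alpha> t)) * cmod (k t) \<le> (Phi_size \<alpha> * cmod (b \<alpha>) * wt 1 t) * L"
        by (intro mult_mono hermite_series_term_bound k) auto
      then show ?thesis by (simp add: norm_mult mult_ac)
    qed
  qed (use b in auto)
  also have "\<dots> = (\<integral>t. hermite_series b t * k t \<partial>lborel)"
    unfolding hermite_series_def by (simp only: integral_mult_left_zero)
  finally show ?thesis ..
qed

end

lemma hermite_mult_eq_series:
  fixes f :: "real ^ 'n::finite \<Rightarrow> complex"
  assumes f: "f \<in> schwartz" and M: "\<And>x. x > 0 \<Longrightarrow> cmod (m x) \<le> M"
  defines "b \<equiv> \<lambda>\<alpha>. m (real (2 * multi_abs \<alpha> + CARD('n))) * hermite_coeff f \<alpha>"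
  shows "hermite_mult m f = hermite_series b"
    and "integrable (count_space UNIV) (\<lambda>\<alpha>. Phi_size \<alpha> * cmod (b \<alpha>))"
proof -
  have mM: "cmod (m (real (2 * k + CARD('n)))) \<le> M" for k by (rule M) (simp add: add_nonneg_pos)
  show int: "integrable (count_space UNIV) (\<lambda>\<alpha>. Phi_size \<alpha> * cmod (b \<alpha>))"
  proof (rule Bochner_Integration.integrable_bound)
    show "integrable (count_space UNIV) (\<lambda>\<alpha>. M * (Phi_size \<alpha> * cmod (hermite_coeff f \<alpha>)))"
      using hermite_coeff_summable[OF f] by simp
    have "norm (Phi_size \<alpha> * cmod (b \<alpha>)) \<le> norm (M * (Phi_size \<alpha> * cmod (hermite_coeff f \<alpha>)))" for \<alpha>
    proof -
      have "cmod (m (real (2 * multi_abs \<alpha> + CARD('n)))) * (Phi_size \<alpha> * cmod (hermite_coeff f \<alpha>)) \<le> M * (Phi_size \<alpha> * cmod (hermite_coeff f \<alpha>))"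
        using Phi_size_ge1[of \<alpha>] by (intro mult_right_mono mM) auto
      moreover have "0 \<le> Phi_size \<alpha> * cmod (b \<alpha>)" using Phi_size_ge1[of \<alpha>] by simp
      ultimately show ?thesis
        unfolding real_norm_def by (simp add: b_def norm_mult mult_ac abs_of_nonneg)
    qed
    then show "AE \<alpha> in count_space UNIV. norm (Phi_size \<alpha> * cmod (b \<alpha>)) \<le> norm (M * (Phi_size \<alpha> * cmod (hermite_coeff f \<alpha>)))" by simp
  qed simp
  show "hermite_mult m f = hermite_series b"
  proof
    fix t
    have "integrable (count_space UNIV) (\<lambda>\<alpha>. b \<alpha> * complex_of_real (hermite_Phi \<alpha> t))"
    proof (rule Bochner_Integration.integrable_bound[OF int])
      show "AE \<alpha> in count_space UNIV. norm (b \<alpha> * complex_of_real (hermite_Phi \<alpha> t)) \<le> norm (Phi_size \<alpha> * cmod (b \<alpha>))"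
      proof (rule AE_I2)
        fix \<alpha> :: "'n \<Rightarrow> nat"
        show "norm (b \<alpha> * complex_of_real (hermite_Phi \<alpha> t)) \<le> norm (Phi_size \<alpha> * cmod (b \<alpha>))"
          using mult_left_mono[OF hermite_Phi_bound'[of \<alpha> t], of "cmod (b \<alpha>)"] Phi_size_ge1[of \<alpha>]
          by (simp add: norm_mult abs_mult mult_ac)
      qed
    qed simp
    from suminf_by_degree[OF this]
    have "hermite_series b t = (\<Sum>k. \<Sum>\<alpha>\<in>{\<alpha>. multi_abs \<alpha> = k}. b \<alpha> * complex_of_real (hermite_Phi \<alpha> t))"
      by (simp add: hermite_series_def)
    also have "\<dots> = hermite_mult m f t"
      unfolding hermite_mult_def hermite_proj_def sum_distrib_left b_def
      by (intro suminf_cong sum.cong) (auto simp: mult.assoc)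
    finally show "hermite_mult m f t = hermite_series b t" ..
  qed
qed

lemma AE_lborel_open:
  fixes U :: "'a::euclidean_space set"
  assumes U: "open U" and AE: "AE x in lborel. x \<notin> U"
  shows "U = {}"
proof -
  have "U \<in> null_sets lborel"
    using AE U by (subst (asm) AE_iff_null) auto
  then have "negligible U" using negligible_iff_null_sets null_sets_completionI by blast
  then show ?thesis using open_not_negligible[OF U] by blast
qed

text \<open>m(H) reads m only at the integers 2k + d, a null set on which an essential bound says
  nothing. By continuity the set where |m| exceeds the bound is open, and an open null set is
  empty.\<close>

lemma AE_bound_imp_bound:
  assumes m_Linf: "Linfty_pos m" and m_cont: "continuous_on {0<..} m"
  obtains M where "\<And>x. x > 0 \<Longrightarrow> cmod (m x) \<le> M"
proof -
  obtain M where M: "AE x in lborel. x > 0 \<longrightarrow> cmod (m x) \<le> M" using m_Linf by (auto simp: Linfty_pos_def)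
  define U where "U = {x \<in> {0<..}. M < cmod (m x)}"
  have "continuous_on {0<..} (\<lambda>x. cmod (m x))" by (intro continuous_intros m_cont)
  then obtain V where V: "open V" "V \<inter> {0<..} = U"
    using open_Collect_less_Int[OF continuous_on_const, of "{0<..}" "\<lambda>x. cmod (m x)" M] by (auto simp: U_def)
  then have "open U" by (metis open_Int open_greaterThan)
  moreover have "AE x in lborel. x \<notin> U" using M by eventually_elim (auto simp: U_def)
  ultimately have "U = {}" by (rule AE_lborel_open)
  then show thesis using that[of M] by (force simp: U_def)
qed

lemma integral_square_pos:
  fixes g :: "'a::euclidean_space \<Rightarrow> complex"
  assumes g: "continuous_on UNIV g" "\<And>x. cmod (g x) \<le> B" "integrable lborel g" "g x0 \<noteq> 0"
  shows "(\<integral>t. (cmod (g t))\<^sup>2 \<partial>lborel) > 0"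
proof (rule ccontr)
  have [measurable]: "g \<in> borel_measurable borel" using g(1) by (rule borel_measurable_continuous_onI)
  have "integrable lborel (\<lambda>t. g t * cnj (g t))"
    by (rule integrable_mult_bounded[OF g(3), of _ B]) (use g in auto)
  then have int: "integrable lborel (\<lambda>t. (cmod (g t))\<^sup>2)"
    using integrable_norm by (force simp: norm_mult power2_eq_square)
  assume "\<not> (\<integral>t. (cmod (g t))\<^sup>2 \<partial>lborel) > 0"
  moreover have "(\<integral>t. (cmod (g t))\<^sup>2 \<partial>lborel) \<ge> 0" by simp
  ultimately have "(\<integral>t. (cmod (g t))\<^sup>2 \<partial>lborel) = 0" by linarith
  then have "AE t in lborel. (cmod (g t))\<^sup>2 = 0"
    using integral_nonneg_eq_0_iff_AE[OF int] by simp
  then have "AE t in lborel. t \<notin> {t. g t \<noteq> 0}" by eventually_elim simp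
  moreover have "open {t. g t \<noteq> 0}" by (intro open_Collect_neq g continuous_intros)
  ultimately have "{t. g t \<noteq> 0} = {}" by (intro AE_lborel_open)
  then show False using g(4) by auto
qed

text \<open>One link of the final chain: a pointwise convolution bound between transforms passes to
  modulation norms, where both the function and the window may change.\<close>

lemma mod_norm_transfer:
  fixes f1 f2 g1 g2 :: "real ^ 'n::finite \<Rightarrow> complex"
  assumes r: "r \<ge> 1" and s: "s \<ge> 1" and b: "b > 1/2"
    and [measurable]: "f2 \<in> borel_measurable borel" "g2 \<in> borel_measurable borel"
    and le: "\<And>x y. ennreal (cmod (stft g1 f1 x y)) \<le> ennreal K * (\<integral>\<^sup>+p. ennreal (cmod (stft g2 f2 (x - fst p) (y - snd p))) \<partial>wt_measure b)"
    and K: "K > 0"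
  shows "mod_norm g1 r s f1 \<le> ennreal (K * measure (wt_measure b :: ((real^'n) \<times> (real^'n)) measure) (space (wt_measure b))) * mod_norm g2 r s f2"
proof -
  have [measurable]: "(\<lambda>(x, y). stft g2 f2 x y) \<in> borel_measurable (borel \<Otimes>\<^sub>M borel)"
    by (intro stft_measurable) measurable
  show ?thesis
    using r s mixed_young[OF r s b K _ le] by (simp add: mod_norm_mixed_norm)
qed

text \<open>Divides out the squared window norm G and restores the normalization c of
  \<open>stft\<close>. The added 1 makes the constant positive even if K = 0, as the passage to
  mixed norms requires.\<close>

lemma ennreal_rescale:
  assumes "ennreal (u * G) \<le> ennreal K * I" "G > 0" "c \<ge> 0" "u \<ge> 0" "K \<ge> 0"
  shows "ennreal (c * u) \<le> ennreal (c / G * K + 1) * I"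
proof -
  have "ennreal (c * u) = ennreal (c / G) * ennreal (u * G)"
    using assms by (simp add: ennreal_mult[symmetric])
  also have "\<dots> \<le> ennreal (c / G) * (ennreal K * I)" using assms by (intro mult_left_mono) auto
  also have "\<dots> = ennreal (c / G * K) * I"
    unfolding mult.assoc[symmetric] using assms by (subst ennreal_mult[symmetric]) auto
  also have "\<dots> \<le> ennreal (c / G * K + 1) * I" by (intro mult_right_mono ennreal_leI) auto
  finally show ?thesis .
qed

theorem theorem1p1:
  fixes m :: "real \<Rightarrow> complex" and \<psi> :: "real \<Rightarrow> real"
    and g :: "real ^ 'n::finite \<Rightarrow> complex" and p q \<beta> :: real
  assumes pq: "(1 < p \<and> p \<le> q \<and> q \<le> 2) \<or> (2 \<le> q \<and> q \<le> p)"
    and psi: "admissible_cutoff \<psi>"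
    and m_Linf: "Linfty_pos m"
    and m_cont: "continuous_on {0<..} m"
    and beta: "\<beta> > (2 * real CARD('n) + 1) / 2"
    and sloc: "sloc_norm \<psi> \<beta> m < \<infinity>"
    and g: "g \<in> schwartz" "g \<noteq> (\<lambda>_. 0)"
  shows "\<exists>C::real. \<forall>f\<in>schwartz.
           mod_norm g q p (hermite_mult m f) \<le> ennreal C * mod_norm g q p f"
proof -
  define n where "n = real CARD('n)"
  have n: "n \<ge> 1" by (simp add: n_def Suc_leI)
  \<comment> \<open>The midpoint of the admissible interval from n to \<beta> - 1/2, capped at 2n.
    The cap gives b \<le> 1, so that the decay \<open>wt 1\<close> of the transforms of Schwartz
    functions also bounds them by \<open>wt b\<close>.\<close>
  define \<gamma> where "\<gamma> = min (2 * n) ((n + (\<beta> - 1/2)) / 2)"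
  have nb: "n < \<beta> - 1/2" using beta by (simp add: n_def field_simps)
  then have \<gamma>: "0 < \<gamma>" "\<gamma> < \<beta> - 1/2" "n < \<gamma>" "\<gamma> \<le> 2 * n"
    using n by (auto simp: \<gamma>_def min_def field_simps)
  define b where "b = \<gamma> / (2 * n)"
  have b: "b > 1/2" "b \<le> 1" "b \<ge> 0" using \<gamma> n by (auto simp: b_def field_simps)
  have p1: "p \<ge> 1" and q1: "q \<ge> 1" using pq by auto
  obtain M where M: "\<And>x. x > 0 \<Longrightarrow> cmod (m x) \<le> M" using AE_bound_imp_bound[OF m_Linf m_cont] by blast
  obtain C1 where C1: "C1 \<ge> 0" "\<And>x y x' y' :: real ^ 'n.
      cmod (\<integral>\<alpha>. m (real (2 * multi_abs \<alpha> + CARD('n))) * (gabor \<alpha> x y * cnj (gabor \<alpha> x' y')) \<partial>count_space UNIV)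
      \<le> C1 * wt b (x - x') * wt b (y - y')"
    unfolding b_def n_def by (rule kernel_bound[OF psi m_cont sloc \<gamma>(1,2) M]) blast+
  obtain C2' where C2': "C2' \<ge> 0" "\<And>x y. cmod (stft gauss_window g x y) \<le> C2' * wt 1 x * wt 1 y"
    using stft_gauss_decay[OF g(1)] by blast
  have C2: "cmod (stft gauss_window g x y) \<le> C2' * wt b x * wt b y" for x y
    by (rule order_trans[OF C2'(2)]) (intro mult_mono mult_nonneg_nonneg C2' wt_mono b order_refl less_imp_le[OF wt_pos])
  obtain x0 where x0: "g x0 \<noteq> 0" using g(2) by auto
  obtain Bg where Bg: "\<And>x. cmod (g x) \<le> Bg" using schwartz_bounded[OF g(1)] by blast
  note gc = continuous_on_schwartz[OF g(1)] and gi = schwartz_integrable[OF g(1)]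
  have [measurable]: "g \<in> borel_measurable borel" by (rule schwartz_measurable[OF g(1)])
  have Gg: "(\<integral>t. (cmod (g t))\<^sup>2 \<partial>lborel) > 0" by (rule integral_square_pos[OF gc Bg gi x0])
  have Gw: "(\<integral>t. (cmod (gauss_window t :: complex))\<^sup>2 \<partial>(lborel :: (real^'n) measure)) > 0"
    by (rule integral_square_pos[OF gauss_window_continuous gauss_window_bound gauss_window_integrable, of 0])
       (simp add: gauss_window_def)
  define c where "c = (2 * pi) powr (- real CARD('n) / 2)"
  have c0: "c \<ge> 0" by (simp add: c_def)
  note inner = stft_eq_inner[where 'n = 'n, folded c_def]
  have wsym: "wt b (u - v) = wt b (v - u)" for u v :: "real ^ 'n" using wt_minus[of b "u - v"] by simp
  have waves: "continuous_on UNIV (\<lambda>t. k (t - x) * iexp (y \<bullet> t))"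
    "integrable lborel (\<lambda>t. k (t - x) * iexp (y \<bullet> t))"
    "\<And>t. cmod (k (t - x) * iexp (y \<bullet> t)) \<le> B"
    if k: "continuous_on UNIV k" "integrable lborel k" "\<And>t. cmod (k t) \<le> B" for k :: "real ^ 'n \<Rightarrow> complex" and x y B
  proof -
    have [measurable]: "k \<in> borel_measurable borel" using k(1) by (rule borel_measurable_continuous_onI)
    show "continuous_on UNIV (\<lambda>t. k (t - x) * iexp (y \<bullet> t))"
      by (intro continuous_intros continuous_on_compose2[OF k(1)]) auto
    have "integrable lborel (\<lambda>t. k (t - x))"
      using lborel_integrable_affine_iff[of 1 k "- x"] k(2) by simp
    then show "integrable lborel (\<lambda>t. k (t - x) * iexp (y \<bullet> t))"
      by (rule Bochner_Integration.integrable_bound) (auto simp: norm_mult)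
    show "cmod (k (t - x) * iexp (y \<bullet> t)) \<le> B" for t
      using k(3) by (simp add: norm_mult)
  qed
  define K1 K2 K3 where "K1 = c / (\<integral>t. (cmod (gauss_window t :: complex))\<^sup>2 \<partial>(lborel :: (real^'n) measure)) * C2' + 1"
    and "K2 = c / (\<integral>t. (cmod (gauss_window t :: complex))\<^sup>2 \<partial>(lborel :: (real^'n) measure)) * (c * C1) + 1"
    and "K3 = c / (\<integral>t. (cmod (g t))\<^sup>2 \<partial>lborel) * C2' + 1"
  have Kpos: "K1 > 0" "K2 > 0" "K3 > 0"
    unfolding K1_def K2_def K3_def using c0 C1(1) C2'(1) Gg Gw by (auto intro!: add_nonneg_pos mult_nonneg_nonneg)
  let ?V = "measure (wt_measure b :: ((real^'n) \<times> (real^'n)) measure) (space (wt_measure b))"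
  have "mod_norm g q p (hermite_mult m f) \<le> ennreal ((K1 * ?V) * ((K2 * ?V) * (K3 * ?V))) * mod_norm g q p f" if f: "f \<in> schwartz" for f
  proof -
    note fi = schwartz_integrable[OF f]
    obtain Bf where Bf: "\<And>x. cmod (f x) \<le> Bf" using schwartz_bounded[OF f] by blast
    have [measurable]: "f \<in> borel_measurable borel" by (rule schwartz_measurable[OF f])
    define bT where "bT \<alpha> = m (real (2 * multi_abs \<alpha> + CARD('n))) * hermite_coeff f \<alpha>" for \<alpha>
    have T: "hermite_mult m f = hermite_series bT" and bT: "integrable (count_space UNIV) (\<lambda>\<alpha>. Phi_size \<alpha> * cmod (bT \<alpha>))"
      unfolding bT_def by (rule hermite_mult_eq_series[OF f M]; assumption)+
    note Ti = hermite_series_integrable[OF bT, folded T]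
    have [measurable]: "hermite_mult m f \<in> borel_measurable borel" unfolding T by (rule hermite_series_measurable[OF bT])
    \<comment> \<open>Change of window from g to the Gaussian for m(H) f: h is a wave packet built
      from g, and its Gaussian transform decays because g is Schwartz.\<close>
    have step1: "ennreal (cmod (stft g (hermite_mult m f) x y)) \<le> ennreal K1 * (\<integral>\<^sup>+p. ennreal (cmod (stft gauss_window (hermite_mult m f) (x - fst p) (y - snd p))) \<partial>wt_measure b)" for x y
      unfolding inner[of g "hermite_mult m f" x y] K1_def
    proof (rule ennreal_rescale[OF stft_convolution_bound[OF Ti waves(1)[OF gc gi Bg] waves(3)[OF gc gi Bg] waves(2)[OF gc gi Bg]
          gauss_window_continuous gauss_window_bound gauss_window_integrable C2'(1) b(1)] Gw c0 _ C2'(1)])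
      show "cmod (stft gauss_window (\<lambda>t. g (t - x) * iexp (y \<bullet> t)) x' y') \<le> C2' * wt b (x - x') * wt b (y - y')" for x' y'
        unfolding wsym[of x] wsym[of y] by (subst stft_shift) (auto intro: C2)
    qed simp
    \<comment> \<open>Change of window back to g for f: now h is a Gaussian wave packet and g is the
      window of Moyal's inequality.\<close>
    have step3: "ennreal (cmod (stft gauss_window f x y)) \<le> ennreal K3 * (\<integral>\<^sup>+p. ennreal (cmod (stft g f (x - fst p) (y - snd p))) \<partial>wt_measure b)" for x y
      unfolding inner[of gauss_window f x y] K3_def
    proof (rule ennreal_rescale[OF stft_convolution_bound[OF fi
          waves(1)[OF gauss_window_continuous gauss_window_integrable gauss_window_bound]
          waves(3)[OF gauss_window_continuous gauss_window_integrable gauss_window_bound]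
          waves(2)[OF gauss_window_continuous gauss_window_integrable gauss_window_bound]
          gc Bg gi C2'(1) b(1)] Gg c0 _ C2'(1)])
      \<comment> \<open>Exchanging function and window reduces this to the decay of the Gaussian
        transform of g.\<close>
      show "cmod (stft g (\<lambda>t. gauss_window (t - x) * iexp (y \<bullet> t)) x' y') \<le> C2' * wt b (x - x') * wt b (y - y')" for x' y'
        by (subst stft_swap, subst stft_shift) (auto intro: C2)
    qed simp
    have step2: "ennreal (cmod (stft gauss_window (hermite_mult m f) x y)) \<le> ennreal K2 * (\<integral>\<^sup>+p. ennreal (cmod (stft gauss_window f (x - fst p) (y - snd p))) \<partial>wt_measure b)" for x y
    proof -
      \<comment> \<open>Hermite coefficients of the image of the Gaussian wave packet at (x, y)
        under the adjoint of m(H), whose symbol is the conjugate of m.\<close>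
      define bh where "bh \<alpha> = cnj (m (real (2 * multi_abs \<alpha> + CARD('n)))) * cnj (gabor \<alpha> x y)" for \<alpha>
      have bh: "integrable (count_space UNIV) (\<lambda>\<alpha>. Phi_size \<alpha> * cmod (bh \<alpha>))"
      proof (rule Bochner_Integration.integrable_bound)
        show "integrable (count_space UNIV) (\<lambda>\<alpha>. M * (Phi_size \<alpha> * cmod (gabor \<alpha> x y)))" by (intro integrable_mult_right gabor_summable)
        have "norm (Phi_size \<alpha> * cmod (bh \<alpha>)) \<le> norm (M * (Phi_size \<alpha> * cmod (gabor \<alpha> x y)))" for \<alpha>
        proof -
          have "cmod (m (real (2 * multi_abs \<alpha> + CARD('n)))) * (Phi_size \<alpha> * cmod (gabor \<alpha> x y)) \<le> M * (Phi_size \<alpha> * cmod (gabor \<alpha> x y))"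
            using Phi_size_ge1[of \<alpha>] by (intro mult_right_mono M) (auto simp: add_nonneg_pos)
          moreover have "0 \<le> Phi_size \<alpha> * cmod (bh \<alpha>)" using Phi_size_ge1[of \<alpha>] by simp
          ultimately show ?thesis unfolding real_norm_def by (simp add: bh_def norm_mult mult_ac abs_of_nonneg)
        qed
        then show "AE \<alpha> in count_space UNIV. norm (Phi_size \<alpha> * cmod (bh \<alpha>)) \<le> norm (M * (Phi_size \<alpha> * cmod (gabor \<alpha> x y)))" by simp
      qed simp
      have wave: "(\<integral>t. hermite_series \<beta>' t * cnj (gauss_window (t - x') * iexp (y' \<bullet> t)) \<partial>lborel) = (\<integral>\<alpha>. \<beta>' \<alpha> * gabor \<alpha> x' y' \<partial>count_space UNIV)"
        if "integrable (count_space UNIV) (\<lambda>\<alpha>. Phi_size \<alpha> * cmod (\<beta>' \<alpha>))" for \<beta>' and x' y' :: "real ^ 'n"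
      proof -
        have "cnj (gauss_window (t - x') * iexp (y' \<bullet> t)) = gauss_window (t - x') * iexpn (y' \<bullet> t)" for t
          by (simp add: exp_cnj)
        moreover have "(\<integral>t. hermite_series \<beta>' t * (gauss_window (t - x') * iexpn (y' \<bullet> t)) \<partial>lborel) = (\<integral>\<alpha>. \<beta>' \<alpha> * gabor \<alpha> x' y' \<partial>count_space UNIV)"
          unfolding gabor_hermite_Phi[symmetric]
          by (rule hermite_series_integral[OF that, of _ 1]) (use gauss_window_bound in \<open>auto simp: norm_mult\<close>)
        ultimately show ?thesis by (simp only:)
      qed
      \<comment> \<open>The adjoint relation between m(H) and its adjoint, checked by pairing both
        Hermite series termwise. It moves the multiplier away from f, so that Moyal's inequality
        involves the transform of f itself.\<close>
      have eq: "cmod (\<integral>t. hermite_mult m f t * cnj (gauss_window (t - x) * iexp (y \<bullet> t)) \<partial>lborel)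
        = cmod (\<integral>t. f t * cnj (hermite_series bh t) \<partial>lborel)"
      proof -
        have "cnj (\<integral>t. f t * cnj (hermite_series bh t) \<partial>lborel) = (\<integral>t. hermite_series bh t * cnj (f t) \<partial>lborel)"
          by (subst Bochner_Integration.integral_cnj[symmetric]) (simp add: mult.commute)
        also have "\<dots> = (\<integral>\<alpha>. bh \<alpha> * (\<integral>t. complex_of_real (hermite_Phi \<alpha> t) * cnj (f t) \<partial>lborel) \<partial>count_space UNIV)"
          by (rule hermite_series_integral[OF bh, of _ Bf]) (use Bf in auto)
        also have "\<dots> = (\<integral>\<alpha>. cnj (bT \<alpha> * gabor \<alpha> x y) \<partial>count_space UNIV)"
        proof (rule Bochner_Integration.integral_cong[OF refl])
          fix \<alpha>
          have "(\<integral>t. complex_of_real (hermite_Phi \<alpha> t) * cnj (f t) \<partial>lborel) = cnj (hermite_coeff f \<alpha>)"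
            unfolding hermite_coeff_def by (subst Bochner_Integration.integral_cnj[symmetric]) (simp add: mult.commute)
          then show "bh \<alpha> * (\<integral>t. complex_of_real (hermite_Phi \<alpha> t) * cnj (f t) \<partial>lborel) = cnj (bT \<alpha> * gabor \<alpha> x y)"
            by (simp add: bh_def bT_def mult_ac)
        qed
        also have "\<dots> = cnj (\<integral>\<alpha>. bT \<alpha> * gabor \<alpha> x y \<partial>count_space UNIV)" by (rule Bochner_Integration.integral_cnj)
        finally show ?thesis unfolding T wave[OF bT] by (simp only: complex_cnj_cancel_iff)
      qed
      \<comment> \<open>The transform of the image is, up to conjugation and the factor c, a matrix
        entry of m(H) between two wave packets; this is where the kernel bound enters.\<close>
      have bd: "cmod (stft gauss_window (hermite_series bh) x' y') \<le> (c * C1) * wt b (x - x') * wt b (y - y')" for x' y'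
      proof -
        have "(\<integral>\<alpha>. bh \<alpha> * gabor \<alpha> x' y' \<partial>count_space UNIV) = (\<integral>\<alpha>. cnj (m (real (2 * multi_abs \<alpha> + CARD('n))) * (gabor \<alpha> x y * cnj (gabor \<alpha> x' y'))) \<partial>count_space UNIV)"
          by (simp add: bh_def mult.assoc)
        also have "\<dots> = cnj (\<integral>\<alpha>. m (real (2 * multi_abs \<alpha> + CARD('n))) * (gabor \<alpha> x y * cnj (gabor \<alpha> x' y')) \<partial>count_space UNIV)"
          by (rule Bochner_Integration.integral_cnj)
        finally have "cmod (stft gauss_window (hermite_series bh) x' y') = c * cmod (\<integral>\<alpha>. m (real (2 * multi_abs \<alpha> + CARD('n))) * (gabor \<alpha> x y * cnj (gabor \<alpha> x' y')) \<partial>count_space UNIV)"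
          unfolding inner wave[OF bh] by (simp only: complex_mod_cnj)
        then show ?thesis using mult_left_mono[OF C1(2)[of x y x' y'] c0] by (simp only: mult.assoc)
      qed
      show ?thesis
        unfolding inner[of gauss_window "hermite_mult m f" x y] eq K2_def
        by (rule ennreal_rescale[OF stft_convolution_bound[OF fi hermite_series_continuous[OF bh] hermite_series_bounded[OF bh] hermite_series_integrable[OF bh]
            gauss_window_continuous gauss_window_bound gauss_window_integrable _ b(1) bd] Gw c0])
           (use c0 C1(1) in auto)
    qed
    \<comment> \<open>The three transfers are composed: window g to Gaussian, removal of the
      multiplier, Gaussian to window g. Each contributes one factor \<open>?V\<close>, the mass of
      the kernel, and none of the constants depends on f.\<close>
    have "mod_norm g q p (hermite_mult m f) \<le> ennreal (K1 * ?V) * mod_norm gauss_window q p (hermite_mult m f)"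
      by (rule mod_norm_transfer[OF q1 p1 b(1) _ _ step1 Kpos(1)]) auto
    also have "mod_norm gauss_window q p (hermite_mult m f) \<le> ennreal (K2 * ?V) * mod_norm gauss_window q p f"
      by (rule mod_norm_transfer[OF q1 p1 b(1) _ _ step2 Kpos(2)]) auto
    also have "mod_norm gauss_window q p f \<le> ennreal (K3 * ?V) * mod_norm g q p f"
      by (rule mod_norm_transfer[OF q1 p1 b(1) _ _ step3 Kpos(3)]) auto
    finally have "mod_norm g q p (hermite_mult m f) \<le> ennreal (K1 * ?V) * (ennreal (K2 * ?V) * (ennreal (K3 * ?V) * mod_norm g q p f))"
      by (simp add: mult_left_mono)
    also have "\<dots> = ennreal ((K1 * ?V) * ((K2 * ?V) * (K3 * ?V))) * mod_norm g q p f"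
      using Kpos by (simp add: ennreal_mult mult_ac)
    finally show ?thesis .
  qed
  then show ?thesis by blast
qed

end
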